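(* Let $M^n$ be a compact smooth manifold without boundary, and let $X: M\times[0,T)\to\mathbb{R}^{n+1}$ be a smooth family of embeddings satisfying $$\frac{\partial X}{\partial t}=-F\nu,$$ where $\nu$ is the outward unit normal and the speed $F(x,t)=f(\kappa_1(x,t),\dots,\kappa_n(x,t))$ is given by a smooth, symmetric, homogeneous degree one, monotone increasing function $f$ of the principal curvatures, defined on a convex cone $\Gamma\subset\mathbb{R}^n$ containing the positive ray (the principal curvatures of the solution lying in $\Gamma$). Suppose that $F$ is positive, i.e. $F(x,t)>0$ for all $(x,t)\in M\times[0,T)$. (i) If $f$ is convex, then $\inf_{x\in M}\frac{\underline{Z}(x,t)}{F(x,t)}$ is non-decreasing in $t$. (ii) If $f$ is concave, then $\sup_{x\in M}\frac{\overline{Z}(x,t)}{F(x,t)}$ is non-increasing in $t$.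
   Context: Orientation: $\nu(x,t)$ is the unit normal pointing out of the compact region $\Omega_t\subset\mathbb{R}^{n+1}$ with $\partial\Omega_t=X(M,t)$. The second fundamental form is $h_{ij}=-\langle \partial_i\partial_j X,\nu\rangle$ (so round spheres have positive principal curvatures), and the principal curvatures $\kappa_1,\dots,\kappa_n$ are its eigenvalues with respect to the metric induced by $X(\cdot,t)$. Speed: $\Gamma$ is an open convex cone, invariant under permutations of coordinates, containing the ray $\{(s,\dots,s): s>0\}$; $f:\Gamma\to\mathbb{R}$ is smooth, symmetric, homogeneous of degree one and monotone increasing in each variable. For $x\neq y$ in $M$ and $t\in[0,T)$ define $$Z(x,y,t)=\frac{2\langle X(x,t)-X(y,t),\nu(x,t)\rangle}{\|X(x,t)-X(y,t)\|^2}.$$ The interior sphere curvature is $\overline{Z}(x,t)=\sup\{Z(x,y,t): y\in M,\ y\ne x\}$ and the exterior sphere curvature is $\underline{Z}(x,t)=\inf\{Z(x,y,t): y\in M,\ y\ne x\}$. *)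

theory Defs
  imports "HOL-Analysis.Analysis"
begin

section \<open>Smooth maps\<close>

text \<open>Only meaningful for open \<open>S\<close>, since the derivatives are taken in the ambient space.\<close>

primrec Ck_on :: "nat \<Rightarrow> 'a::euclidean_space set \<Rightarrow> ('a \<Rightarrow> 'b::real_normed_vector) \<Rightarrow> bool" where
  "Ck_on 0 S f \<longleftrightarrow> continuous_on S f"
| "Ck_on (Suc k) S f \<longleftrightarrow>
     (\<forall>x\<in>S. f differentiable (at x)) \<and>
     (\<forall>v. Ck_on k S (\<lambda>x. frechet_derivative f (at x) v))"

text \<open>On an arbitrary set, smoothness means that there are local smooth extensions to open sets.
  This is needed for the initial time, where the domain is not open. On open sets it is
  the usual notion.\<close>

definition smooth_on :: "'a::euclidean_space set \<Rightarrow> ('a \<Rightarrow> 'b::real_normed_vector) \<Rightarrow> bool" where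
  "smooth_on S f \<longleftrightarrow>
     (\<forall>p\<in>S. \<exists>W g. open W \<and> p \<in> W \<and> (\<forall>k. Ck_on k W g) \<and> (\<forall>q\<in>W \<inter> S. g q = f q))"

definition partial_deriv :: "'n::finite \<Rightarrow> (real^'n \<Rightarrow> 'b::real_normed_vector) \<Rightarrow> real^'n \<Rightarrow> 'b" where
  "partial_deriv i f p = frechet_derivative f (at p) (axis i 1)"


section \<open>Smooth manifolds without boundary, and embeddings\<close>

text \<open>The manifold is a whole type \<open>'m\<close>, of dimension \<open>CARD('n)\<close>. A chart is a pair of an open
  set of \<open>'m\<close> and a coordinate map on it; values of the coordinate map outside that set are
  irrelevant. The atlas is not required to be maximal. The type is Hausdorff
  by its sort; second countability is automatic when it is compact.\<close>

type_synonym ('m, 'n) chart = "'m set \<times> ('m \<Rightarrow> real^'n)"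

definition is_chart :: "('m::t2_space, 'n::finite) chart \<Rightarrow> bool" where
  "is_chart = (\<lambda>(U, \<phi>). open U \<and> open (\<phi> ` U) \<and> homeomorphism U (\<phi> ` U) \<phi> (inv_into U \<phi>))"

definition smooth_atlas :: "('m::t2_space, 'n::finite) chart set \<Rightarrow> bool" where
  "smooth_atlas A \<longleftrightarrow>
     (\<forall>c\<in>A. is_chart c) \<and>
     (\<Union>(U, \<phi>)\<in>A. U) = UNIV \<and>
     (\<forall>(U, \<phi>)\<in>A. \<forall>(V, \<psi>)\<in>A. smooth_on (\<phi> ` (U \<inter> V)) (\<lambda>p. \<psi> (inv_into U \<phi> p)))"

definition local_rep :: "('m, 'n::finite) chart \<Rightarrow> ('m \<Rightarrow> 'b) \<Rightarrow> real^'n \<Rightarrow> 'b" where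
  "local_rep c Y = (\<lambda>p. Y (inv_into (fst c) (snd c) p))"

definition time_interval :: "ereal \<Rightarrow> real set" where
  "time_interval T = {t. 0 \<le> t \<and> ereal t < T}"

definition smooth_family ::
    "('m::t2_space, 'n::finite) chart set \<Rightarrow> ereal \<Rightarrow> ('m \<Rightarrow> real \<Rightarrow> 'b::real_normed_vector) \<Rightarrow> bool" where
  "smooth_family A T X \<longleftrightarrow>
     (\<forall>(U, \<phi>)\<in>A. smooth_on (\<phi> ` U \<times> time_interval T)
        (\<lambda>(p, t). local_rep (U, \<phi>) (\<lambda>x. X x t) p))"

definition smooth_embedding ::
    "('m::t2_space, 'n::finite) chart set \<Rightarrow> ('m \<Rightarrow> 'b::real_normed_vector) \<Rightarrow> bool" where
  "smooth_embedding A Y \<longleftrightarrow>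
     (\<forall>(U, \<phi>)\<in>A. smooth_on (\<phi> ` U) (local_rep (U, \<phi>) Y) \<and>
        (\<forall>p\<in>\<phi> ` U. inj (frechet_derivative (local_rep (U, \<phi>) Y) (at p)))) \<and>
     embedding_map euclidean euclidean Y"


section \<open>Geometry of hypersurfaces\<close>

text \<open>Regularity (\<open>closure (interior \<Omega>) = \<Omega>\<close>) is part of what it means to be a region: without it,
  a ball together with a larger concentric sphere would be bounded by two spheres.\<close>

definition compact_region_bounded_by :: "'e::euclidean_space set \<Rightarrow> 'e set \<Rightarrow> bool" where
  "compact_region_bounded_by \<Omega> S \<longleftrightarrow>
     compact \<Omega> \<and> closure (interior \<Omega>) = \<Omega> \<and> frontier \<Omega> = S"

definition outward_unit_normal ::
    "('m::t2_space, 'n::finite) chart set \<Rightarrow> ('m \<Rightarrow> 'e::euclidean_space) \<Rightarrow> 'e set \<Rightarrow> 'm \<Rightarrow> 'e \<Rightarrow> bool" where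
  "outward_unit_normal A Y \<Omega> x v \<longleftrightarrow>
     norm v = 1 \<and>
     (\<forall>(U, \<phi>)\<in>A. x \<in> U \<longrightarrow> (\<forall>i. partial_deriv i (local_rep (U, \<phi>) Y) (\<phi> x) \<bullet> v = 0)) \<and>
     (\<exists>\<epsilon>>0. \<forall>s. 0 < s \<and> s < \<epsilon> \<longrightarrow> Y x + s *\<^sub>R v \<notin> \<Omega>)"

definition metric_matrix :: "(real^'n::finite \<Rightarrow> 'e::euclidean_space) \<Rightarrow> real^'n \<Rightarrow> real^'n^'n" where
  "metric_matrix Y p = (\<chi> i j. partial_deriv i Y p \<bullet> partial_deriv j Y p)"

definition second_fundamental_matrix ::
    "(real^'n::finite \<Rightarrow> 'e::euclidean_space) \<Rightarrow> 'e \<Rightarrow> real^'n \<Rightarrow> real^'n^'n" where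
  "second_fundamental_matrix Y v p = (\<chi> i j. - (partial_deriv i (partial_deriv j Y) p \<bullet> v))"

text \<open>The entries of \<open>k\<close> are the eigenvalues of \<open>h\<close> with respect to \<open>g\<close>, with multiplicity, in some
  order: there is a basis of eigenvectors.\<close>

definition eigenvalues_wrt :: "real^'n^'n \<Rightarrow> real^'n^'n \<Rightarrow> real^'n::finite \<Rightarrow> bool" where
  "eigenvalues_wrt g h k \<longleftrightarrow>
     (\<exists>e :: 'n \<Rightarrow> real^'n. inj e \<and> independent (range e) \<and>
        (\<forall>i. h *v e i = (k $ i) *\<^sub>R (g *v e i)))"

definition principal_curvatures ::
    "('m::t2_space, 'n::finite) chart set \<Rightarrow> ('m \<Rightarrow> 'e::euclidean_space) \<Rightarrow> 'e \<Rightarrow> 'm \<Rightarrow> real^'n \<Rightarrow> bool" where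
  "principal_curvatures A Y v x k \<longleftrightarrow>
     (\<forall>(U, \<phi>)\<in>A. x \<in> U \<longrightarrow>
        eigenvalues_wrt (metric_matrix (local_rep (U, \<phi>) Y) (\<phi> x))
          (second_fundamental_matrix (local_rep (U, \<phi>) Y) v (\<phi> x)) k)"


section \<open>Speed functions\<close>

text \<open>The library's \<open>cone\<close> and \<open>conic\<close> require nonempty cones to contain \<open>0\<close>, which an open proper
  cone does not.\<close>

definition admissible_cone :: "(real^'n::finite) set \<Rightarrow> bool" where
  "admissible_cone \<Gamma> \<longleftrightarrow>
     open \<Gamma> \<and> convex \<Gamma> \<and>
     (\<forall>z\<in>\<Gamma>. \<forall>c>0. c *\<^sub>R z \<in> \<Gamma>) \<and>
     (\<forall>z\<in>\<Gamma>. \<forall>\<pi>. bij \<pi> \<longrightarrow> (\<chi> i. z $ \<pi> i) \<in> \<Gamma>) \<and>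
     (\<forall>s>0. (\<chi> i. s) \<in> \<Gamma>)"

definition admissible_speed :: "(real^'n::finite) set \<Rightarrow> (real^'n \<Rightarrow> real) \<Rightarrow> bool" where
  "admissible_speed \<Gamma> f \<longleftrightarrow>
     smooth_on \<Gamma> f \<and>
     (\<forall>z\<in>\<Gamma>. \<forall>\<pi>. bij \<pi> \<longrightarrow> f (\<chi> i. z $ \<pi> i) = f z) \<and>
     (\<forall>z\<in>\<Gamma>. \<forall>c>0. f (c *\<^sub>R z) = c * f z) \<and>
     (\<forall>z\<in>\<Gamma>. \<forall>i. \<forall>s\<ge>0. z + axis i s \<in> \<Gamma> \<longrightarrow> f z \<le> f (z + axis i s))"


section \<open>Sphere curvatures\<close>

definition ball_curvature :: "('m \<Rightarrow> real \<Rightarrow> 'e::euclidean_space) \<Rightarrow> ('m \<Rightarrow> real \<Rightarrow> 'e) \<Rightarrow> 'm \<Rightarrow> 'm \<Rightarrow> real \<Rightarrow> real" where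
  "ball_curvature X \<nu> x y t = 2 * ((X x t - X y t) \<bullet> \<nu> x t) / (norm (X x t - X y t))\<^sup>2"

text \<open>The supremum and infimum are real valued: for a smooth compact embedded hypersurface of
  positive dimension, \<open>ball_curvature\<close> is bounded over all pairs of distinct points, and there are
  such pairs.\<close>

definition interior_sphere_curvature :: "('m \<Rightarrow> real \<Rightarrow> 'e::euclidean_space) \<Rightarrow> ('m \<Rightarrow> real \<Rightarrow> 'e) \<Rightarrow> 'm \<Rightarrow> real \<Rightarrow> real" where
  "interior_sphere_curvature X \<nu> x t = (SUP y\<in>-{x}. ball_curvature X \<nu> x y t)"

definition exterior_sphere_curvature :: "('m \<Rightarrow> real \<Rightarrow> 'e::euclidean_space) \<Rightarrow> ('m \<Rightarrow> real \<Rightarrow> 'e) \<Rightarrow> 'm \<Rightarrow> real \<Rightarrow> real" where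
  "exterior_sphere_curvature X \<nu> x t = (INF y\<in>-{x}. ball_curvature X \<nu> x y t)"

end

theory Submission
  imports Defs
begin

text \<open>
  With \<open>d = X y t - X x t\<close>, the sphere curvature bound with constant \<open>K\<close> says that
  \<open>W(x,y,t) = K F(x,t) |d|\<^sup>2 / 2 + \<langle>d, \<nu>(x,t)\<rangle>\<close> has a fixed sign \<open>\<epsilon>\<close> (\<open>\<epsilon> = 1\<close> for concave, \<open>\<epsilon> = -1\<close> for convex
  speeds). The function \<open>W\<close> is smooth on \<open>M \<times> M\<close> and vanishes on the diagonal, so \<open>\<epsilon> W + \<theta>(t)\<close> with
  \<open>\<theta>(t) = \<delta> exp(L t)\<close> can vanish for the first time only at some \<open>x \<noteq> y\<close>. There the first order
  conditions make the reflection of the tangent space at \<open>x\<close> in (almost) the bisector of the chord the tangent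
  space at \<open>y\<close>. Let \<open>e\<^sub>i\<close> be principal directions at \<open>x\<close>, \<open>e'\<^sub>i\<close> their reflections and \<open>a = Df(\<kappa>(x,t))\<close>.
  The second variation of \<open>W\<close> in the directions \<open>(e\<^sub>i, \<sigma>\<^sub>i e'\<^sub>i)\<close>, weighted with \<open>a\<^sub>i\<close>, contradicts the time
  derivative of \<open>W\<close> if \<open>\<sigma>\<^sub>i\<close> is \<open>1\<close> or \<open>-1\<close> according to the sign of \<open>\<epsilon> (K F - \<kappa>\<^sub>i)\<close>. This choice of signs replaces
  the separate treatment of the boundary case where the supremum is the largest principal curvature.

  Neither the smoothness of \<open>\<nu>\<close> and \<open>F\<close> nor derivatives of \<open>f\<close> as a function of matrices need a proof:
  \<open>\<partial>X/\<partial>t = - F \<nu>\<close> with \<open>F > 0\<close> gives \<open>F = |\<partial>X/\<partial>t|\<close> and \<open>\<nu> = - \<partial>X/\<partial>t / F\<close>, and Jensen's inequality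
  \<open>\<epsilon> F \<le> \<epsilon> \<Sum>\<^sub>i a\<^sub>i h(w\<^sub>i, w\<^sub>i)\<close> for orthonormal frames \<open>w\<close>, an equality at \<open>(x,t)\<close> for \<open>w = e\<close>, determines
  the first derivatives of \<open>F\<close> there.
\<close>

section \<open>Doubly stochastic matrices\<close>

text \<open>For each fixed \<open>K\<close> the sign of W is shown to persist in time; taking
  \<open>K\<close> to be the extremal ratio at the earlier time then gives both monotonicity claims.
  The price of the strict barrier \<theta> is that a touching pair has W = - \<epsilon> \<theta>
  instead of W = 0, so the reflection is only nearly the one in the bisector. The estimate |W| <= C
  |d|^2, uniform on a compact time interval, makes this harmless: at touching \<theta> <= C |d|^2,
  so errors of size \<theta>^2 / |d|^2 are at most C \<theta>, however close x and y are, and a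
  large \<open>L\<close> absorbs them. With k = K F, the first order condition in y reads k d +
  \<nu> = \<rho> \<nu>', where \<rho>^2 = 1 + 2 k W. It leaves the sign of \<rho> open. A value near
  -1 would mean a comparison sphere that touches the hypersurface from inside at one point and from
  outside at the other; this is excluded by topology, using the enclosed region. The curvatures are
  only a pointwise choice of eigenvalues in some order, so bounds for them come from compactness of
  orthonormal eigenframes.\<close>

lemma doubly_stochastic_rearrangement:
  fixes S :: "'a \<Rightarrow> 'b \<Rightarrow> real" and a :: "'a \<Rightarrow> real" and l :: "'b \<Rightarrow> real"
  assumes "finite I" "finite J" "card I = card J"
    and "\<And>i j. i \<in> I \<Longrightarrow> j \<in> J \<Longrightarrow> 0 \<le> S i j"
    and "\<And>i. i \<in> I \<Longrightarrow> (\<Sum>j\<in>J. S i j) = 1"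
    and "\<And>j. j \<in> J \<Longrightarrow> (\<Sum>i\<in>I. S i j) = 1"
  shows "\<exists>\<pi>. bij_betw \<pi> I J \<and> (\<Sum>i\<in>I. a i * l (\<pi> i)) \<le> (\<Sum>i\<in>I. \<Sum>j\<in>J. a i * S i j * l j)"
  using assms
\<comment> \<open>A linear functional on doubly stochastic matrices is minimal at a permutation. The
  induction pairs the largest \<open>a i0\<close> with the smallest \<open>l j0\<close> and moves
  all mass of that row and column there; no decomposition of \<open>S\<close> into permutations is
  built.\<close>
proof (induction "card I" arbitrary: I J S)
  case 0
  then have "I = {}" "J = {}" by auto
  then show ?case by (auto simp: bij_betw_def)
next
  case (Suc n)
  have ne: "I \<noteq> {}" "J \<noteq> {}" using Suc.hyps(2) Suc.prems(3) by auto
  obtain i0 where i0: "i0 \<in> I" "\<And>i. i \<in> I \<Longrightarrow> a i \<le> a i0"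
    using ex_is_arg_min_if_finite[OF Suc.prems(1) ne(1), of "\<lambda>i. - a i"] by (auto simp: is_arg_min_linorder)
  obtain j0 where j0: "j0 \<in> J" "\<And>j. j \<in> J \<Longrightarrow> l j0 \<le> l j"
    using ex_is_arg_min_if_finite[OF Suc.prems(2) ne(2), of l] by (auto simp: is_arg_min_linorder)
  define I' where "I' = I - {i0}"
  define J' where "J' = J - {j0}"
  have fin: "finite I'" "finite J'" using Suc.prems by (auto simp: I'_def J'_def)
  have sub: "\<And>i. i \<in> I' \<Longrightarrow> i \<in> I" "\<And>j. j \<in> J' \<Longrightarrow> j \<in> J" by (auto simp: I'_def J'_def)
  have splitI: "(\<Sum>i\<in>I. g i) = g i0 + (\<Sum>i\<in>I'. g i)" for g :: "'a \<Rightarrow> real"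
    unfolding I'_def using Suc.prems(1) i0(1) by (simp add: sum.remove)
  have splitJ: "(\<Sum>j\<in>J. g j) = g j0 + (\<Sum>j\<in>J'. g j)" for g :: "'b \<Rightarrow> real"
    unfolding J'_def using Suc.prems(2) j0(1) by (simp add: sum.remove)
  define s where "s = S i0 j0"
  \<comment> \<open>Deleting row \<open>i0\<close> and column \<open>j0\<close> leaves the row sums
    short by \<open>S i j0\<close> and the column sums short by \<open>S i0 j\<close>;
    \<open>U\<close> is the product matrix with exactly these marginals. For \<open>s = 1\<close>
    the quotient is 0 by convention, which is right, since \<open>z1\<close> and \<open>z2\<close>
    make the missing entries vanish.\<close>
  define U where "U i j = S i j0 * S i0 j / (1 - s)" for i j
  have row0: "(\<Sum>j\<in>J'. S i0 j) = 1 - s" using Suc.prems(5)[OF i0(1)] splitJ[of "S i0"] by (simp add: s_def)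
  have col0: "(\<Sum>i\<in>I'. S i j0) = 1 - s"
    using Suc.prems(6)[OF j0(1)] splitI[of "\<lambda>i. S i j0"] by (simp add: s_def)
  have nn: "0 \<le> S i j0" "0 \<le> S i0 j" if "i \<in> I'" "j \<in> J'" for i j
    using Suc.prems(4) sub i0 j0 that by blast+
  have s1: "s \<le> 1"
  proof -
    have "0 \<le> (\<Sum>j\<in>J'. S i0 j)" by (rule sum_nonneg) (use Suc.prems(4) sub i0 in blast)
    then show ?thesis using row0 by simp
  qed
  have z1: "S i j0 = 0" if "s = 1" "i \<in> I'" for i
  proof -
    have "(\<Sum>i\<in>I'. S i j0) = 0" using col0 that by simp
    then show ?thesis using sum_nonneg_eq_0_iff[of I' "\<lambda>i. S i j0"] fin that
      Suc.prems(4) sub j0 by auto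
  qed
  have z2: "S i0 j = 0" if "s = 1" "j \<in> J'" for j
  proof -
    have "(\<Sum>j\<in>J'. S i0 j) = 0" using row0 that by simp
    then show ?thesis using sum_nonneg_eq_0_iff[of J' "S i0"] fin that
      Suc.prems(4) sub i0 by auto
  qed
  have rowU: "(\<Sum>j\<in>J'. U i j) = S i j0" if "i \<in> I'" for i
  proof -
    have "(\<Sum>j\<in>J'. U i j) = S i j0 * (\<Sum>j\<in>J'. S i0 j) / (1 - s)"
      by (simp add: U_def sum_distrib_left sum_divide_distrib)
    then show ?thesis using row0 z1[OF _ that] by (cases "s = 1") auto
  qed
  have colU: "(\<Sum>i\<in>I'. U i j) = S i0 j" if "j \<in> J'" for j
  proof -
    have "(\<Sum>i\<in>I'. U i j) = (\<Sum>i\<in>I'. S i j0) * S i0 j / (1 - s)"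
      by (simp add: U_def sum_distrib_right sum_divide_distrib)
    then show ?thesis using col0 z2[OF _ that] by (cases "s = 1") auto
  qed
  have Unn: "0 \<le> U i j" if "i \<in> I'" "j \<in> J'" for i j
    using nn that s1 by (auto simp: U_def)
  define S' where "S' i j = S i j + U i j" for i j
  have "\<exists>\<pi>. bij_betw \<pi> I' J' \<and> (\<Sum>i\<in>I'. a i * l (\<pi> i)) \<le> (\<Sum>i\<in>I'. \<Sum>j\<in>J'. a i * S' i j * l j)"
  proof (rule Suc.hyps(1))
    show "n = card I'" using Suc.hyps(2) Suc.prems(1) i0(1) by (simp add: I'_def)
    show "card I' = card J'" using Suc.prems(1-3) i0(1) j0(1) by (simp add: I'_def J'_def)
    show "0 \<le> S' i j" if "i \<in> I'" "j \<in> J'" for i j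
      using Unn[OF that] Suc.prems(4) sub that by (force simp: S'_def)
    show "(\<Sum>j\<in>J'. S' i j) = 1" if "i \<in> I'" for i
      using Suc.prems(5)[OF sub(1)[OF that]] splitJ[of "S i"] rowU[OF that]
      by (simp add: S'_def sum.distrib)
    show "(\<Sum>i\<in>I'. S' i j) = 1" if "j \<in> J'" for j
      using Suc.prems(6)[OF sub(2)[OF that]] splitI[of "\<lambda>i. S i j"] colU[OF that]
      by (simp add: S'_def sum.distrib)
  qed (use fin in auto)
  then obtain \<pi> where \<pi>: "bij_betw \<pi> I' J'"
    "(\<Sum>i\<in>I'. a i * l (\<pi> i)) \<le> (\<Sum>i\<in>I'. \<Sum>j\<in>J'. a i * S' i j * l j)" by blast
  define \<rho> where "\<rho> = \<pi>(i0 := j0)"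
  have II: "I = insert i0 I'" "J = insert j0 J'" using i0 j0 by (auto simp: I'_def J'_def)
  have b: "bij_betw \<rho> I J"
  proof -
    have "bij_betw \<rho> I' J'" using \<pi>(1) bij_betw_cong[of I' \<rho> \<pi> J'] by (auto simp: \<rho>_def I'_def)
    then have "bij_betw \<rho> (I' \<union> {i0}) (J' \<union> {\<rho> i0})"
      by (rule notIn_Un_bij_betw[rotated 2]) (auto simp: I'_def \<rho>_def J'_def)
    then show ?thesis using II by (simp add: \<rho>_def)
  qed
  have e1: "(\<Sum>i\<in>I. a i * l (\<rho> i)) = a i0 * l j0 + (\<Sum>i\<in>I'. a i * l (\<pi> i))"
    unfolding splitI by (auto simp: \<rho>_def I'_def intro!: sum.cong)
  have e2: "(\<Sum>i\<in>I. \<Sum>j\<in>J. a i * S i j * l j) =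
     a i0 * s * l j0 + (\<Sum>j\<in>J'. a i0 * S i0 j * l j) + (\<Sum>i\<in>I'. a i * S i j0 * l j0)
       + (\<Sum>i\<in>I'. \<Sum>j\<in>J'. a i * S i j * l j)"
    unfolding splitI splitJ by (simp add: sum.distrib s_def)
  have e3: "(\<Sum>i\<in>I'. \<Sum>j\<in>J'. a i * S' i j * l j) =
     (\<Sum>i\<in>I'. \<Sum>j\<in>J'. a i * S i j * l j) + (\<Sum>i\<in>I'. \<Sum>j\<in>J'. a i * U i j * l j)"
    by (simp add: S'_def algebra_simps sum.distrib)
  have f1: "(\<Sum>j\<in>J'. a i0 * S i0 j * l j) = (\<Sum>i\<in>I'. \<Sum>j\<in>J'. a i0 * U i j * l j)"
  proof -
    have "(\<Sum>i\<in>I'. \<Sum>j\<in>J'. a i0 * U i j * l j) = (\<Sum>j\<in>J'. \<Sum>i\<in>I'. a i0 * U i j * l j)" by (rule sum.swap)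
    also have "\<dots> = (\<Sum>j\<in>J'. a i0 * (\<Sum>i\<in>I'. U i j) * l j)"
      by (simp add: sum_distrib_left sum_distrib_right)
    finally show ?thesis by (simp add: colU)
  qed
  have f2: "(\<Sum>i\<in>I'. a i * S i j0 * l j0) = (\<Sum>i\<in>I'. \<Sum>j\<in>J'. a i * U i j * l j0)"
  proof -
    have "(\<Sum>i\<in>I'. \<Sum>j\<in>J'. a i * U i j * l j0) = (\<Sum>i\<in>I'. a i * (\<Sum>j\<in>J'. U i j) * l j0)"
      by (simp add: sum_distrib_left sum_distrib_right)
    then show ?thesis by (simp add: rowU)
  qed
  have f3: "a i0 * l j0 - a i0 * s * l j0 = (\<Sum>i\<in>I'. \<Sum>j\<in>J'. a i0 * U i j * l j0)"
  proof -
    have "(\<Sum>i\<in>I'. \<Sum>j\<in>J'. a i0 * U i j * l j0) = (\<Sum>i\<in>I'. a i0 * (\<Sum>j\<in>J'. U i j) * l j0)"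
      by (simp add: sum_distrib_left sum_distrib_right)
    also have "\<dots> = a i0 * (\<Sum>i\<in>I'. S i j0) * l j0"
      by (simp add: rowU sum_distrib_left sum_distrib_right)
    finally show ?thesis using col0 by (simp add: algebra_simps)
  qed
  \<comment> \<open>The exact decrease of the functional under the exchange: mass
    \<open>U i j\<close> is taken from (i, j0) and (i0, j) and put on (i, j) and (i0, j0).\<close>
  have "0 \<le> (\<Sum>i\<in>I'. \<Sum>j\<in>J'. U i j * ((a i0 - a i) * (l j - l j0)))"
    by (intro sum_nonneg mult_nonneg_nonneg Unn) (use i0 j0 sub in auto)
  also have "\<dots> = (\<Sum>i\<in>I'. \<Sum>j\<in>J'. a i0 * U i j * l j) + (\<Sum>i\<in>I'. \<Sum>j\<in>J'. a i * U i j * l j0)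
      - (\<Sum>i\<in>I'. \<Sum>j\<in>J'. a i0 * U i j * l j0) - (\<Sum>i\<in>I'. \<Sum>j\<in>J'. a i * U i j * l j)"
    by (simp add: algebra_simps sum.distrib sum_subtractf)
  finally have "(\<Sum>i\<in>I. a i * l (\<rho> i)) \<le> (\<Sum>i\<in>I. \<Sum>j\<in>J. a i * S i j * l j)"
    using e1 e2 e3 f1 f2 f3 \<pi>(2) by linarith
  then show ?case using b by blast
qed

text \<open>One half of the Hardy-Littlewood-Polya theorem. A hyperplane separating the point from
  the hull would have a coefficient vector that violates the rearrangement inequality. It serves to
  keep diagonals of the second fundamental form inside the convex symmetric cone.\<close>

lemma doubly_stochastic_hull:
  fixes S :: "'n::finite \<Rightarrow> 'n \<Rightarrow> real" and z :: "real^'n"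
  assumes "\<And>i j. 0 \<le> S i j" "\<And>i. (\<Sum>j\<in>UNIV. S i j) = 1" "\<And>j. (\<Sum>i\<in>UNIV. S i j) = 1"
  shows "(\<chi> i. \<Sum>j\<in>UNIV. S i j * z $ j) \<in> convex hull {\<chi> i. z $ \<pi> i |\<pi>. bij \<pi>}"
proof (rule ccontr)
  define w where "w = (\<chi> i. \<Sum>j\<in>UNIV. S i j * z $ j)"
  define P where "P = (\<lambda>\<pi> :: 'n \<Rightarrow> 'n. \<chi> i. z $ \<pi> i) ` {\<pi>. bij \<pi>}"
  have P: "{\<chi> i. z $ \<pi> i |\<pi>. bij \<pi>} = P" by (auto simp: P_def)
  have "finite P" unfolding P_def by (rule finite_imageI) (rule finite)
  then have "closed (convex hull P)" by (intro compact_imp_closed compact_convex_hull finite_imp_compact)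
  moreover assume "(\<chi> i. \<Sum>j\<in>UNIV. S i j * z $ j) \<notin> convex hull {\<chi> i. z $ \<pi> i |\<pi>. bij \<pi>}"
  then have "w \<notin> convex hull P" by (simp add: w_def P)
  ultimately obtain a b where ab: "a \<bullet> w < b" "\<forall>x\<in>convex hull P. a \<bullet> x > b"
    using separating_hyperplane_closed_point[of "convex hull P" w] convex_convex_hull by blast
  have "\<exists>\<pi>. bij_betw \<pi> UNIV UNIV \<and> (\<Sum>i\<in>UNIV. a $ i * z $ \<pi> i) \<le> (\<Sum>i\<in>UNIV. \<Sum>j\<in>UNIV. a $ i * S i j * z $ j)"
    by (rule doubly_stochastic_rearrangement) (simp_all add: assms)
  then obtain \<pi> where \<pi>: "bij \<pi>" "(\<Sum>i\<in>UNIV. a $ i * z $ \<pi> i) \<le> (\<Sum>i\<in>UNIV. \<Sum>j\<in>UNIV. a $ i * S i j * z $ j)"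
    by blast
  have "(\<chi> i. z $ \<pi> i) \<in> convex hull P" by (rule hull_inc) (use \<pi> in \<open>auto simp: P_def\<close>)
  then have "b < a \<bullet> (\<chi> i. z $ \<pi> i)" using ab by blast
  also have "\<dots> = (\<Sum>i\<in>UNIV. a $ i * z $ \<pi> i)" by (simp add: inner_vec_def)
  also note \<pi>(2)
  also have "(\<Sum>i\<in>UNIV. \<Sum>j\<in>UNIV. a $ i * S i j * z $ j) = a \<bullet> w"
    by (simp add: w_def inner_vec_def sum_distrib_left mult.assoc)
  finally show False using ab by simp
qed

text \<open>The set \<open>C\<close> of a topological space need not be sequentially compact; the parameter \<open>m\<close> plays
  the role of a radius or of the inverse of a bound.\<close>

lemma compact_uniform:
  fixes C :: "'a::topological_space set"
  assumes C: "compact C"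
    and loc: "\<And>z. z \<in> C \<Longrightarrow> \<exists>m>0. \<forall>\<^sub>F z' in inf (nhds z) (principal C). P m z'"
    and mono: "\<And>z m m'. P m z \<Longrightarrow> 0 < m' \<Longrightarrow> m' \<le> (m::real) \<Longrightarrow> P m' z"
  shows "\<exists>m>0. \<forall>z\<in>C. P m z"
proof -
  have "\<forall>z\<in>C. \<exists>m O'. 0 < m \<and> open O' \<and> z \<in> O' \<and> (\<forall>z'\<in>O' \<inter> C. P m z')"
    using loc by (fastforce simp: eventually_inf_principal eventually_nhds)
  then obtain m O' where mO: "\<And>z. z \<in> C \<Longrightarrow> 0 < m z \<and> open (O' z) \<and> z \<in> O' z \<and> (\<forall>z'\<in>O' z \<inter> C. P (m z) z')"
    by metis
  obtain D where D: "D \<subseteq> C" "finite D" "C \<subseteq> (\<Union>z\<in>D. O' z)"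
    using compactE_image[OF C, of C O'] mO by blast
  define M where "M = Min (insert 1 (m ` D))"
  have M: "0 < M" using D mO by (auto simp: M_def Min_gr_iff)
  have "P M z" if z: "z \<in> C" for z
  proof -
    obtain w where w: "w \<in> D" "z \<in> O' w" using D z by blast
    then have "P (m w) z" using mO D z by blast
    moreover have "M \<le> m w" using D w by (auto simp: M_def)
    ultimately show ?thesis using mono M by blast
  qed
  then show ?thesis using M by blast
qed

section \<open>Directional derivatives\<close>

text \<open>With the direction first, \<open>dd v\<close> is an operator on functions and can be
  iterated, as in \<open>dd u (dd v f)\<close>.\<close>

definition dd :: "'a::euclidean_space \<Rightarrow> ('a \<Rightarrow> 'b::real_normed_vector) \<Rightarrow> 'a \<Rightarrow> 'b" where
  "dd v f z = frechet_derivative f (at z) v"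

lemma Ck_on_Suc_dd: "Ck_on (Suc k) S f \<longleftrightarrow> (\<forall>x\<in>S. f differentiable (at x)) \<and> (\<forall>v. Ck_on k S (dd v f))"
  by (simp add: dd_def[abs_def])

lemma has_derivative_dd: "f differentiable (at z) \<Longrightarrow> (f has_derivative (\<lambda>v. dd v f z)) (at z)"
  unfolding dd_def using frechet_derivative_works by blast

lemma dd_eqI: "(f has_derivative f') (at z) \<Longrightarrow> dd v f z = f' v"
  by (metis dd_def frechet_derivative_at)

lemma linear_dd: "f differentiable (at z) \<Longrightarrow> linear (\<lambda>v. dd v f z)"
  using has_derivative_dd has_derivative_linear by blast

lemma dd_add: "f differentiable (at z) \<Longrightarrow> dd (u + v) f z = dd u f z + dd v f z"
  by (rule linear_add[OF linear_dd])

lemma dd_scale: "f differentiable (at z) \<Longrightarrow> dd (c *\<^sub>R v) f z = c *\<^sub>R dd v f z"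
  by (rule linear_scale[OF linear_dd])

lemma has_derivative_cong_open:
  assumes "open S" "z \<in> S" "\<And>w. w \<in> S \<Longrightarrow> f w = g w"
  shows "(f has_derivative D) (at z) \<longleftrightarrow> (g has_derivative D) (at z)"
proof
  show "(g has_derivative D) (at z)" if "(f has_derivative D) (at z)"
    by (rule has_derivative_transform_within_open[OF that assms])
  show "(f has_derivative D) (at z)" if "(g has_derivative D) (at z)"
    by (rule has_derivative_transform_within_open[OF that assms(1,2)]) (simp add: assms(3))
qed

lemma dd_cong_open:
  assumes "open S" "z \<in> S" "\<And>w. w \<in> S \<Longrightarrow> f w = g w"
  shows "dd v f z = dd v g z"
  unfolding dd_def frechet_derivative_def by (simp add: has_derivative_cong_open[OF assms])

lemma differentiable_cong_open:
  assumes "open S" "z \<in> S" "\<And>w. w \<in> S \<Longrightarrow> f w = g w"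
  shows "f differentiable (at z) \<longleftrightarrow> g differentiable (at z)"
  unfolding differentiable_def by (simp add: has_derivative_cong_open[OF assms])

section \<open>Closure properties of the classes C^k\<close>

lemma Ck_on_cong:
  assumes "open S" "\<And>w. w \<in> S \<Longrightarrow> f w = g w" "Ck_on k S f"
  shows "Ck_on k S g"
  using assms
proof (induction k arbitrary: f g)
  case 0
  then show ?case using continuous_on_cong[of S S f g] by auto
next
  case (Suc k)
  have "g differentiable (at x)" if "x \<in> S" for x
    using Suc.prems that differentiable_cong_open[of S x f g] by auto
  moreover have "Ck_on k S (dd v g)" for v
    using Suc.prems Suc.IH[of "dd v f" "dd v g"] dd_cong_open[of S _ f g v]
    by (auto simp: Ck_on_Suc_dd simp del: Ck_on.simps)
  ultimately show ?case by (simp add: Ck_on_Suc_dd del: Ck_on.simps)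
qed

lemma Ck_on_subset: "Ck_on k S f \<Longrightarrow> T \<subseteq> S \<Longrightarrow> Ck_on k T f"
  by (induction k arbitrary: f) (auto intro: continuous_on_subset)

lemma Ck_on_continuous: "Ck_on k S f \<Longrightarrow> continuous_on S f"
  by (cases k) (auto intro!: continuous_at_imp_continuous_on differentiable_imp_continuous_within)

lemma Ck_on_Suc_imp: "Ck_on (Suc k) S f \<Longrightarrow> Ck_on k S f"
proof (induction k arbitrary: f)
  case 0
  then show ?case using Ck_on_continuous by (metis Ck_on.simps(1))
next
  case (Suc k)
  then show ?case by (meson Ck_on.simps(2))
qed

lemma Ck_on_const: "Ck_on k S (\<lambda>x. c)"
proof (induction k arbitrary: c)
  case (Suc k)
  have "(\<lambda>x. dd v (\<lambda>x::'a. c) x) = (\<lambda>x. 0)" for v by (auto simp: dd_eqI[OF has_derivative_const])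
  then show ?case using Suc by (simp add: Ck_on_Suc_dd del: Ck_on.simps)
qed simp

lemma Ck_on_add:
  assumes "open S" "Ck_on k S f" "Ck_on k S g" shows "Ck_on k S (\<lambda>x. f x + g x)"
  using assms
proof (induction k arbitrary: f g)
  case 0 then show ?case by (auto intro: continuous_on_add)
next
  case (Suc k)
  have d: "((\<lambda>x. f x + g x) has_derivative (\<lambda>v. dd v f x + dd v g x)) (at x)" if "x \<in> S" for x
    using Suc.prems that by (auto intro!: has_derivative_add has_derivative_dd)
  have "Ck_on k S (dd v (\<lambda>x. f x + g x))" for v
  proof (rule Ck_on_cong)
    show "Ck_on k S (\<lambda>x. dd v f x + dd v g x)"
      using Suc by (simp add: Ck_on_Suc_dd del: Ck_on.simps)
  qed (use Suc.prems in \<open>simp_all add: dd_eqI[OF d]\<close>)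
  then show ?case using d by (auto simp: Ck_on_Suc_dd differentiable_def simp del: Ck_on.simps)
qed

lemma Ck_on_bilinear:
  assumes B: "bounded_bilinear B" and "open S" "Ck_on k S f" "Ck_on k S g"
  shows "Ck_on k S (\<lambda>x. B (f x) (g x))"
  using assms(2-)
proof (induction k arbitrary: f g)
  case 0 then show ?case by (auto intro: bounded_bilinear.continuous_on[OF B])
next
  case (Suc k)
  have d: "((\<lambda>x. B (f x) (g x)) has_derivative (\<lambda>v. B (f x) (dd v g x) + B (dd v f x) (g x))) (at x)"
    if "x \<in> S" for x
    using Suc.prems that by (auto intro!: bounded_bilinear.FDERIV[OF B] has_derivative_dd)
  have "Ck_on k S (dd v (\<lambda>x. B (f x) (g x)))" for v
  proof (rule Ck_on_cong)
    show "Ck_on k S (\<lambda>x. B (f x) (dd v g x) + B (dd v f x) (g x))"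
    proof (intro Ck_on_add Suc.IH)
      show "Ck_on k S f" "Ck_on k S g" using Suc.prems by (blast intro: Ck_on_Suc_imp)+
      show "Ck_on k S (dd v f)" "Ck_on k S (dd v g)"
        using Suc.prems by (auto simp: Ck_on_Suc_dd simp del: Ck_on.simps)
    qed (use Suc.prems in auto)
  qed (use Suc.prems in \<open>simp_all add: dd_eqI[OF d]\<close>)
  then show ?case using d by (auto simp: Ck_on_Suc_dd differentiable_def simp del: Ck_on.simps)
qed

lemma Ck_on_inverse:
  fixes f :: "'a::euclidean_space \<Rightarrow> real"
  assumes "open S" "Ck_on k S f" "\<And>x. x \<in> S \<Longrightarrow> f x \<noteq> 0"
  shows "Ck_on k S (\<lambda>x. inverse (f x))"
  using assms(2-)
proof (induction k)
  case 0 then show ?case by (auto intro: continuous_on_inverse)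
next
  case (Suc k)
  have d: "((\<lambda>x. inverse (f x)) has_derivative (\<lambda>v. - (inverse (f x) * dd v f x * inverse (f x)))) (at x)"
    if "x \<in> S" for x
    using Suc.prems that by (auto intro!: has_derivative_inverse' has_derivative_dd Deriv.has_derivative_inverse)
  have I: "Ck_on k S (\<lambda>x. inverse (f x))" using Suc Ck_on_Suc_imp by blast
  have "Ck_on k S (dd v (\<lambda>x. inverse (f x)))" for v
  proof (rule Ck_on_cong)
    have "Ck_on k S (\<lambda>x. (-1) * ((inverse (f x) * dd v f x) * inverse (f x)))"
      using Suc.prems I assms(1)
      by (intro Ck_on_bilinear[OF bounded_bilinear_mult] Ck_on_const) (auto simp: Ck_on_Suc_dd simp del: Ck_on.simps)
    then show "Ck_on k S (\<lambda>x. - (inverse (f x) * dd v f x * inverse (f x)))" by simp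
  qed (use assms(1) in \<open>simp_all add: dd_eqI[OF d]\<close>)
  then show ?case using d by (auto simp: Ck_on_Suc_dd differentiable_def simp del: Ck_on.simps)
qed

lemma Ck_on_sqrt:
  fixes f :: "'a::euclidean_space \<Rightarrow> real"
  assumes "open S" "Ck_on k S f" "\<And>x. x \<in> S \<Longrightarrow> f x > 0"
  shows "Ck_on k S (\<lambda>x. sqrt (f x))"
  using assms(2-)
proof (induction k)
  case 0 then show ?case by (auto intro: continuous_on_real_sqrt)
next
  case (Suc k)
  have d: "((\<lambda>x. sqrt (f x)) has_derivative (\<lambda>v. dd v f x * (inverse (sqrt (f x)) / 2))) (at x)"
    if "x \<in> S" for x
  proof -
    have "f differentiable (at x)" using Suc.prems that by simp
    then have "(f has_derivative (\<lambda>v. dd v f x)) (at x)" by (rule has_derivative_dd)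
    then show ?thesis using Suc.prems(2)[OF that] by (rule has_derivative_real_sqrt[rotated])
  qed
  have I: "Ck_on k S (\<lambda>x. sqrt (f x))" using Suc Ck_on_Suc_imp by blast
  have "Ck_on k S (dd v (\<lambda>x. sqrt (f x)))" for v
  proof (rule Ck_on_cong)
    have "Ck_on k S (\<lambda>x. inverse (sqrt (f x)))" by (rule Ck_on_inverse[OF assms(1) I]) (use Suc.prems in force)
    then have "Ck_on k S (\<lambda>x. (1/2) * (dd v f x * inverse (sqrt (f x))))"
      using Suc.prems assms(1)
      by (intro Ck_on_bilinear[OF bounded_bilinear_mult] Ck_on_const) (auto simp: Ck_on_Suc_dd simp del: Ck_on.simps)
    then show "Ck_on k S (\<lambda>x. dd v f x * (inverse (sqrt (f x)) / 2))" by (simp add: algebra_simps)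
  qed (use assms(1) in \<open>simp_all add: dd_eqI[OF d]\<close>)
  then show ?case using d by (auto simp: Ck_on_Suc_dd differentiable_def simp del: Ck_on.simps)
qed

lemma has_vector_derivative_dd_compose:
  assumes "f differentiable (at (c s))" "(c has_vector_derivative c') (at s within S)"
  shows "((\<lambda>s. f (c s)) has_vector_derivative dd c' f (c s)) (at s within S)"
  using vector_derivative_diff_chain_within[OF assms(2) has_derivative_at_withinI[OF has_derivative_dd[OF assms(1)]]]
  by (simp add: o_def)

section \<open>Second derivatives: symmetry, and jets along curves\<close>

lemma second_difference_mvt:
  fixes f :: "'a::euclidean_space \<Rightarrow> real"
  assumes s: "0 < s" and C2: "Ck_on 2 W f"
    and W: "\<And>a b. 0 \<le> a \<Longrightarrow> a \<le> s \<Longrightarrow> 0 \<le> b \<Longrightarrow> b \<le> s \<Longrightarrow> z + a *\<^sub>R u + b *\<^sub>R v \<in> W"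
  shows "\<exists>a b. 0 \<le> a \<and> a \<le> s \<and> 0 \<le> b \<and> b \<le> s \<and>
     f (z + s *\<^sub>R u + s *\<^sub>R v) - f (z + s *\<^sub>R u) - f (z + s *\<^sub>R v) + f z
       = s * (s * dd u (dd v f) (z + a *\<^sub>R u + b *\<^sub>R v))"
proof -
  have d1: "f differentiable (at x)" if "x \<in> W" for x
    using C2 that by (simp add: numeral_2_eq_2)
  have d2: "dd v f differentiable (at x)" if "x \<in> W" for x
    using C2 that by (simp add: numeral_2_eq_2 dd_def[abs_def])
  define \<phi> where "\<phi> b = f (z + s *\<^sub>R u + b *\<^sub>R v) - f (z + b *\<^sub>R v)" for b
  have D: "DERIV \<phi> b :> dd v f (z + s *\<^sub>R u + b *\<^sub>R v) - dd v f (z + b *\<^sub>R v)"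
    if "0 \<le> b" "b \<le> s" for b
  proof -
    have "z + s *\<^sub>R u + b *\<^sub>R v \<in> W" "z + b *\<^sub>R v \<in> W" using W[of s b] W[of 0 b] s that by auto
    then have "((\<lambda>b. f (z + s *\<^sub>R u + b *\<^sub>R v)) has_vector_derivative dd v f (z + s *\<^sub>R u + b *\<^sub>R v)) (at b)"
      "((\<lambda>b. f (z + b *\<^sub>R v)) has_vector_derivative dd v f (z + b *\<^sub>R v)) (at b)"
      by (auto intro!: has_vector_derivative_dd_compose d1 derivative_eq_intros)
    then show ?thesis
      unfolding \<phi>_def has_real_derivative_iff_has_vector_derivative by (rule has_vector_derivative_diff)
  qed
  obtain b where b: "0 < b" "b < s"
    "\<phi> s - \<phi> 0 = (s - 0) * (dd v f (z + s *\<^sub>R u + b *\<^sub>R v) - dd v f (z + b *\<^sub>R v))"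
    using MVT2[OF s, of \<phi> "\<lambda>b. dd v f (z + s *\<^sub>R u + b *\<^sub>R v) - dd v f (z + b *\<^sub>R v)", OF D] by metis
  have D2: "DERIV (\<lambda>a. dd v f (z + a *\<^sub>R u + b *\<^sub>R v)) a :> dd u (dd v f) (z + a *\<^sub>R u + b *\<^sub>R v)"
    if "0 \<le> a" "a \<le> s" for a
    unfolding has_real_derivative_iff_has_vector_derivative
    using W[of a b] that b
    by (auto intro!: has_vector_derivative_dd_compose[where f="dd v f"] d2 derivative_eq_intros)
  obtain a where a: "0 < a" "a < s"
    "dd v f (z + s *\<^sub>R u + b *\<^sub>R v) - dd v f (z + 0 *\<^sub>R u + b *\<^sub>R v)
      = (s - 0) * dd u (dd v f) (z + a *\<^sub>R u + b *\<^sub>R v)"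
    using MVT2[OF s, of "\<lambda>a. dd v f (z + a *\<^sub>R u + b *\<^sub>R v)" "\<lambda>a. dd u (dd v f) (z + a *\<^sub>R u + b *\<^sub>R v)", OF D2] by metis
  show ?thesis
    using a b by (intro exI[of _ a] exI[of _ b]) (simp add: \<phi>_def)
qed

text \<open>Schwarz' theorem. The second difference of \<open>f\<close> over the parallelogram
  spanned by s u and s v does not see the order of u and v, while
  \<open>second_difference_mvt\<close> expresses it by either mixed derivative at a nearby point;
  continuity of both does the rest.\<close>

lemma dd_commute_real:
  fixes f :: "'a::euclidean_space \<Rightarrow> real"
  assumes "open W" and C2: "Ck_on 2 W f" and z: "z \<in> W"
  shows "dd u (dd v f) z = dd v (dd u f) z"
proof (rule ccontr)
  assume ne: "\<not> ?thesis"
  define e where "e = \<bar>dd u (dd v f) z - dd v (dd u f) z\<bar> / 2"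
  have e: "e > 0" using ne by (simp add: e_def)
  have c: "continuous_on W (dd u (dd v f))" "continuous_on W (dd v (dd u f))"
    using C2 by (auto simp: numeral_2_eq_2 dd_def[abs_def])
  have "\<forall>\<^sub>F x in at z. dist (dd u (dd v f) x) (dd u (dd v f) z) < e \<and>
      dist (dd v (dd u f) x) (dd v (dd u f) z) < e \<and> x \<in> W"
    using c assms e
    by (intro eventually_conj tendstoD eventually_at_in_open')
       (auto simp: continuous_on_eq_continuous_at isCont_def)
  then obtain r where r: "r > 0" "\<And>x. x \<noteq> z \<Longrightarrow> dist x z < r \<Longrightarrow> dist (dd u (dd v f) x) (dd u (dd v f) z) < e \<and>
      dist (dd v (dd u f) x) (dd v (dd u f) z) < e \<and> x \<in> W"
    unfolding eventually_at by auto
  have r': "dist (dd u (dd v f) x) (dd u (dd v f) z) < e" "dist (dd v (dd u f) x) (dd v (dd u f) z) < e" "x \<in> W"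
    if "dist x z < r" for x using r(2)[of x] that e z by (cases "x = z"; auto)+
  \<comment> \<open>Small enough for the whole parallelogram to lie in the ball of radius
    \<open>r\<close>; the 1 in the denominator covers u = v = 0.\<close>
  define s where "s = r / (2 * (norm u + norm v + 1))"
  have p: "norm u + norm v + 1 > 0" by (smt (verit) norm_ge_zero)
  have s: "s > 0" using r p by (simp add: s_def)
  have near: "dist (z + a *\<^sub>R u + b *\<^sub>R v) z < r" if "0 \<le> a" "a \<le> s" "0 \<le> b" "b \<le> s" for a b
  proof -
    have "norm (a *\<^sub>R u + b *\<^sub>R v) \<le> a * norm u + b * norm v" using that by (metis abs_of_nonneg norm_scaleR norm_triangle_ineq)
    also have "\<dots> \<le> s * norm u + s * norm v" using that by (intro add_mono mult_right_mono) auto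
    also have "\<dots> \<le> s * (norm u + norm v + 1)" using s by (simp add: algebra_simps)
    also have "\<dots> = r / 2" using p by (simp add: s_def field_simps)
    also have "\<dots> < r" using r by simp
    finally show ?thesis by (simp add: dist_norm add.assoc)
  qed
  have near': "dist (z + a *\<^sub>R v + b *\<^sub>R u) z < r" if "0 \<le> a" "a \<le> s" "0 \<le> b" "b \<le> s" for a b
    using near[of b a] that by (simp add: algebra_simps)
  obtain a b where ab: "0 \<le> a" "a \<le> s" "0 \<le> b" "b \<le> s"
     "f (z + s *\<^sub>R u + s *\<^sub>R v) - f (z + s *\<^sub>R u) - f (z + s *\<^sub>R v) + f z
       = s * (s * dd u (dd v f) (z + a *\<^sub>R u + b *\<^sub>R v))"
    using second_difference_mvt[OF s C2, of z u v, OF r'(3)[OF near]] by blast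
  obtain a' b' where ab': "0 \<le> a'" "a' \<le> s" "0 \<le> b'" "b' \<le> s"
     "f (z + s *\<^sub>R v + s *\<^sub>R u) - f (z + s *\<^sub>R v) - f (z + s *\<^sub>R u) + f z
       = s * (s * dd v (dd u f) (z + a' *\<^sub>R v + b' *\<^sub>R u))"
    using second_difference_mvt[OF s C2, of z v u, OF r'(3)[OF near']] by blast
  have eq: "z + s *\<^sub>R v + s *\<^sub>R u = z + s *\<^sub>R u + s *\<^sub>R v" by simp
  then have "s * (s * dd u (dd v f) (z + a *\<^sub>R u + b *\<^sub>R v)) = s * (s * dd v (dd u f) (z + a' *\<^sub>R v + b' *\<^sub>R u))"
    using ab(5) ab'(5)[unfolded eq] by linarith
  then have "dd u (dd v f) (z + a *\<^sub>R u + b *\<^sub>R v) = dd v (dd u f) (z + a' *\<^sub>R v + b' *\<^sub>R u)"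
    using s by simp
  moreover have "dist (dd u (dd v f) (z + a *\<^sub>R u + b *\<^sub>R v)) (dd u (dd v f) z) < e"
    using near ab r' by blast
  moreover have "dist (dd v (dd u f) (z + a' *\<^sub>R v + b' *\<^sub>R u)) (dd v (dd u f) z) < e"
    using near' ab' r' by blast
  ultimately have "dist (dd u (dd v f) z) (dd v (dd u f) z) < e + e"
    by (metis dist_commute dist_triangle_less_add)
  then show False by (simp add: e_def dist_real_def)
qed

lemma dd_inner_const:
  assumes "f differentiable (at z)"
  shows "dd v (\<lambda>x. f x \<bullet> w) z = dd v f z \<bullet> w"
  by (rule dd_eqI) (intro has_derivative_inner_left has_derivative_dd assms)

lemma dd_commute:
  fixes f :: "'a::euclidean_space \<Rightarrow> 'b::real_inner"
  assumes "open W" and C2: "Ck_on 2 W f" and z: "z \<in> W"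
  shows "dd u (dd v f) z = dd v (dd u f) z"
proof -
  have d1: "f differentiable (at x)" if "x \<in> W" for x
    using C2 that by (simp add: numeral_2_eq_2)
  have d2: "dd v f differentiable (at x)" if "x \<in> W" for x v
    using C2 that by (simp add: numeral_2_eq_2 dd_def[abs_def])
  have e: "dd u (dd v (\<lambda>x. f x \<bullet> w)) z = dd u (dd v f) z \<bullet> w" for u v w
  proof -
    have "dd u (dd v (\<lambda>x. f x \<bullet> w)) z = dd u (\<lambda>x. dd v f x \<bullet> w) z"
      by (rule dd_cong_open[OF assms(1) z]) (simp add: dd_inner_const d1)
    then show ?thesis by (simp add: dd_inner_const d2 z)
  qed
  have "dd u (dd v f) z \<bullet> w = dd v (dd u f) z \<bullet> w" for w
  proof -
    have "Ck_on 2 W (\<lambda>x. f x \<bullet> w)"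
      using C2 Ck_on_const assms(1) by (intro Ck_on_bilinear[OF bounded_bilinear_inner]) auto
    from dd_commute_real[OF assms(1) this z] show ?thesis by (simp add: e)
  qed
  then show ?thesis by (metis inner_commute vector_eq_ldot)
qed

text \<open>\<open>f1\<close> and \<open>f2\<close> are the first two derivatives at 0. The first
  derivative is required in a neighbourhood, since it is differentiated again and since
  \<open>jet2_min\<close> applies the mean value theorem there.\<close>

definition jet2 :: "(real \<Rightarrow> 'b::real_normed_vector) \<Rightarrow> 'b \<Rightarrow> 'b \<Rightarrow> bool" where
  "jet2 f f1 f2 \<longleftrightarrow> (\<exists>f'. (\<forall>\<^sub>F s in nhds 0. (f has_vector_derivative f' s) (at s)) \<and> f' 0 = f1 \<and>
     (f' has_vector_derivative f2) (at 0))"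

lemma jet2_const: "jet2 (\<lambda>s. c) 0 0"
  unfolding jet2_def by (intro exI[of _ "\<lambda>s. 0"]) (auto intro!: always_eventually derivative_eq_intros)

lemma jet2_add: "jet2 f f1 f2 \<Longrightarrow> jet2 g g1 g2 \<Longrightarrow> jet2 (\<lambda>s. f s + g s) (f1 + g1) (f2 + g2)"
  unfolding jet2_def
proof (elim exE conjE)
  fix f' g' assume "\<forall>\<^sub>F s in nhds 0. (f has_vector_derivative f' s) (at s)" "f' 0 = f1" "(f' has_vector_derivative f2) (at 0)"
    "\<forall>\<^sub>F s in nhds 0. (g has_vector_derivative g' s) (at s)" "g' 0 = g1" "(g' has_vector_derivative g2) (at 0)"
  then show "\<exists>h. (\<forall>\<^sub>F s in nhds 0. ((\<lambda>s. f s + g s) has_vector_derivative h s) (at s)) \<and> h 0 = f1 + g1 \<and>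
     (h has_vector_derivative (f2 + g2)) (at 0)"
    by (intro exI[of _ "\<lambda>s. f' s + g' s"]) (auto elim: eventually_elim2 intro: has_vector_derivative_add)
qed

lemma jet2_diff: "jet2 f f1 f2 \<Longrightarrow> jet2 g g1 g2 \<Longrightarrow> jet2 (\<lambda>s. f s - g s) (f1 - g1) (f2 - g2)"
  unfolding jet2_def
proof (elim exE conjE)
  fix f' g' assume "\<forall>\<^sub>F s in nhds 0. (f has_vector_derivative f' s) (at s)" "f' 0 = f1" "(f' has_vector_derivative f2) (at 0)"
    "\<forall>\<^sub>F s in nhds 0. (g has_vector_derivative g' s) (at s)" "g' 0 = g1" "(g' has_vector_derivative g2) (at 0)"
  then show "\<exists>h. (\<forall>\<^sub>F s in nhds 0. ((\<lambda>s. f s - g s) has_vector_derivative h s) (at s)) \<and> h 0 = f1 - g1 \<and>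
     (h has_vector_derivative (f2 - g2)) (at 0)"
    by (intro exI[of _ "\<lambda>s. f' s - g' s"]) (auto elim: eventually_elim2 intro: has_vector_derivative_diff)
qed

lemma jet2_bilinear:
  assumes B: "bounded_bilinear B" and "jet2 f f1 f2" "jet2 g g1 g2"
  shows "jet2 (\<lambda>s. B (f s) (g s)) (B (f 0) g1 + B f1 (g 0)) (B (f 0) g2 + 2 *\<^sub>R B f1 g1 + B f2 (g 0))"
proof -
  from assms(2,3) obtain f' g' where f: "\<forall>\<^sub>F s in nhds 0. (f has_vector_derivative f' s) (at s)" "f' 0 = f1" "(f' has_vector_derivative f2) (at 0)"
    and g: "\<forall>\<^sub>F s in nhds 0. (g has_vector_derivative g' s) (at s)" "g' 0 = g1" "(g' has_vector_derivative g2) (at 0)"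
    unfolding jet2_def by blast
  let ?h = "\<lambda>s. B (f s) (g' s) + B (f' s) (g s)"
  have f0: "(f has_vector_derivative f1) (at 0)" and g0: "(g has_vector_derivative g1) (at 0)"
    using f g eventually_nhds_x_imp_x by blast+
  have "\<forall>\<^sub>F s in nhds 0. ((\<lambda>s. B (f s) (g s)) has_vector_derivative ?h s) (at s)"
    using f(1) g(1) by eventually_elim (rule bounded_bilinear.has_vector_derivative[OF B])
  moreover have "(?h has_vector_derivative (B (f 0) g2 + B f1 (g' 0)) + (B (f' 0) g1 + B f2 (g 0))) (at 0)"
    by (intro has_vector_derivative_add bounded_bilinear.has_vector_derivative[OF B] f0 g0 f g)
  ultimately show ?thesis unfolding jet2_def
    by (intro exI[of _ ?h]) (simp add: f g scaleR_2 add_ac)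
qed

lemmas jet2_mult = jet2_bilinear[OF bounded_bilinear_mult]
lemmas jet2_inner = jet2_bilinear[OF bounded_bilinear_inner]

text \<open>The acceleration \<open>b\<close> of the parameter curve contributes only the
  first-order term \<open>dd b \<Phi> z\<close>. This is the freedom used later to give the curve on
  the hypersurface a purely normal acceleration.\<close>

lemma jet2_compose:
  assumes W: "open W" "z \<in> W" and C2: "Ck_on 2 W \<Phi>"
  shows "jet2 (\<lambda>s. \<Phi> (z + s *\<^sub>R u + (s\<^sup>2 / 2) *\<^sub>R b)) (dd u \<Phi> z) (dd u (dd u \<Phi>) z + dd b \<Phi> z)"
proof -
  define c where "c s = z + s *\<^sub>R u + (s\<^sup>2 / 2) *\<^sub>R b" for s :: real
  have c0: "c 0 = z" by (simp add: c_def)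
  have dc: "(c has_vector_derivative (u + s *\<^sub>R b)) (at s)" for s
    unfolding c_def by (auto intro!: derivative_eq_intros)
  have d1: "\<Phi> differentiable (at x)" if "x \<in> W" for x
    using C2 that by (simp add: numeral_2_eq_2)
  have d2: "dd v \<Phi> differentiable (at x)" if "x \<in> W" for x v
    using C2 that by (simp add: numeral_2_eq_2 dd_def[abs_def])
  have "isCont c 0" using dc has_vector_derivative_continuous by blast
  then have ev: "\<forall>\<^sub>F s in nhds 0. c s \<in> W"
    using W c0 by (metis isCont_def tendsto_at_iff_tendsto_nhds topological_tendstoD)
  let ?h = "\<lambda>s. dd u \<Phi> (c s) + s *\<^sub>R dd b \<Phi> (c s)"
  have "\<forall>\<^sub>F s in nhds 0. ((\<lambda>s. \<Phi> (c s)) has_vector_derivative ?h s) (at s)"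
    using ev
  proof eventually_elim
    case (elim s)
    have "((\<lambda>s. \<Phi> (c s)) has_vector_derivative dd (u + s *\<^sub>R b) \<Phi> (c s)) (at s)"
      by (rule has_vector_derivative_dd_compose[OF d1[OF elim] dc])
    then show ?case by (simp add: dd_add dd_scale d1 elim)
  qed
  moreover have "(?h has_vector_derivative dd u (dd u \<Phi>) z + (0 *\<^sub>R dd u (dd b \<Phi>) z + 1 *\<^sub>R dd b \<Phi> (c 0))) (at 0)"
  proof -
    have "((\<lambda>s. dd v \<Phi> (c s)) has_vector_derivative dd (u + 0 *\<^sub>R b) (dd v \<Phi>) (c 0)) (at 0)" for v
      by (rule has_vector_derivative_dd_compose[OF _ dc]) (use d2 c0 W in auto)
    then show ?thesis using c0
      by (intro has_vector_derivative_add has_vector_derivative_scaleR) (auto simp: DERIV_ident)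
  qed
  ultimately show ?thesis unfolding jet2_def c_def[symmetric]
    by (intro exI[of _ ?h]) (simp add: c0)
qed

lemma jet2_min:
  fixes f :: "real \<Rightarrow> real"
  assumes "jet2 f f1 f2" and min: "\<forall>\<^sub>F s in nhds 0. f 0 \<le> f s"
  shows "f1 = 0" "0 \<le> f2"
proof -
  obtain f' where f: "\<forall>\<^sub>F s in nhds 0. (f has_vector_derivative f' s) (at s)" "f' 0 = f1" "(f' has_vector_derivative f2) (at 0)"
    using assms(1) unfolding jet2_def by blast
  have "\<forall>\<^sub>F s in nhds 0. (f has_vector_derivative f' s) (at s) \<and> f 0 \<le> f s"
    using f(1) min by (rule eventually_conj)
  then obtain r where r: "r > 0" "\<And>s. \<bar>s\<bar> < r \<Longrightarrow> DERIV f s :> f' s" "\<And>s. \<bar>s\<bar> < r \<Longrightarrow> f 0 \<le> f s"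
    unfolding eventually_nhds_metric has_real_derivative_iff_has_vector_derivative by (auto simp: dist_real_def)
  show f10: "f1 = 0"
    using DERIV_local_min[of f f1 0 r] f(2) r by auto
  show "0 \<le> f2"
  proof (rule ccontr)
    assume "\<not> 0 \<le> f2"
    then have neg: "f2 < 0" by simp
    have "DERIV f' 0 :> f2" using f(3) by (simp add: has_real_derivative_iff_has_vector_derivative)
    then obtain e where e: "e > 0" "\<And>h. 0 < h \<Longrightarrow> h < e \<Longrightarrow> f' (0 + h) < f' 0"
      using DERIV_neg_dec_right neg by metis
    define s where "s = min r e / 2"
    have s: "0 < s" "s < r" "s < e" using r e by (auto simp: s_def)
    have "DERIV f x :> f' x" if "0 \<le> x" "x \<le> s" for x using r(2)[of x] that s by simp
    from MVT2[OF s(1) this] obtain \<xi> where "0 < \<xi>" "\<xi> < s" "f s - f 0 = (s - 0) * f' \<xi>"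
      by blast
    moreover from this have "f' \<xi> < 0" using e(2)[of \<xi>] s f10 f by simp
    moreover from this have "s * f' \<xi> < 0" using s by (simp add: mult_pos_neg)
    ultimately have "f s < f 0" by simp
    then show False using r(3)[of s] s by simp
  qed
qed

section \<open>Algebra at a touching pair\<close>

text \<open>The two-point function at a touching pair: \<open>d\<close> is the chord from \<open>x\<close> to \<open>y\<close>, and \<open>k\<close> the
  curvature of the comparison sphere at \<open>x\<close>. Both normals are exchanged by the reflection in
  \<open>u = d - \<tau> \<nu>\<close>, which for \<open>W = 0\<close> is the reflection in the perpendicular bisector of the chord.\<close>

lemma reflection_frame:
  fixes d \<nu> \<nu>' :: "'e::real_inner" and e :: "'n \<Rightarrow> 'e"
  assumes \<nu>: "norm \<nu> = 1" and \<nu>': "norm \<nu>' = 1" and n: "k *\<^sub>R d + \<nu> = \<rho> *\<^sub>R \<nu>'" and \<rho>: "0 < \<rho>"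
    and W: "W = k / 2 * (norm d)\<^sup>2 + d \<bullet> \<nu>" and \<tau>: "\<tau> = 2 * W / (1 + \<rho>)" and small: "\<tau>\<^sup>2 < (norm d)\<^sup>2"
    and e: "\<And>i j. e i \<bullet> e j = (if i = j then 1 else 0)" "\<And>i. e i \<bullet> \<nu> = 0"
  shows "\<exists>e' :: 'n \<Rightarrow> 'e. (\<forall>i j. e' i \<bullet> e' j = (if i = j then 1 else 0)) \<and> (\<forall>i. e' i \<bullet> \<nu>' = 0) \<and>
     (\<forall>i. d \<bullet> e' i = - (d \<bullet> e i) / \<rho>) \<and>
     (\<forall>i. e i \<bullet> e' i = 1 - 2 * (d \<bullet> e i)\<^sup>2 / (\<rho> * ((norm d)\<^sup>2 - \<tau>\<^sup>2)))"
proof -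
  define D where "D = (norm d)\<^sup>2"
  have dd: "d \<bullet> d = D" by (simp add: D_def power2_norm_eq_inner)
  have nn: "\<nu> \<bullet> \<nu> = 1" "\<nu>' \<bullet> \<nu>' = 1" using \<nu> \<nu>' by (simp_all add: norm_eq_1)
  have "\<rho>\<^sup>2 = (\<rho> *\<^sub>R \<nu>') \<bullet> (\<rho> *\<^sub>R \<nu>')" by (simp add: nn power2_eq_square)
  also have "\<dots> = k\<^sup>2 * D + 2 * k * (d \<bullet> \<nu>) + 1"
    unfolding n[symmetric] by (simp add: inner_add_left inner_add_right dd nn inner_commute[of \<nu> d] power2_eq_square algebra_simps)
  also have "\<dots> = 1 + 2 * k * W" by (simp add: W D_def algebra_simps power2_eq_square)
  finally have \<rho>2: "\<rho>\<^sup>2 = 1 + 2 * k * W" .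
  have W\<tau>: "W = \<tau> * (1 + \<rho>) / 2" using \<rho> by (simp add: \<tau>)
  have "(\<rho> - 1) * (1 + \<rho>) = k * \<tau> * (1 + \<rho>)" using \<rho>2 by (simp add: W\<tau> power2_eq_square algebra_simps)
  then have "\<rho> - 1 = k * \<tau>" using \<rho> by (metis add_pos_pos less_numeral_extra(1) mult_right_cancel order_less_irrefl)
  \<comment> \<open>This identity is the reason for the choice of \<open>\<tau>\<close>: it gives k
    u = \<rho> (\<nu>' - \<nu>) for the vector u = d - \<tau> \<nu> below, so the reflection in the
    hyperplane orthogonal to u swaps the normals. The scalar products that follow also cover k =
    0.\<close>
  then have \<rho>k: "\<rho> = 1 + k * \<tau>" by simp
  have dn: "d \<bullet> \<nu> = \<tau> * (1 + \<rho>) / 2 - k * D / 2"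
  proof -
    have "W = k * D / 2 + d \<bullet> \<nu>" by (simp add: W D_def)
    then show ?thesis using W\<tau> by linarith
  qed
  define u where "u = d - \<tau> *\<^sub>R \<nu>"
  define M where "M = D - \<tau>\<^sup>2"
  have M: "M > 0" using small by (simp add: M_def D_def)
  have uu: "u \<bullet> u = \<rho> * M"
  proof -
    have "u \<bullet> u = D - 2 * \<tau> * (d \<bullet> \<nu>) + \<tau>\<^sup>2"
      by (simp add: u_def inner_diff_left inner_diff_right dd nn inner_commute[of \<nu> d] power2_eq_square algebra_simps)
    also have "\<dots> = \<rho> * M" unfolding dn \<rho>k M_def by (simp add: algebra_simps power2_eq_square)
    finally show ?thesis .
  qed
  have nu: "\<nu> \<bullet> u = - (k / 2) * M"
    unfolding u_def inner_diff_right inner_scaleR_right nn inner_commute[of \<nu> d] dn \<rho>k M_def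
    by (simp add: field_simps power2_eq_square)
  have du: "d \<bullet> u = (1 + \<rho>) / 2 * M"
    unfolding u_def inner_diff_right inner_scaleR_right dd dn M_def \<rho>k
    by (simp add: field_simps power2_eq_square)
  define R where "R w = w - (2 * (w \<bullet> u) / (\<rho> * M)) *\<^sub>R u" for w
  have \<rho>M: "\<rho> * M \<noteq> 0" using \<rho> M by simp
  have Riso: "R v \<bullet> R w = v \<bullet> w" for v w
  proof -
    have "(v - a *\<^sub>R u) \<bullet> (w - b *\<^sub>R u) = v \<bullet> w - b * (v \<bullet> u) - a * (w \<bullet> u) + a * (b * (\<rho> * M))" for a b
      by (simp add: inner_diff_left inner_diff_right uu inner_commute[of u w] right_diff_distrib)
    then have "R v \<bullet> R w = v \<bullet> w - 2 * (w \<bullet> u) / (\<rho> * M) * (v \<bullet> u) - 2 * (v \<bullet> u) / (\<rho> * M) * (w \<bullet> u)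
       + 2 * (v \<bullet> u) / (\<rho> * M) * (2 * (w \<bullet> u) / (\<rho> * M) * (\<rho> * M))"
      unfolding R_def by blast
    also have "\<dots> = v \<bullet> w" using \<rho>M by (simp add: field_simps)
    finally show ?thesis .
  qed
  have "R \<nu> = \<nu> + (k / \<rho>) *\<^sub>R u" unfolding R_def nu using \<rho> M by (simp add: field_simps)
  also have "\<dots> = (1 / \<rho>) *\<^sub>R (k *\<^sub>R d + \<nu>)"
  proof -
    have "1 - k * \<tau> / \<rho> = 1 / \<rho>" using \<rho> \<rho>k by (simp add: field_simps)
    then have "(1 / \<rho>) *\<^sub>R \<nu> = \<nu> - (k * \<tau> / \<rho>) *\<^sub>R \<nu>" by (metis scaleR_left_diff_distrib scaleR_one)
    then show ?thesis by (simp add: u_def algebra_simps)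
  qed
  also have "\<dots> = \<nu>'" unfolding n using \<rho> by simp
  finally have R\<nu>: "R \<nu> = \<nu>'" .
  have eu: "e i \<bullet> u = d \<bullet> e i" for i by (simp add: u_def inner_diff_right e inner_commute[of d])
  show ?thesis
  proof (intro exI[of _ "\<lambda>i. R (e i)"] conjI allI)
    show "R (e i) \<bullet> R (e j) = (if i = j then 1 else 0)" for i j by (simp add: Riso e)
    show "R (e i) \<bullet> \<nu>' = 0" for i by (simp add: R\<nu>[symmetric] Riso e)
    show "d \<bullet> R (e i) = - (d \<bullet> e i) / \<rho>" for i
      unfolding R_def inner_diff_right inner_scaleR_right eu du using \<rho> M by (simp add: field_simps)
    show "e i \<bullet> R (e i) = 1 - 2 * (d \<bullet> e i)\<^sup>2 / (\<rho> * ((norm d)\<^sup>2 - \<tau>\<^sup>2))" for i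
      unfolding R_def inner_diff_right inner_scaleR_right eu by (simp add: e M_def D_def power2_eq_square)
  qed
qed

text \<open>Choosing the sign \<open>\<sigma>\<close> according to the sign of \<open>k - \<kappa>\<close> makes any a priori comparison of
  the principal curvatures with \<open>k\<close> unnecessary.\<close>

lemma sign_choice:
  fixes \<epsilon> k \<kappa> p q c D \<tau> \<rho> :: real
  assumes \<epsilon>: "\<epsilon> = 1 \<or> \<epsilon> = -1" and D: "0 < D" and \<rho>: "1/2 \<le> \<rho>" and \<tau>: "3 * \<tau>\<^sup>2 \<le> D" and p: "p\<^sup>2 \<le> D"
    and q: "q = - p / \<rho>" and c: "c = 1 - 2 * p\<^sup>2 / (\<rho> * (D - \<tau>\<^sup>2))"
  shows "\<exists>\<sigma>. (\<sigma> = 1 \<or> \<sigma> = -1) \<and>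
     - \<bar>k - \<kappa>\<bar> * (8 * \<tau>\<^sup>2 / D) \<le> \<epsilon> * (k - \<kappa>) * (2 * p / D * (p - \<sigma> * q) - 1 + \<sigma> * c)"
proof -
  define M where "M = D - \<tau>\<^sup>2"
  have \<tau>0: "0 \<le> \<tau>\<^sup>2" by simp
  have M: "0 < M" unfolding M_def using D \<tau> \<tau>0 by linarith
  have M2: "D \<le> 2 * M" 
  proof -
    have "2 * \<tau>\<^sup>2 \<le> 3 * \<tau>\<^sup>2" by (rule mult_right_mono) auto
    from order_trans[OF this \<tau>] show ?thesis unfolding M_def right_diff_distrib by simp
  qed
  have \<rho>0: "0 < \<rho>" using \<rho> by simp
  show ?thesis
  \<comment> \<open>For \<tau> = 0 and \<rho> = 1 the bracket equals 2 p^2 / D if \<sigma> = 1 and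
    -2 (1 - p^2 / D) if \<sigma> = -1. These values have opposite signs, so one of them suits the
    sign of \<epsilon> (k - \<kappa>); the rest controls the deviation from this ideal case.\<close>
  proof (cases "0 \<le> \<epsilon> * (k - \<kappa>)")
    case True
    have "2 * p / D * (p - 1 * q) - 1 + 1 * c = 2 * p\<^sup>2 * ((1 + \<rho>) * M - D) / (\<rho> * D * M)"
      unfolding q c M_def[symmetric] using D \<rho>0 M by (simp add: field_simps power2_eq_square)
    moreover have "0 \<le> (1 + \<rho>) * M - D"
    proof -
      have "(1/2) * M \<le> \<rho> * M" using \<rho> M by (intro mult_right_mono) auto
      \<comment> \<open>The factor 3 in \<open>3 * \<tau>\<^sup>2 \<le> D\<close> is tuned to this:
        together with \<open>1/2 \<le> \<rho>\<close> it just gives (1 + \<rho>) M >= D.\<close>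
      moreover have "D \<le> (3/2) * M" unfolding M_def using \<tau> by simp
      ultimately show ?thesis by (simp add: algebra_simps)
    qed
    ultimately have "0 \<le> 2 * p / D * (p - 1 * q) - 1 + 1 * c" using D \<rho>0 M by simp
    then have "0 \<le> \<epsilon> * (k - \<kappa>) * (2 * p / D * (p - 1 * q) - 1 + 1 * c)" using True by simp
    moreover have "- \<bar>k - \<kappa>\<bar> * (8 * \<tau>\<^sup>2 / D) \<le> 0" using D by (simp add: mult_nonneg_nonneg)
    ultimately show ?thesis by (intro exI[of _ 1]) linarith
  next
    case False
    let ?\<beta> = "2 * p / D * (p - (-1) * q) - 1 + (-1) * c"
    have "?\<beta> = - 2 * (1 - p\<^sup>2 / D) + 2 * p\<^sup>2 * \<tau>\<^sup>2 / (\<rho> * D * M)"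
    proof -
      have "?\<beta> - (- 2 * (1 - p\<^sup>2 / D)) = 2 * p\<^sup>2 / \<rho> * (1 / M - 1 / D)"
        unfolding q c M_def[symmetric] using D \<rho>0 M by (simp add: field_simps power2_eq_square)
      also have "1 / M - 1 / D = \<tau>\<^sup>2 / (D * M)" using D M by (simp add: field_simps) (simp add: M_def)
      finally show ?thesis by (simp add: mult.assoc)
    qed
    moreover have "0 \<le> 1 - p\<^sup>2 / D" using D p by simp
    \<comment> \<open>The error of the case \<sigma> = -1: p^2 <= D, \<rho> >= 1/2 and M >= D / 2
      produce the factor 8.\<close>
    moreover have "2 * p\<^sup>2 * \<tau>\<^sup>2 / (\<rho> * D * M) \<le> 8 * \<tau>\<^sup>2 / D"
    proof -
      have "2 * p\<^sup>2 * \<tau>\<^sup>2 \<le> 2 * D * \<tau>\<^sup>2" using p by (intro mult_right_mono) auto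
      then have "2 * p\<^sup>2 * \<tau>\<^sup>2 / (\<rho> * D * M) \<le> 2 * D * \<tau>\<^sup>2 / (\<rho> * D * M)"
        using D M \<rho>0 by (intro divide_right_mono) auto
      also have "\<dots> = 2 * \<tau>\<^sup>2 / (\<rho> * M)" using D by simp
      also have "\<dots> \<le> 2 * \<tau>\<^sup>2 / (D / 4)"
      proof (intro divide_left_mono)
        have "(1/2) * (D / 2) \<le> \<rho> * M" using \<rho> M M2 D by (intro mult_mono) auto
        then show "D / 4 \<le> \<rho> * M" by simp
      qed (use D M \<rho>0 in auto)
      finally show ?thesis by simp
    qed
    moreover have "x \<le> w" if "x = - 2 * y + z" "0 \<le> y" "z \<le> w" for x y z w :: real
      using that by linarith
    ultimately have \<beta>: "?\<beta> \<le> 8 * \<tau>\<^sup>2 / D" by blast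
    have ab: "\<epsilon> * (k - \<kappa>) = - \<bar>k - \<kappa>\<bar>" using False \<epsilon> by (auto simp: abs_if)
    have "- \<bar>k - \<kappa>\<bar> * (8 * \<tau>\<^sup>2 / D) \<le> - \<bar>k - \<kappa>\<bar> * ?\<beta>"
      using \<beta> by (intro mult_left_mono_neg) auto
    then show ?thesis unfolding ab by (intro exI[of _ "-1"]) auto
  qed
qed

text \<open>The left side is the second derivative delivered by \<open>jet2_chord_fun\<close> when x
  moves with velocity \<open>e\<close> and acceleration \<open>- \<kappa> *\<^sub>R \<nu>\<close>,
  and y with velocity \<open>\<sigma> *\<^sub>R e'\<close> and acceleration
  \<open>- h *\<^sub>R \<nu>'\<close>. The product of the first order condition \<open>n\<close>
  with \<open>\<nu>'\<close> collects all terms in \<open>h\<close> into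
  \<open>- \<rho> * h\<close>.\<close>

lemma second_variation_scalar:
  fixes d \<nu> \<nu>' e e' m :: "'e::real_inner"
  assumes nn: "\<nu> \<bullet> \<nu> = 1" and ee: "e \<bullet> e = 1" "e' \<bullet> e' = 1" and n: "k *\<^sub>R d + \<nu> = \<rho> *\<^sub>R \<nu>'" "\<nu>' \<bullet> \<nu>' = 1"
    and \<sigma>: "\<sigma> = 1 \<or> \<sigma> = (-1::real)" and k: "k = K * G"
    and D1: "D1 = \<sigma> *\<^sub>R e' - e" and D2: "D2 = - h *\<^sub>R \<nu>' - (- \<kappa> *\<^sub>R \<nu>)"
  shows "K / 2 * (g2 * (norm d)\<^sup>2 + 4 * g1 * (d \<bullet> D1) + G * (2 * (D1 \<bullet> D1) + 2 * (d \<bullet> D2)))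
      + D2 \<bullet> \<nu> + 2 * (D1 \<bullet> (\<kappa> *\<^sub>R e)) + d \<bullet> m
    = K * g2 * (norm d)\<^sup>2 / 2 + 2 * K * g1 * (\<sigma> * (d \<bullet> e') - d \<bullet> e) + 2 * (k - \<kappa>) * (1 - \<sigma> * (e \<bullet> e'))
      - \<rho> * h + \<kappa> * (k * (d \<bullet> \<nu>) + 1) + d \<bullet> m"
proof -
  have r: "k * (d \<bullet> \<nu>') + \<nu> \<bullet> \<nu>' = \<rho>"
    using arg_cong[OF n(1), of "\<lambda>w. w \<bullet> \<nu>'"] n(2) by (simp add: inner_add_left)
  have s2: "\<sigma> * \<sigma> = 1" using \<sigma> by auto
  have a: "D1 \<bullet> D1 = 2 - 2 * \<sigma> * (e \<bullet> e')"
    unfolding D1 by (simp add: inner_diff_left inner_diff_right ee s2 inner_commute[of e' e] algebra_simps)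
  have b: "d \<bullet> D2 = - h * (d \<bullet> \<nu>') + \<kappa> * (d \<bullet> \<nu>)" unfolding D2 by (simp add: inner_diff_right inner_add_right)
  have c: "D2 \<bullet> \<nu> = - h * (\<nu> \<bullet> \<nu>') + \<kappa>" unfolding D2 by (simp add: inner_diff_left inner_add_left nn inner_commute[of \<nu>' \<nu>])
  have f: "D1 \<bullet> (\<kappa> *\<^sub>R e) = \<kappa> * (\<sigma> * (e \<bullet> e') - 1)"
    unfolding D1 by (simp add: inner_diff_left ee inner_commute[of e' e])
  have g: "d \<bullet> D1 = \<sigma> * (d \<bullet> e') - d \<bullet> e" unfolding D1 by (simp add: inner_diff_right)
  have "\<rho> * h = h * (K * G * (d \<bullet> \<nu>')) + h * (\<nu> \<bullet> \<nu>')" using r[symmetric] k by (simp add: algebra_simps)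
  then show ?thesis unfolding a b c f g k by (simp add: algebra_simps)
qed

text \<open>Everything known at a first touching pair, in scalar form. Weighting the second
  variations with \<open>a\<close> turns the terms in \<open>g2\<close> and \<open>m\<close> into
  the time derivatives \<open>Gt\<close> and \<open>Nt\<close>, which cancel against
  \<open>time\<close>. What survives is \<rho> times a difference signed by Jensen's inequality
  \<open>Gy\<close>, the terms from the choice of signs, and a zeroth-order term in \<theta>; the
  last two are beaten by \<open>L\<close>.\<close>

lemma touching_impossible:
  fixes d \<nu> \<nu>' Nt :: "'e::real_inner" and e e' m :: "'n::finite \<Rightarrow> 'e"
  assumes \<epsilon>: "\<epsilon> = 1 \<or> \<epsilon> = (-1::real)"
    and nn: "\<nu> \<bullet> \<nu> = 1" "\<nu>' \<bullet> \<nu>' = 1"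
    and ee: "\<And>i. e i \<bullet> e i = 1" "\<And>i. e' i \<bullet> e' i = 1"
    and n: "k *\<^sub>R d + \<nu> = \<rho> *\<^sub>R \<nu>'" and k: "k = K * G" and \<rho>: "1/2 \<le> \<rho>"
    and W: "k / 2 * (norm d)\<^sup>2 + d \<bullet> \<nu> = - \<epsilon> * \<theta>" and \<theta>: "0 < \<theta>"
    and \<tau>: "\<tau> = 2 * (- \<epsilon> * \<theta>) / (1 + \<rho>)"
    and C: "\<theta> \<le> C * (norm d)\<^sup>2" "12 * C * \<theta> \<le> 1" and C0: "0 \<le> C"
    and q: "\<And>i. d \<bullet> e' i = - (d \<bullet> e i) / \<rho>"
    and c: "\<And>i. e i \<bullet> e' i = 1 - 2 * (d \<bullet> e i)\<^sup>2 / (\<rho> * ((norm d)\<^sup>2 - \<tau>\<^sup>2))"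
    and a: "\<And>i. 0 \<le> a i" and aG: "(\<Sum>i\<in>UNIV. a i * \<kappa> i) = G"
    and m: "(\<Sum>i\<in>UNIV. a i *\<^sub>R m i) = Nt - (\<Sum>i\<in>UNIV. a i * (\<kappa> i)\<^sup>2) *\<^sub>R \<nu>"
    and Gt: "Gt = (\<Sum>i\<in>UNIV. a i * (g2 i + G * (\<kappa> i)\<^sup>2))"
    and g1: "\<And>i. K * g1 i * (norm d)\<^sup>2 / 2 = (k - \<kappa> i) * (d \<bullet> e i)"
    and Gy: "\<epsilon> * Gy \<le> \<epsilon> * (\<Sum>i\<in>UNIV. a i * h i)"
    and snd: "\<And>i \<sigma> D1 D2. \<sigma> = 1 \<or> \<sigma> = (-1::real) \<Longrightarrow> D1 = \<sigma> *\<^sub>R e' i - e i \<Longrightarrow> D2 = - h i *\<^sub>R \<nu>' - (- \<kappa> i *\<^sub>R \<nu>) \<Longrightarrow>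
       0 \<le> \<epsilon> * (K / 2 * (g2 i * (norm d)\<^sup>2 + 4 * g1 i * (d \<bullet> D1) + G * (2 * (D1 \<bullet> D1) + 2 * (d \<bullet> D2)))
          + D2 \<bullet> \<nu> + 2 * (D1 \<bullet> (\<kappa> i *\<^sub>R e i)) + d \<bullet> m i)"
    and time: "\<epsilon> * (K / 2 * (Gt * (norm d)\<^sup>2 + 2 * G * (d \<bullet> (- Gy *\<^sub>R \<nu>' - (- G *\<^sub>R \<nu>))))
          + (- Gy *\<^sub>R \<nu>' - (- G *\<^sub>R \<nu>)) \<bullet> \<nu> + d \<bullet> Nt) \<le> - L * \<theta>"
    and L: "(\<Sum>i\<in>UNIV. a i * (\<kappa> i)\<^sup>2) + 64 * C * (\<Sum>i\<in>UNIV. a i * \<bar>k - \<kappa> i\<bar>) < L"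
  shows False
proof -
  define D where "D = (norm d)\<^sup>2"
  have CD: "0 < C * D" using C(1) \<theta> by (simp add: D_def)
  then have D: "0 < D" using C0 D_def by (metis mult_zero_right not_less zero_le_power2 order_less_le)
  have \<rho>0: "0 < \<rho>" using \<rho> by simp
  have \<tau>2: "\<tau>\<^sup>2 \<le> 4 * \<theta>\<^sup>2"
  proof -
    have "\<bar>\<tau>\<bar> = 2 * \<theta> / (1 + \<rho>)" using \<epsilon> \<theta> \<rho>0 unfolding \<tau> by (auto simp: abs_mult abs_divide)
    also have "\<dots> \<le> 2 * \<theta>" using \<theta> \<rho>0 by (simp add: field_simps)
    finally have "\<bar>\<tau>\<bar>\<^sup>2 \<le> (2 * \<theta>)\<^sup>2" by (intro power_mono) auto
    then show ?thesis by (simp add: power_mult_distrib)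
  qed
  \<comment> \<open>Since |\<tau>| <= 2 \<theta> and \<theta> <= C D, the bound 12 C \<theta> <= 1
    yields the requirement \<open>3 * \<tau>\<^sup>2 \<le> D\<close> of \<open>sign_choice\<close>,
    and the error 8 \<tau>^2 / D there is at most 32 C \<theta>, linear in \<theta>. The second
    variation contains this error twice, hence the 64 in \<open>L\<close>.\<close>
  have \<theta>2: "\<theta>\<^sup>2 \<le> C * \<theta> * D" using mult_right_mono[OF C(1), of \<theta>] \<theta> by (simp add: power2_eq_square D_def algebra_simps)
  have "12 * C * \<theta> * D \<le> 1 * D" using C(2) D by (intro mult_right_mono) auto
  then have \<tau>D: "3 * \<tau>\<^sup>2 \<le> D" using \<tau>2 \<theta>2 by linarith
  have \<tau>C: "8 * \<tau>\<^sup>2 / D \<le> 32 * C * \<theta>"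
  proof -
    have "8 * \<tau>\<^sup>2 \<le> 32 * C * \<theta> * D" using \<tau>2 \<theta>2 by linarith
    then show ?thesis using D by (simp add: field_simps)
  qed
  have p2: "(d \<bullet> e i)\<^sup>2 \<le> D" for i
  proof -
    have "norm (e i) = 1" using ee by (simp add: norm_eq_1)
    then have "\<bar>d \<bullet> e i\<bar> \<le> norm d" using Cauchy_Schwarz_ineq2[of d "e i"] by simp
    then show ?thesis unfolding D_def using abs_le_square_iff by force
  qed
  have "\<exists>\<sigma>. (\<sigma> = 1 \<or> \<sigma> = -1) \<and>
     - \<bar>k - \<kappa> i\<bar> * (8 * \<tau>\<^sup>2 / D) \<le> \<epsilon> * (k - \<kappa> i) * (2 * (d \<bullet> e i) / D * (d \<bullet> e i - \<sigma> * (d \<bullet> e' i)) - 1 + \<sigma> * (e i \<bullet> e' i))" for i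
    by (rule sign_choice[OF \<epsilon> D \<rho> \<tau>D p2 q]) (simp add: c D_def)
  then obtain \<sigma> where \<sigma>: "\<And>i. \<sigma> i = 1 \<or> \<sigma> i = -1"
    "\<And>i. - \<bar>k - \<kappa> i\<bar> * (8 * \<tau>\<^sup>2 / D) \<le> \<epsilon> * (k - \<kappa> i) * (2 * (d \<bullet> e i) / D * (d \<bullet> e i - \<sigma> i * (d \<bullet> e' i)) - 1 + \<sigma> i * (e i \<bullet> e' i))"
    by metis
  define \<beta> where "\<beta> i = 2 * (d \<bullet> e i) / D * (d \<bullet> e i - \<sigma> i * (d \<bullet> e' i)) - 1 + \<sigma> i * (e i \<bullet> e' i)" for i
  define r where "r i = 2 * (d \<bullet> e i) / D * (d \<bullet> e i - \<sigma> i * (d \<bullet> e' i))" for i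
  \<comment> \<open>The second variation after elimination of \<open>g1\<close>: by the first order
    condition the mixed term becomes part of \<open>\<beta>\<close>, so no gradient of the speed is
    left.\<close>
  define w where "w i = K * g2 i * D / 2 - 2 * (k - \<kappa> i) * \<beta> i - \<rho> * h i + \<kappa> i * (k * (d \<bullet> \<nu>) + 1) + d \<bullet> m i" for i
  have Kg: "2 * K * g1 i * (\<sigma> i * (d \<bullet> e' i) - d \<bullet> e i)
      = - 2 * (k - \<kappa> i) * (2 * (d \<bullet> e i) / D * (d \<bullet> e i - \<sigma> i * (d \<bullet> e' i)))" for i
  proof -
    have "K * g1 i = 2 * (k - \<kappa> i) * (d \<bullet> e i) / D" using g1[of i] D by (simp add: D_def[symmetric] field_simps)
    then have "2 * (K * g1 i) * (\<sigma> i * (d \<bullet> e' i) - d \<bullet> e i) =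
       2 * (2 * (k - \<kappa> i) * (d \<bullet> e i) / D) * (\<sigma> i * (d \<bullet> e' i) - d \<bullet> e i)" by simp
    also have "\<dots> = - 2 * (k - \<kappa> i) * (2 * (d \<bullet> e i) / D * (d \<bullet> e i - \<sigma> i * (d \<bullet> e' i)))"
      by (simp add: field_simps)
    finally show ?thesis by (simp add: mult.assoc)
  qed
  have w: "0 \<le> \<epsilon> * w i" for i
    using snd[OF \<sigma>(1) refl refl, of i i]
    unfolding second_variation_scalar[OF nn(1) ee(1) ee(2) n nn(2) \<sigma>(1) k refl refl]
    unfolding Kg D_def[symmetric] w_def \<beta>_def r_def[symmetric] by (simp add: algebra_simps)
  define A2 where "A2 = (\<Sum>i\<in>UNIV. a i * (\<kappa> i)\<^sup>2)"
  have S: "(\<Sum>i\<in>UNIV. a i * w i) = K * D / 2 * (Gt - G * A2) - 2 * (\<Sum>i\<in>UNIV. a i * ((k - \<kappa> i) * \<beta> i))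
     - \<rho> * (\<Sum>i\<in>UNIV. a i * h i) + G * (k * (d \<bullet> \<nu>) + 1) + (d \<bullet> Nt - A2 * (d \<bullet> \<nu>))"
  proof -
    have 1: "(\<Sum>i\<in>UNIV. a i * g2 i) = Gt - G * A2"
      unfolding Gt A2_def by (simp add: distrib_left sum.distrib sum_distrib_left mult.left_commute)
    have "(\<Sum>i\<in>UNIV. a i * (d \<bullet> m i)) = d \<bullet> (\<Sum>i\<in>UNIV. a i *\<^sub>R m i)" by (simp add: inner_sum_right)
    then have 2: "(\<Sum>i\<in>UNIV. a i * (d \<bullet> m i)) = d \<bullet> Nt - A2 * (d \<bullet> \<nu>)" by (simp add: m A2_def inner_diff_right)
    have "(\<Sum>i\<in>UNIV. a i * w i) = (\<Sum>i\<in>UNIV. (K * D / 2) * (a i * g2 i) - 2 * (a i * ((k - \<kappa> i) * \<beta> i))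
      - \<rho> * (a i * h i) + (k * (d \<bullet> \<nu>) + 1) * (a i * \<kappa> i) + a i * (d \<bullet> m i))"
      unfolding w_def by (intro sum.cong) (auto simp: algebra_simps)
    also have "\<dots> = K * D / 2 * (Gt - G * A2) - 2 * (\<Sum>i\<in>UNIV. a i * ((k - \<kappa> i) * \<beta> i))
     - \<rho> * (\<Sum>i\<in>UNIV. a i * h i) + (k * (d \<bullet> \<nu>) + 1) * G + (d \<bullet> Nt - A2 * (d \<bullet> \<nu>))"
      unfolding sum.distrib sum_subtractf sum_distrib_left[symmetric] 1 2 aG by simp
    finally show ?thesis by (simp add: algebra_simps)
  qed
  define wt where "wt = K * Gt * D / 2 - \<rho> * Gy + G * (k * (d \<bullet> \<nu>) + 1) + d \<bullet> Nt"
  have rr: "k * (d \<bullet> \<nu>') + \<nu> \<bullet> \<nu>' = \<rho>"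
    using arg_cong[OF n(1), of "\<lambda>w. w \<bullet> \<nu>'"] nn(2) by (simp add: inner_add_left)
  have wt: "\<epsilon> * wt \<le> - L * \<theta>"
  proof -
    have "K / 2 * (Gt * D + 2 * G * (d \<bullet> (- Gy *\<^sub>R \<nu>' - (- G *\<^sub>R \<nu>))))
          + (- Gy *\<^sub>R \<nu>' - (- G *\<^sub>R \<nu>)) \<bullet> \<nu> + d \<bullet> Nt = wt"
      unfolding wt_def rr[symmetric] k
      by (simp add: inner_diff_left inner_add_left inner_add_right inner_diff_right nn inner_commute[of \<nu>' \<nu>] algebra_simps)
    then show ?thesis using time by (simp add: D_def)
  qed
  have "0 \<le> (\<Sum>i\<in>UNIV. a i * (\<epsilon> * w i))" by (intro sum_nonneg mult_nonneg_nonneg a w)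
  also have "\<dots> = \<epsilon> * (\<Sum>i\<in>UNIV. a i * w i)" by (simp add: sum_distrib_left mult.left_commute)
  finally have w0: "0 \<le> \<epsilon> * (\<Sum>i\<in>UNIV. a i * w i)" .
  \<comment> \<open>Time derivative minus weighted second variation: \<open>Gt\<close> and
    \<open>Nt\<close> cancel, and the leftover curvature terms combine to \<open>A2\<close> times
    the value of W, which is \<open>- \<epsilon> * \<theta>\<close>.\<close>
  have "wt - (\<Sum>i\<in>UNIV. a i * w i) = \<rho> * ((\<Sum>i\<in>UNIV. a i * h i) - Gy) + A2 * (- \<epsilon> * \<theta>) + 2 * (\<Sum>i\<in>UNIV. a i * ((k - \<kappa> i) * \<beta> i))"
    unfolding S wt_def W[symmetric] D_def[symmetric] k by (simp add: field_simps)
  then have "\<epsilon> * wt - \<epsilon> * (\<Sum>i\<in>UNIV. a i * w i) = \<rho> * (\<epsilon> * (\<Sum>i\<in>UNIV. a i * h i) - \<epsilon> * Gy) + A2 * (- (\<epsilon> * \<epsilon>) * \<theta>)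
      + 2 * (\<epsilon> * (\<Sum>i\<in>UNIV. a i * ((k - \<kappa> i) * \<beta> i)))"
    by (simp add: right_diff_distrib[symmetric]) (simp add: algebra_simps)
  moreover have "\<epsilon> * \<epsilon> = 1" using \<epsilon> by auto
  moreover have "0 \<le> \<rho> * (\<epsilon> * (\<Sum>i\<in>UNIV. a i * h i) - \<epsilon> * Gy)" using Gy \<rho>0 by simp
  moreover have "- (32 * C * \<theta>) * (\<Sum>i\<in>UNIV. a i * \<bar>k - \<kappa> i\<bar>) \<le> \<epsilon> * (\<Sum>i\<in>UNIV. a i * ((k - \<kappa> i) * \<beta> i))"
  proof -
    have "- (32 * C * \<theta>) * (a i * \<bar>k - \<kappa> i\<bar>) \<le> \<epsilon> * (a i * ((k - \<kappa> i) * \<beta> i))" for i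
    proof -
      have "a i * (- \<bar>k - \<kappa> i\<bar> * (32 * C * \<theta>)) \<le> a i * (- \<bar>k - \<kappa> i\<bar> * (8 * \<tau>\<^sup>2 / D))"
        using \<tau>C a by (intro mult_left_mono mult_left_mono_neg) auto
      also have "\<dots> \<le> a i * (\<epsilon> * (k - \<kappa> i) * \<beta> i)" unfolding \<beta>_def by (intro mult_left_mono \<sigma>(2) a)
      finally show ?thesis by (simp add: algebra_simps)
    qed
    then have "(\<Sum>i\<in>UNIV. - (32 * C * \<theta>) * (a i * \<bar>k - \<kappa> i\<bar>)) \<le> (\<Sum>i\<in>UNIV. \<epsilon> * (a i * ((k - \<kappa> i) * \<beta> i)))"
      by (intro sum_mono)
    then show ?thesis by (simp only: sum_distrib_left)
  qed
  ultimately have "- A2 * \<theta> - 2 * ((32 * C * \<theta>) * (\<Sum>i\<in>UNIV. a i * \<bar>k - \<kappa> i\<bar>)) \<le> \<epsilon> * wt - \<epsilon> * (\<Sum>i\<in>UNIV. a i * w i)"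
    by simp
  then have "- A2 * \<theta> - 2 * ((32 * C * \<theta>) * (\<Sum>i\<in>UNIV. a i * \<bar>k - \<kappa> i\<bar>)) \<le> - L * \<theta>"
    using wt w0 by linarith
  then have "L * \<theta> \<le> (A2 + 64 * C * (\<Sum>i\<in>UNIV. a i * \<bar>k - \<kappa> i\<bar>)) * \<theta>" by (simp add: algebra_simps)
  then have "L \<le> A2 + 64 * C * (\<Sum>i\<in>UNIV. a i * \<bar>k - \<kappa> i\<bar>)" using \<theta> by simp
  then show False using L A2_def by simp
qed

section \<open>Frames and speed functions\<close>

text \<open>Principal curvatures come with a basis of eigenvectors that need not be orthogonal.
  Among the vectors sharing one eigenvalue an orthonormal basis of their span is chosen; across
  eigenvalues orthogonality follows from the symmetry of \<open>H\<close>. Lengths are measured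
  after applying \<open>D\<close>.\<close>

lemma orthonormal_eigenframe:
  fixes D :: "'p::euclidean_space \<Rightarrow> 'e::euclidean_space" and H :: "'p \<Rightarrow> 'p \<Rightarrow> real"
    and e :: "'n::finite \<Rightarrow> 'p" and \<kappa> :: "'n \<Rightarrow> real"
  assumes D: "linear D" "inj D" and H: "\<And>v. linear (\<lambda>u. H u v)" "\<And>u v. H u v = H v u"
    and e: "inj e" "independent (range e)" and eig: "\<And>i v. H (e i) v = \<kappa> i * (D (e i) \<bullet> D v)"
  shows "\<exists>u :: 'n \<Rightarrow> 'p. (\<forall>i j. D (u i) \<bullet> D (u j) = (if i = j then 1 else 0)) \<and>
     (\<forall>i v. H (u i) v = \<kappa> i * (D (u i) \<bullet> D v))"
proof -
  define I where "I c = {i. \<kappa> i = c}" for c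
  have fin: "finite (I c)" for c by (rule finite)
  have "\<exists>B. B \<subseteq> span (D ` e ` I c) \<and> pairwise orthogonal B \<and> (\<forall>x\<in>B. norm x = 1) \<and> card B = card (I c) \<and> finite B" for c
  proof -
    have ind: "independent (D ` e ` I c)"
    proof (rule linear_independent_injective_image[OF D(1)])
      show "independent (e ` I c)" by (rule independent_mono[OF e(2)]) auto
      show "inj_on D (span (e ` I c))" using D(2) by (rule inj_on_subset) simp
    qed
    have "inj_on (\<lambda>i. D (e i)) (I c)" using D(2) e(1) by (auto simp: inj_on_def)
    then have "card (D ` e ` I c) = card (I c)" by (simp add: image_image card_image)
    then have dim: "dim (span (D ` e ` I c)) = card (I c)" using ind by (simp add: dim_eq_card_independent)
    obtain B where B: "B \<subseteq> span (D ` e ` I c)" "pairwise orthogonal B" "\<And>x. x \<in> B \<Longrightarrow> norm x = 1"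
      "independent B" "card B = dim (span (D ` e ` I c))"
      using orthonormal_basis_subspace[OF subspace_span[of "D ` e ` I c"]] by metis
    then show ?thesis using dim independent_imp_finite by metis
  qed
  then obtain B where B: "\<And>c. B c \<subseteq> span (D ` e ` I c)" "\<And>c. pairwise orthogonal (B c)"
    "\<And>c x. x \<in> B c \<Longrightarrow> norm x = 1" "\<And>c. card (B c) = card (I c)" "\<And>c. finite (B c)" by metis
  have "\<exists>g. bij_betw g (I c) (B c)" for c
    using finite_same_card_bij[OF fin B(5)] B(4) by metis
  then obtain g where g: "\<And>c. bij_betw (g c) (I c) (B c)" by metis
  \<comment> \<open>The bijection \<open>g c\<close> keeps the indexing: \<open>w i\<close> again
    belongs to the eigenvalue \<open>\<kappa> i\<close>, so the order of the entries is
    preserved.\<close>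
  define w where "w i = g (\<kappa> i) i" for i
  have wB: "w i \<in> B (\<kappa> i)" for i
    using bij_betwE[OF g[of "\<kappa> i"]] by (auto simp: w_def I_def)
  have "\<exists>u. u \<in> span (e ` I (\<kappa> i)) \<and> w i = D u" for i
  proof -
    have "w i \<in> D ` span (e ` I (\<kappa> i))"
      using wB[of i] B(1)[of "\<kappa> i"] linear_span_image[OF D(1), of "e ` I (\<kappa> i)"] by auto
    then show ?thesis by auto
  qed
  then obtain u where u: "\<And>i. u i \<in> span (e ` I (\<kappa> i))" "\<And>i. w i = D (u i)" by metis
  have Heig: "H x v = c * (D x \<bullet> D v)" if "x \<in> span (e ` I c)" for x c v
    using that
  proof (induction rule: span_induct_alt)
    case base
    then show ?case using linear_0[OF H(1)] linear_0[OF D(1)] by simp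
  next
    case (step a x y)
    then have "H x v = c * (D x \<bullet> D v)" using eig by (auto simp: I_def)
    then show ?case using step
      by (simp add: linear_add[OF H(1)] linear_scale[OF H(1)] linear_add[OF D(1)] linear_scale[OF D(1)]
          inner_add_left algebra_simps)
  qed
  have eigu: "H (u i) v = \<kappa> i * (D (u i) \<bullet> D v)" for i v by (rule Heig[OF u(1)])
  have "D (u i) \<bullet> D (u j) = (if i = j then 1 else 0)" for i j
  proof (cases "\<kappa> i = \<kappa> j")
    case True
    show ?thesis
    proof (cases "i = j")
      case True
      then show ?thesis using B(3)[OF wB[of i]] u(2) by (simp add: norm_eq_1)
    next
      case False
      have "i \<in> I (\<kappa> i)" "j \<in> I (\<kappa> i)" using True by (auto simp: I_def)
      then have "w i \<noteq> w j" using g[of "\<kappa> i"] False True by (auto simp: w_def bij_betw_def inj_on_def)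
      then show ?thesis using B(2)[of "\<kappa> i"] wB[of i] wB[of j] True False u(2)
        by (auto simp: pairwise_def orthogonal_def)
    qed
  next
    case False
    have "\<kappa> i * (D (u i) \<bullet> D (u j)) = \<kappa> j * (D (u i) \<bullet> D (u j))"
      using eigu[of i "u j"] eigu[of j "u i"] H(2)[of "u i" "u j"] by (metis inner_commute)
    then show ?thesis using False by auto
  qed
  then show ?thesis using eigu by blast
qed

lemma orthonormal_frame_expansion:
  fixes D :: "'p::euclidean_space \<Rightarrow> 'e::euclidean_space" and u :: "'n::finite \<Rightarrow> 'p"
  assumes D: "linear D" and card: "CARD('n) = DIM('p)"
    and u: "\<And>i j. D (u i) \<bullet> D (u j) = (if i = j then 1 else 0)"
  shows "x = (\<Sum>j\<in>UNIV. (D x \<bullet> D (u j)) *\<^sub>R u j)"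
proof -
  have Dsum: "D (\<Sum>j\<in>UNIV. c j *\<^sub>R u j) = (\<Sum>j\<in>UNIV. c j *\<^sub>R D (u j))" for c
    by (simp add: linear_sum[OF D] linear_scale[OF D])
  have coeff: "D (\<Sum>j\<in>UNIV. c j *\<^sub>R u j) \<bullet> D (u k) = c k" for c k
    by (simp add: Dsum inner_sum_left u if_distrib cong: if_cong)
  have inj: "inj u"
    by (rule injI) (metis u zero_neq_one)
  have ind: "independent (range u)"
  proof (rule independent_if_scalars_zero)
    fix f x assume "(\<Sum>x\<in>range u. f x *\<^sub>R x) = 0" "x \<in> range u"
    then obtain k where k: "x = u k" by blast
    have "(\<Sum>j\<in>UNIV. f (u j) *\<^sub>R u j) = 0"
      using \<open>(\<Sum>x\<in>range u. f x *\<^sub>R x) = 0\<close> by (simp add: sum.reindex[OF inj])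
    then have "f (u k) = D 0 \<bullet> D (u k)" using coeff[of "\<lambda>j. f (u j)" k] by simp
    then show "f x = 0" by (simp add: k linear_0[OF D])
  qed simp
  have "UNIV \<subseteq> span (range u)"
    using card_eq_dim[of "range u" UNIV] ind inj card by (simp add: card_image)
  then have "x \<in> span (range u)" by blast
  then obtain f where f: "x = (\<Sum>v\<in>range u. f v *\<^sub>R v)" by (auto simp: span_finite)
  then have "x = (\<Sum>j\<in>UNIV. f (u j) *\<^sub>R u j)" by (simp add: sum.reindex[OF inj])
  moreover from this have "D x \<bullet> D (u k) = f (u k)" for k using coeff[of "\<lambda>j. f (u j)"] by simp
  ultimately show ?thesis by simp
qed

text \<open>Parseval for one frame expanded in the other. With the frames exchanged it gives the
  column sums, so the squared cosines form a doubly stochastic matrix.\<close>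

lemma orthonormal_frame_stochastic:
  fixes D :: "'p::euclidean_space \<Rightarrow> 'e::euclidean_space" and u w :: "'n::finite \<Rightarrow> 'p"
  assumes D: "linear D" and card: "CARD('n) = DIM('p)"
    and u: "\<And>i j. D (u i) \<bullet> D (u j) = (if i = j then 1 else 0)"
    and w: "\<And>i j. D (w i) \<bullet> D (w j) = (if i = j then 1 else 0)"
  shows "(\<Sum>j\<in>UNIV. (D (w i) \<bullet> D (u j))\<^sup>2) = 1"
proof -
  have "D (w i) = (\<Sum>j\<in>UNIV. (D (w i) \<bullet> D (u j)) *\<^sub>R D (u j))"
    using arg_cong[OF orthonormal_frame_expansion[OF D card u, of "w i"], of D]
    by (simp add: linear_sum[OF D] linear_scale[OF D])
  then have "D (w i) \<bullet> D (w i) = (\<Sum>j\<in>UNIV. (D (w i) \<bullet> D (u j)) *\<^sub>R D (u j)) \<bullet> D (w i)" by simp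
  also have "\<dots> = (\<Sum>j\<in>UNIV. (D (w i) \<bullet> D (u j)) * (D (u j) \<bullet> D (w i)))" by (simp add: inner_sum_left)
  finally show ?thesis using w[of i i] by (simp add: power2_eq_square inner_commute)
qed

text \<open>Together with \<open>orthonormal_frame_stochastic\<close> this is the easy half of the
  Schur-Horn theorem: the diagonal of a symmetric form in an orthonormal frame is a doubly
  stochastic average of its eigenvalues.\<close>

lemma frame_diagonal:
  fixes D :: "'p::euclidean_space \<Rightarrow> 'e::euclidean_space" and u :: "'n::finite \<Rightarrow> 'p"
  assumes D: "linear D" and card: "CARD('n) = DIM('p)"
    and u: "\<And>i j. D (u i) \<bullet> D (u j) = (if i = j then 1 else 0)"
    and H: "\<And>v. linear (\<lambda>u. H u v)" and eig: "\<And>i v. H (u i) v = \<kappa> i * (D (u i) \<bullet> D v)"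
  shows "H x x = (\<Sum>j\<in>UNIV. (D x \<bullet> D (u j))\<^sup>2 * \<kappa> j)"
proof -
  have "H x x = H (\<Sum>j\<in>UNIV. (D x \<bullet> D (u j)) *\<^sub>R u j) x"
    using orthonormal_frame_expansion[OF D card u, of x] by simp
  also have "\<dots> = (\<Sum>j\<in>UNIV. (D x \<bullet> D (u j)) * H (u j) x)"
    by (simp add: linear_sum[OF H] linear_scale[OF H])
  finally show ?thesis by (simp add: eig power2_eq_square inner_commute mult_ac)
qed

definition gradient :: "(real^'n::finite \<Rightarrow> real) \<Rightarrow> real^'n \<Rightarrow> 'n \<Rightarrow> real" where
  "gradient f z i = dd (axis i 1) f z"

locale speed =
  fixes \<Gamma> :: "(real^'n::finite) set" and f :: "real^'n \<Rightarrow> real"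
  assumes cone: "admissible_cone \<Gamma>" and adm: "admissible_speed \<Gamma> f"
begin

lemma open_cone: "open \<Gamma>" using cone by (simp add: admissible_cone_def)

lemma local_C1:
  assumes "z \<in> \<Gamma>"
  shows "\<exists>V. open V \<and> z \<in> V \<and> V \<subseteq> \<Gamma> \<and> Ck_on 1 V f"
proof -
  have "smooth_on \<Gamma> f" using adm by (simp add: admissible_speed_def)
  then obtain W g where W: "open W" "z \<in> W" "\<forall>k. Ck_on k W g" "\<forall>q\<in>W \<inter> \<Gamma>. g q = f q"
    unfolding smooth_on_def using assms by metis
  have o: "open (W \<inter> \<Gamma>)" using W open_cone by blast
  have "Ck_on 1 (W \<inter> \<Gamma>) f"
    by (rule Ck_on_cong[OF o, of g]) (use W Ck_on_subset[of 1 W g "W \<inter> \<Gamma>"] in auto)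
  then show ?thesis using o W assms by (intro exI[of _ "W \<inter> \<Gamma>"]) auto
qed

lemma differentiable: "z \<in> \<Gamma> \<Longrightarrow> f differentiable (at z)"
  using local_C1[of z] by (auto simp: Ck_on_Suc_dd[of 0, simplified])

lemma gradient_isCont: "z \<in> \<Gamma> \<Longrightarrow> isCont (\<lambda>z. gradient f z i) z"
proof -
  assume "z \<in> \<Gamma>"
  then obtain V where "open V" "z \<in> V" "continuous_on V (dd (axis i 1) f)"
    using local_C1[of z] by (auto simp: Ck_on_Suc_dd[of 0, simplified])
  then show ?thesis unfolding gradient_def by (simp add: continuous_on_eq_continuous_at)
qed

lemma dd_gradient:
  assumes "z \<in> \<Gamma>" shows "dd v f z = (\<Sum>i\<in>UNIV. gradient f z i * v $ i)"
proof -
  have "v = (\<Sum>i\<in>UNIV. (v $ i) *\<^sub>R axis i 1)"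
    by (metis (no_types, lifting) basis_expansion scalar_mult_eq_scaleR sum.cong)
  then have "dd v f z = dd (\<Sum>i\<in>UNIV. (v $ i) *\<^sub>R axis i 1) f z" by simp
  also have "\<dots> = (\<Sum>i\<in>UNIV. v $ i * dd (axis i 1) f z)"
    by (simp add: linear_sum[OF linear_dd[OF differentiable[OF assms]]] linear_scale[OF linear_dd[OF differentiable[OF assms]]])
  finally show ?thesis by (simp add: gradient_def mult.commute)
qed

lemma dd_has_real_derivative:
  assumes "z \<in> \<Gamma>" shows "((\<lambda>s. f (z + s *\<^sub>R v)) has_real_derivative dd v f z) (at 0)"
proof -
  have "((\<lambda>s. f (z + s *\<^sub>R v)) has_vector_derivative dd v f (z + 0 *\<^sub>R v)) (at 0)"
    by (rule has_vector_derivative_dd_compose)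
       (use differentiable assms in \<open>auto intro!: derivative_eq_intros\<close>)
  then show ?thesis by (simp add: has_real_derivative_iff_has_vector_derivative)
qed

lemma eventually_in_cone:
  assumes "z \<in> \<Gamma>" shows "\<forall>\<^sub>F s in nhds (0::real). z + s *\<^sub>R v \<in> \<Gamma>"
proof -
  have "((\<lambda>s. z + s *\<^sub>R v) \<longlongrightarrow> z + 0 *\<^sub>R v) (nhds 0)" by (intro tendsto_intros filterlim_ident)
  then show ?thesis using topological_tendstoD[OF _ open_cone] assms by fastforce
qed

lemma gradient_nonneg:
  assumes "z \<in> \<Gamma>" shows "0 \<le> gradient f z i"
proof (rule ccontr)
  assume "\<not> ?thesis"
  then have "dd (axis i 1) f z < 0" by (simp add: gradient_def)
  from DERIV_neg_dec_right[OF dd_has_real_derivative[OF assms] this]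
  obtain r where r: "r > 0" "\<And>h. 0 < h \<Longrightarrow> h < r \<Longrightarrow> f (z + h *\<^sub>R axis i 1) < f z" by auto
  obtain r' where r': "r' > 0" "\<And>h. \<bar>h\<bar> < r' \<Longrightarrow> z + h *\<^sub>R axis i 1 \<in> \<Gamma>"
    using eventually_in_cone[OF assms, of "axis i 1"] unfolding eventually_nhds_metric by (auto simp: dist_real_def)
  define h where "h = min r r' / 2"
  have h: "0 < h" "h < r" "h < r'" using r r' by (auto simp: h_def)
  have ax: "h *\<^sub>R axis i 1 = axis i h" by (simp add: axis_def vec_eq_iff)
  have "f z \<le> f (z + axis i h)"
    using adm r'(2)[of h] h assms unfolding ax admissible_speed_def by auto
  then show False using r(2)[of h] h by (simp add: ax)
qed

lemma euler:
  assumes z: "z \<in> \<Gamma>" shows "(\<Sum>i\<in>UNIV. gradient f z i * z $ i) = f z"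
proof -
  have "((\<lambda>s. (1 + s) * f z) has_real_derivative f z) (at 0)" by (auto intro!: derivative_eq_intros)
  moreover have "\<forall>\<^sub>F s in nhds 0. f (z + s *\<^sub>R z) = (1 + s) * f z"
    unfolding eventually_nhds_metric
  proof (intro exI[of _ 1] conjI allI impI)
    fix s :: real assume "dist s 0 < 1"
    then have "0 < 1 + s" by (auto simp: dist_real_def)
    then have "f ((1 + s) *\<^sub>R z) = (1 + s) * f z" using adm z by (simp add: admissible_speed_def)
    then show "f (z + s *\<^sub>R z) = (1 + s) * f z" by (simp add: algebra_simps)
  qed simp
  ultimately have "((\<lambda>s. f (z + s *\<^sub>R z)) has_real_derivative f z) (at 0)"
    by (subst DERIV_cong_ev[OF refl _ refl]) auto
  then have "dd z f z = f z" using DERIV_unique dd_has_real_derivative[OF z] by blast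
  then show ?thesis by (simp add: dd_gradient[OF z])
qed

definition curv_sign :: "real \<Rightarrow> bool" where
  "curv_sign \<epsilon> \<longleftrightarrow> (\<epsilon> = 1 \<and> concave_on \<Gamma> f) \<or> (\<epsilon> = -1 \<and> convex_on \<Gamma> f)"

text \<open>The tangent plane of a function homogeneous of degree one passes through the origin by
  \<open>euler\<close>, hence the supporting inequality has no constant term.\<close>

lemma supporting_gradient:
  assumes \<epsilon>: "curv_sign \<epsilon>" and z: "z \<in> \<Gamma>" and w: "w \<in> \<Gamma>"
  shows "\<epsilon> * f w \<le> \<epsilon> * (\<Sum>i\<in>UNIV. gradient f z i * w $ i)"
proof -
  have cv: "convex_on \<Gamma> (\<lambda>x. - \<epsilon> * f x)" using \<epsilon> by (auto simp: curv_sign_def concave_on_def)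
  let ?g = "\<lambda>s. - \<epsilon> * f (z + s *\<^sub>R (w - z))"
  have d: "(?g has_real_derivative - \<epsilon> * dd (w - z) f z) (at 0)"
    by (intro DERIV_cmult dd_has_real_derivative z)
  then have "((\<lambda>s. (?g s - ?g 0) / (s - 0)) \<longlongrightarrow> - \<epsilon> * dd (w - z) f z) (at 0)"
    by (simp add: has_field_derivative_iff)
  then have lim: "((\<lambda>s. (?g s - ?g 0) / (s - 0)) \<longlongrightarrow> - \<epsilon> * dd (w - z) f z) (at_right 0)"
    by (rule filterlim_mono) (auto simp: at_le)
  have "- \<epsilon> * dd (w - z) f z \<le> - \<epsilon> * f w + \<epsilon> * f z"
  proof (rule tendsto_upperbound[OF lim])
    show "\<forall>\<^sub>F s in at_right 0. (?g s - ?g 0) / (s - 0) \<le> - \<epsilon> * f w + \<epsilon> * f z"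
      unfolding eventually_at_right_field
    proof (intro exI[of _ 1] conjI allI impI)
      fix s :: real assume s: "0 < s" "s < 1"
      have "- \<epsilon> * f ((1 - s) *\<^sub>R z + s *\<^sub>R w) \<le> (1 - s) * (- \<epsilon> * f z) + s * (- \<epsilon> * f w)"
        using convex_onD[OF cv, of s z w] s z w by simp
      moreover have "(1 - s) *\<^sub>R z + s *\<^sub>R w = z + s *\<^sub>R (w - z)" by (simp add: algebra_simps)
      ultimately have "?g s - ?g 0 \<le> s * (- \<epsilon> * f w + \<epsilon> * f z)" by (simp add: algebra_simps)
      then show "(?g s - ?g 0) / (s - 0) \<le> - \<epsilon> * f w + \<epsilon> * f z" using s by (simp add: field_simps)
    qed simp
  qed simp
  moreover have "dd (w - z) f z = (\<Sum>i\<in>UNIV. gradient f z i * w $ i) - f z"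
    unfolding dd_gradient[OF z] by (simp add: right_diff_distrib sum_subtractf euler[OF z])
  ultimately show ?thesis by (simp add: algebra_simps)
qed

text \<open>This stands in for concavity or convexity of the speed as a function of symmetric
  matrices. Rearrangement replaces the doubly stochastic average by a permutation, which
  \<open>f\<close> does not notice; then \<open>supporting_gradient\<close> applies.\<close>

lemma supporting_gradient_stochastic:
  assumes \<epsilon>: "curv_sign \<epsilon>" and z: "z \<in> \<Gamma>" and w: "w \<in> \<Gamma>"
    and S: "\<And>i j. 0 \<le> S i j" "\<And>i. (\<Sum>j\<in>UNIV. S i j) = 1" "\<And>j. (\<Sum>i\<in>UNIV. S i j) = 1"
  shows "\<epsilon> * f w \<le> \<epsilon> * (\<Sum>i\<in>UNIV. gradient f z i * (\<Sum>j\<in>UNIV. S i j * w $ j))"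
proof -
  have "\<exists>\<pi>. bij_betw \<pi> UNIV UNIV \<and> (\<Sum>i\<in>UNIV. (\<epsilon> * gradient f z i) * w $ \<pi> i)
      \<le> (\<Sum>i\<in>UNIV. \<Sum>j\<in>UNIV. (\<epsilon> * gradient f z i) * S i j * w $ j)"
    by (rule doubly_stochastic_rearrangement) (simp_all add: S)
  then obtain \<pi> where \<pi>: "bij \<pi>" "(\<Sum>i\<in>UNIV. (\<epsilon> * gradient f z i) * w $ \<pi> i)
      \<le> (\<Sum>i\<in>UNIV. \<Sum>j\<in>UNIV. (\<epsilon> * gradient f z i) * S i j * w $ j)" by blast
  have mem: "(\<chi> i. w $ \<pi> i) \<in> \<Gamma>" using cone w \<pi>(1) by (simp add: admissible_cone_def)
  have "f (\<chi> i. w $ \<pi> i) = f w" using adm w \<pi>(1) by (simp add: admissible_speed_def)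
  then have "\<epsilon> * f w \<le> \<epsilon> * (\<Sum>i\<in>UNIV. gradient f z i * w $ \<pi> i)"
    using supporting_gradient[OF \<epsilon> z mem] by simp
  also have "\<dots> = (\<Sum>i\<in>UNIV. (\<epsilon> * gradient f z i) * w $ \<pi> i)" by (simp add: sum_distrib_left mult.assoc)
  also note \<pi>(2)
  also have "(\<Sum>i\<in>UNIV. \<Sum>j\<in>UNIV. (\<epsilon> * gradient f z i) * S i j * w $ j)
     = \<epsilon> * (\<Sum>i\<in>UNIV. gradient f z i * (\<Sum>j\<in>UNIV. S i j * w $ j))"
    by (simp add: sum_distrib_left mult.assoc)
  finally show ?thesis .
qed

text \<open>Needed for limits of eigenframes: the diagonal in the limit frame must stay where the
  gradient of \<open>f\<close> is continuous.\<close>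

lemma stochastic_in_cone:
  assumes w: "w \<in> \<Gamma>"
    and S: "\<And>i j. 0 \<le> S i j" "\<And>i. (\<Sum>j\<in>UNIV. S i j) = 1" "\<And>j. (\<Sum>i\<in>UNIV. S i j) = 1"
  shows "(\<chi> i. \<Sum>j\<in>UNIV. S i j * w $ j) \<in> \<Gamma>"
proof -
  have "convex hull {\<chi> i. w $ \<pi> i |\<pi>. bij \<pi>} \<subseteq> \<Gamma>"
    using cone w by (intro hull_minimal) (auto simp: admissible_cone_def)
  then show ?thesis using doubly_stochastic_hull[of S w] S by blast
qed

end

section \<open>Local parametrizations\<close>

lemma dd_inner:
  fixes f g :: "'a::euclidean_space \<Rightarrow> 'b::real_inner"
  assumes "f differentiable (at z)" "g differentiable (at z)"
  shows "dd v (\<lambda>x. f x \<bullet> g x) z = f z \<bullet> dd v g z + dd v f z \<bullet> g z"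
  by (rule dd_eqI) (intro has_derivative_inner has_derivative_dd assms)

lemma dd_scaleR_fun:
  assumes "f differentiable (at z)" "g differentiable (at z)"
  shows "dd v (\<lambda>x. f x *\<^sub>R g x) z = f z *\<^sub>R dd v g z + dd v f z *\<^sub>R g z"
  by (rule dd_eqI) (intro has_derivative_scaleR has_derivative_dd assms)

lemma dd_const: "dd v (\<lambda>x. c) z = 0"
  by (rule dd_eqI) (rule has_derivative_const)

lemma dd_minus_fun: "f differentiable (at z) \<Longrightarrow> dd v (\<lambda>x. - f x) z = - dd v f z"
  by (rule dd_eqI) (intro has_derivative_minus has_derivative_dd)

lemma Ck_on_dd: "Ck_on (Suc k) S f \<Longrightarrow> Ck_on k S (dd v f)"
  using Ck_on_Suc_dd by blast

lemma Ck_on_differentiable: "Ck_on (Suc k) S f \<Longrightarrow> z \<in> S \<Longrightarrow> f differentiable (at z)"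
  using Ck_on_Suc_dd by blast

text \<open>Space and time form one variable, so that \<open>dd_commute\<close> also exchanges space
  derivatives with the time derivative.\<close>

locale smooth_patch =
  fixes W :: "('p::euclidean_space \<times> real) set" and Y :: "'p \<times> real \<Rightarrow> 'e::euclidean_space"
  assumes open_W: "open W" and smooth: "\<And>k. Ck_on k W Y"
begin

abbreviation D :: "'p \<Rightarrow> 'p \<times> real \<Rightarrow> 'e" where "D v \<equiv> dd (v, 0) Y"
abbreviation HH :: "'p \<Rightarrow> 'p \<Rightarrow> 'p \<times> real \<Rightarrow> 'e" where "HH u v \<equiv> dd (u, 0) (dd (v, 0) Y)"

lemma smooth_dd: "Ck_on k W (dd v Y)"
  by (rule Ck_on_dd[OF smooth])

lemma smooth_dd2: "Ck_on k W (dd u (dd v Y))"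
  by (rule Ck_on_dd[OF smooth_dd])

lemma diff: "z \<in> W \<Longrightarrow> Y differentiable (at z)" "z \<in> W \<Longrightarrow> dd v Y differentiable (at z)"
  using smooth[of 1] smooth_dd[of 1 v] by auto

lemma linear_D: "z \<in> W \<Longrightarrow> linear (\<lambda>v. D v z)"
  using dd_add[OF diff(1), of z "(_, 0)" "(_, 0)"] dd_scale[OF diff(1), of z _ "(_, 0)"]
  by (intro linearI) auto

lemma HH_commute: "z \<in> W \<Longrightarrow> HH u v z = HH v u z"
  by (rule dd_commute[OF open_W smooth])

lemma linear_HH: "z \<in> W \<Longrightarrow> linear (\<lambda>u. HH u v z)"
  using dd_add[OF diff(2), of z "(_, 0)" "(_, 0)"] dd_scale[OF diff(2), of z _ "(_, 0)"]
  by (intro linearI) auto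

lemma linear_HH': "z \<in> W \<Longrightarrow> linear (\<lambda>v. HH u v z)"
  using linear_HH[of z u] by (simp add: HH_commute[of z u])

lemma D_expand: "z \<in> W \<Longrightarrow> D v z = (\<Sum>b\<in>Basis. (v \<bullet> b) *\<^sub>R D b z)"
  by (subst euclidean_representation[of v, symmetric])
     (simp only: linear_sum[OF linear_D] linear_scale[OF linear_D])

lemma HH_expand:
  assumes "z \<in> W" shows "HH u v z = (\<Sum>b\<in>Basis. \<Sum>c\<in>Basis. (u \<bullet> b) *\<^sub>R (v \<bullet> c) *\<^sub>R HH b c z)"
proof -
  have "HH u v z = HH (\<Sum>b\<in>Basis. (u \<bullet> b) *\<^sub>R b) v z" by (simp only: euclidean_representation)
  also have "\<dots> = (\<Sum>b\<in>Basis. (u \<bullet> b) *\<^sub>R HH b v z)"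
    by (simp only: linear_sum[OF linear_HH[OF assms]] linear_scale[OF linear_HH[OF assms]])
  also have "\<dots> = (\<Sum>b\<in>Basis. (u \<bullet> b) *\<^sub>R HH b (\<Sum>c\<in>Basis. (v \<bullet> c) *\<^sub>R c) z)" by (simp only: euclidean_representation)
  also have "\<dots> = (\<Sum>b\<in>Basis. (u \<bullet> b) *\<^sub>R (\<Sum>c\<in>Basis. (v \<bullet> c) *\<^sub>R HH b c z))"
    by (simp only: linear_sum[OF linear_HH'[OF assms]] linear_scale[OF linear_HH'[OF assms]])
  finally show ?thesis by (simp only: scaleR_sum_right)
qed

lemma isCont_dd: "z \<in> W \<Longrightarrow> isCont (dd v Y) z"
  using Ck_on_continuous[OF smooth_dd[of 0]] open_W by (simp add: continuous_on_eq_continuous_at)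

lemma isCont_dd2: "z \<in> W \<Longrightarrow> isCont (dd u (dd v Y)) z"
  using Ck_on_continuous[OF smooth_dd2[of 0]] open_W by (simp add: continuous_on_eq_continuous_at)

lemma space_line:
  assumes "(p + s *\<^sub>R v, t) \<in> W"
  shows "((\<lambda>s. Y (p + s *\<^sub>R v, t)) has_vector_derivative D v (p + s *\<^sub>R v, t)) (at s within T)"
    "((\<lambda>s. dd w Y (p + s *\<^sub>R v, t)) has_vector_derivative dd (v, 0) (dd w Y) (p + s *\<^sub>R v, t)) (at s within T)"
proof -
  have c: "((\<lambda>s. (p + s *\<^sub>R v, t)) has_vector_derivative (v, 0)) (at s within T)"
    by (rule has_vector_derivative_Pair) (auto intro!: derivative_eq_intros)
  show "((\<lambda>s. Y (p + s *\<^sub>R v, t)) has_vector_derivative D v (p + s *\<^sub>R v, t)) (at s within T)"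
    by (rule has_vector_derivative_dd_compose[OF diff(1)[OF assms] c])
  show "((\<lambda>s. dd w Y (p + s *\<^sub>R v, t)) has_vector_derivative dd (v, 0) (dd w Y) (p + s *\<^sub>R v, t)) (at s within T)"
    by (rule has_vector_derivative_dd_compose[OF diff(2)[OF assms] c])
qed

text \<open>Continuity of finitely many basis derivatives keeps \<open>D v z\<close> within
  \<open>c / 2 * norm v\<close> of \<open>D v z0\<close> on a ball. Balls are convex, so a mean
  value estimate along segments transfers the lower bound from tangent vectors to chords at equal
  times. The chord bound is what makes later estimates uniform near the diagonal.\<close>

lemma local_bounds:
  assumes z0: "z0 \<in> W" and inj: "\<And>v. D v z0 = 0 \<Longrightarrow> v = 0"
  shows "\<exists>r c C. 0 < r \<and> 0 < c \<and> 0 < C \<and> ball z0 r \<subseteq> W \<and>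
    (\<forall>z\<in>ball z0 r. \<forall>v. c * norm v \<le> norm (D v z)) \<and>
    (\<forall>z\<in>ball z0 r. \<forall>u v. norm (HH u v z) \<le> C * norm u * norm v) \<and>
    (\<forall>p q t. (p, t) \<in> ball z0 r \<longrightarrow> (q, t) \<in> ball z0 r \<longrightarrow>
       c * norm (q - p) \<le> norm (Y (q, t) - Y (p, t)) \<and>
       norm (Y (q, t) - Y (p, t) - D (q - p) z0) \<le> c / 2 * norm (q - p))"
proof -
  have "inj (\<lambda>v. D v z0)" using inj by (simp add: linear_injective_0[OF linear_D[OF z0]])
  then obtain c2 where c2: "c2 > 0" "\<And>v. c2 * norm v \<le> norm (D v z0)"
    using linear_inj_bounded_below_pos[OF linear_D[OF z0]] by metis
  \<comment> \<open>Half of the injectivity constant at \<open>z0\<close>: after the loss of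
    \<open>c / 2\<close> to the perturbation at least \<open>c\<close> remains.\<close>
  define c where "c = c2 / 2"
  have c: "c > 0" "\<And>v. 2 * c * norm v \<le> norm (D v z0)" using c2 by (auto simp: c_def)
  \<comment> \<open>\<open>D v\<close> is a sum over \<open>DIM('p)\<close> basis directions, each
    with an error of at most \<open>norm v * \<eta>\<close>.\<close>
  define \<eta> where "\<eta> = c / (2 * DIM('p))"
  have \<eta>: "\<eta> > 0" using c by (simp add: \<eta>_def)
  have "\<forall>\<^sub>F z in nhds z0. z \<in> W \<and> (\<forall>b\<in>Basis. dist (D b z) (D b z0) < \<eta>) \<and>
      (\<forall>b\<in>Basis. \<forall>b'\<in>Basis. dist (HH b b' z) (HH b b' z0) < 1)"
    using isCont_dd[OF z0] isCont_dd2[OF z0] \<eta> z0 open_W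
    by (intro eventually_conj eventually_ball_finite ballI tendstoD eventually_nhds_in_open)
       (auto simp: isCont_def tendsto_at_iff_tendsto_nhds)
  then obtain r where r: "r > 0" and rb: "\<And>z. z \<in> ball z0 r \<Longrightarrow> z \<in> W \<and> (\<forall>b\<in>Basis. dist (D b z) (D b z0) < \<eta>) \<and>
      (\<forall>b\<in>Basis. \<forall>b'\<in>Basis. dist (HH b b' z) (HH b b' z0) < 1)"
    unfolding eventually_nhds_metric by (auto simp: dist_commute)
  define C where "C = 1 + (\<Sum>b\<in>(Basis::'p set). \<Sum>b'\<in>(Basis::'p set). norm (HH b b' z0) + 1)"
  have C: "C > 0" unfolding C_def by (intro add_pos_nonneg sum_nonneg) auto
  have close: "norm (D v z - D v z0) \<le> c / 2 * norm v" if "z \<in> ball z0 r" for z v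
  proof -
    have "D v z - D v z0 = (\<Sum>b\<in>Basis. (v \<bullet> b) *\<^sub>R (D b z - D b z0))"
      using D_expand[of z v] D_expand[OF z0, of v] rb[OF that] by (simp add: scaleR_diff_right sum_subtractf)
    also have "norm \<dots> \<le> (\<Sum>b\<in>(Basis::'p set). norm v * \<eta>)"
      by (rule sum_norm_le)
         (use rb[OF that] \<eta> in \<open>auto intro!: mult_mono simp: Basis_le_norm dist_norm less_imp_le\<close>)
    finally show ?thesis by (simp add: \<eta>_def mult.commute)
  qed
  have bd: "norm (HH u v z) \<le> C * norm u * norm v" if "z \<in> ball z0 r" for z u v
  proof -
    have "norm (HH u v z) \<le> (\<Sum>b\<in>(Basis::'p set). \<Sum>b'\<in>(Basis::'p set). norm u * (norm v * (norm (HH b b' z0) + 1)))"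
    proof (subst HH_expand[OF conjunct1[OF rb[OF that]]], intro sum_norm_le)
      fix b b' :: 'p assume b: "b \<in> Basis" "b' \<in> Basis"
      have "norm (HH b b' z) \<le> norm (HH b b' z0) + 1"
      proof -
        have "norm (HH b b' z - HH b b' z0) < 1" using rb[OF that] b unfolding dist_norm by blast
        then show ?thesis using norm_triangle_sub[of "HH b b' z" "HH b b' z0"] by linarith
      qed
      then show "norm ((u \<bullet> b) *\<^sub>R (v \<bullet> b') *\<^sub>R HH b b' z) \<le> norm u * (norm v * (norm (HH b b' z0) + 1))"
        unfolding norm_scaleR using b by (intro mult_mono Basis_le_norm mult_nonneg_nonneg) auto
    qed
    also have "\<dots> = (\<Sum>b\<in>(Basis::'p set). \<Sum>b'\<in>(Basis::'p set). norm (HH b b' z0) + 1) * (norm u * norm v)"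
      unfolding sum_distrib_right by (intro sum.cong refl) (simp only: mult_ac)
    also have "\<dots> \<le> C * (norm u * norm v)" by (intro mult_right_mono) (auto simp: C_def)
    finally show ?thesis by (simp add: mult.assoc)
  qed
  have low: "c * norm v \<le> norm (D v z)" if "z \<in> ball z0 r" for z v
  proof -
    have "2 * c * norm v \<le> norm (D v z) + norm (D v z - D v z0)"
      using c(2)[of v] norm_triangle_sub[of "D v z0" "D v z"] by (simp add: norm_minus_commute)
    moreover have ar: "x \<le> y" if "2 * x \<le> y + b" "b \<le> x / 2" "0 \<le> x" for x y b :: real using that by linarith
    ultimately show ?thesis using close[OF that, of v] c(1)
      by (intro ar[of "c * norm v" "norm (D v z)" "norm (D v z - D v z0)"]) simp_all
  qed
  have est: "norm (Y (q, t) - Y (p, t) - D (q - p) z0) \<le> c / 2 * norm (q - p)"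
    if pq: "(p, t) \<in> ball z0 r" "(q, t) \<in> ball z0 r" for p q t
  proof -
    define g where "g s = Y (p + s *\<^sub>R (q - p), t) - s *\<^sub>R D (q - p) z0" for s
    have seg: "(p + s *\<^sub>R (q - p), t) \<in> ball z0 r" if "0 \<le> s" "s \<le> 1" for s
    proof -
      have "(1 - s) *\<^sub>R (p, t) + s *\<^sub>R (q, t) \<in> ball z0 r"
        by (rule convexD_alt[OF convex_ball pq that])
      moreover have "(1 - s) *\<^sub>R (p, t) + s *\<^sub>R (q, t) = (p + s *\<^sub>R (q - p), t)"
        by (simp add: algebra_simps)
      ultimately show ?thesis by simp
    qed
    have "norm (g 1 - g 0) \<le> c / 2 * norm (q - p) * norm (1 - (0::real))"
    proof (rule differentiable_bound[where S="{0..1}" and f=g])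
      fix s :: real assume s: "s \<in> {0..1}"
      have "(g has_vector_derivative D (q - p) (p + s *\<^sub>R (q - p), t) - 1 *\<^sub>R D (q - p) z0) (at s within {0..1})"
        unfolding g_def using rb seg s
        by (intro has_vector_derivative_diff space_line) (auto intro!: derivative_eq_intros)
      then show "(g has_derivative (\<lambda>h. h *\<^sub>R (D (q - p) (p + s *\<^sub>R (q - p), t) - 1 *\<^sub>R D (q - p) z0))) (at s within {0..1})"
        by (simp add: has_vector_derivative_def)
      have "onorm (\<lambda>h. h *\<^sub>R (D (q - p) (p + s *\<^sub>R (q - p), t) - 1 *\<^sub>R D (q - p) z0))
         \<le> norm (D (q - p) (p + s *\<^sub>R (q - p), t) - 1 *\<^sub>R D (q - p) z0)"
        by (rule onorm_le) simp
      also have "\<dots> \<le> c / 2 * norm (q - p)" using close[OF seg, of s "q - p"] s by simp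
      finally show "onorm (\<lambda>h. h *\<^sub>R (D (q - p) (p + s *\<^sub>R (q - p), t) - 1 *\<^sub>R D (q - p) z0)) \<le> c / 2 * norm (q - p)" .
    qed auto
    then show ?thesis by (simp add: g_def algebra_simps)
  qed
  have low2: "c * norm (q - p) \<le> norm (Y (q, t) - Y (p, t))"
    if pq: "(p, t) \<in> ball z0 r" "(q, t) \<in> ball z0 r" for p q t
  proof -
    have "2 * c * norm (q - p) \<le> norm (Y (q, t) - Y (p, t)) + c / 2 * norm (q - p)"
      using c(2)[of "q - p"] est[OF pq] norm_triangle_sub[of "D (q - p) z0" "Y (q, t) - Y (p, t)"]
      by (simp add: norm_minus_commute)
    moreover have ar: "x \<le> y" if "2 * x \<le> y + x / 2" "0 \<le> x" for x y :: real using that by linarith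
    ultimately show ?thesis using c(1)
      by (intro ar[of "c * norm (q - p)" "norm (Y (q, t) - Y (p, t))"]) simp_all
  qed
  show ?thesis using r c C rb bd low est low2
    by (intro exI[of _ r] exI[of _ c] exI[of _ C]) (auto simp del: mem_ball)
qed

text \<open>Two mean value steps along the segment: the first-order term vanishes because
  \<open>n\<close> is orthogonal to \<open>D (q - p)\<close> at the starting point, so the height
  over the tangent plane is quadratic.\<close>

lemma quadratic_tangency:
  assumes B: "ball z0 r \<subseteq> W" "\<And>z u v. z \<in> ball z0 r \<Longrightarrow> norm (HH u v z) \<le> C * norm u * norm v"
    and pq: "(p, t) \<in> ball z0 r" "(q, t) \<in> ball z0 r" and n: "norm n = 1" "D (q - p) (p, t) \<bullet> n = 0" and C: "0 < C"
  shows "\<bar>(Y (q, t) - Y (p, t)) \<bullet> n\<bar> \<le> C * (norm (q - p))\<^sup>2"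
proof -
  have seg: "(p + s *\<^sub>R (q - p), t) \<in> ball z0 r" if "0 \<le> s" "s \<le> 1" for s
  proof -
    have "(1 - s) *\<^sub>R (p, t) + s *\<^sub>R (q, t) \<in> ball z0 r"
      by (rule convexD_alt[OF convex_ball pq that])
    moreover have "(1 - s) *\<^sub>R (p, t) + s *\<^sub>R (q, t) = (p + s *\<^sub>R (q - p), t)"
      by (simp add: algebra_simps)
    ultimately show ?thesis by simp
  qed
  have inW: "(p + s *\<^sub>R (q - p), t) \<in> W" if "0 \<le> s" "s \<le> 1" for s
    using seg[OF that] B(1) by blast
  have d1: "DERIV (\<lambda>s. Y (p + s *\<^sub>R (q - p), t) \<bullet> n) s :> D (q - p) (p + s *\<^sub>R (q - p), t) \<bullet> n"
    if "0 \<le> s" "s \<le> 1" for s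
    unfolding has_real_derivative_iff_has_vector_derivative
    by (rule bounded_linear.has_vector_derivative[OF bounded_linear_inner_left space_line(1)[OF inW[OF that]]])
  have d2: "DERIV (\<lambda>s. D (q - p) (p + s *\<^sub>R (q - p), t) \<bullet> n) s :> HH (q - p) (q - p) (p + s *\<^sub>R (q - p), t) \<bullet> n"
    if "0 \<le> s" "s \<le> 1" for s
    unfolding has_real_derivative_iff_has_vector_derivative
    by (rule bounded_linear.has_vector_derivative[OF bounded_linear_inner_left space_line(2)[OF inW[OF that]]])
  obtain \<xi> where \<xi>: "0 < \<xi>" "\<xi> < 1"
    "Y (p + 1 *\<^sub>R (q - p), t) \<bullet> n - Y (p + 0 *\<^sub>R (q - p), t) \<bullet> n = (1 - 0) * (D (q - p) (p + \<xi> *\<^sub>R (q - p), t) \<bullet> n)"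
    using MVT2[OF zero_less_one, of "\<lambda>s. Y (p + s *\<^sub>R (q - p), t) \<bullet> n" "\<lambda>s. D (q - p) (p + s *\<^sub>R (q - p), t) \<bullet> n", OF d1] by metis
  have d2': "DERIV (\<lambda>s. D (q - p) (p + s *\<^sub>R (q - p), t) \<bullet> n) s :> HH (q - p) (q - p) (p + s *\<^sub>R (q - p), t) \<bullet> n"
    if "0 \<le> s" "s \<le> \<xi>" for s using d2 that \<xi> by simp
  obtain \<zeta> where \<zeta>: "0 < \<zeta>" "\<zeta> < \<xi>"
    "D (q - p) (p + \<xi> *\<^sub>R (q - p), t) \<bullet> n - D (q - p) (p + 0 *\<^sub>R (q - p), t) \<bullet> n
      = (\<xi> - 0) * (HH (q - p) (q - p) (p + \<zeta> *\<^sub>R (q - p), t) \<bullet> n)"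
    using MVT2[OF \<xi>(1), of "\<lambda>s. D (q - p) (p + s *\<^sub>R (q - p), t) \<bullet> n" "\<lambda>s. HH (q - p) (q - p) (p + s *\<^sub>R (q - p), t) \<bullet> n", OF d2'] by metis
  have "(Y (q, t) - Y (p, t)) \<bullet> n = \<xi> * (HH (q - p) (q - p) (p + \<zeta> *\<^sub>R (q - p), t) \<bullet> n)"
    using \<xi>(3) \<zeta>(3) n(2) by (simp add: inner_diff_left)
  also have "\<bar>\<dots>\<bar> \<le> 1 * (C * norm (q - p) * norm (q - p))"
    unfolding abs_mult
  proof (rule mult_mono)
    have "\<bar>HH (q - p) (q - p) (p + \<zeta> *\<^sub>R (q - p), t) \<bullet> n\<bar> \<le> norm (HH (q - p) (q - p) (p + \<zeta> *\<^sub>R (q - p), t))"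
      using Cauchy_Schwarz_ineq2[of _ n] n by simp
    also have "\<dots> \<le> C * norm (q - p) * norm (q - p)" using B(2) seg \<zeta> \<xi> by simp
    finally show "\<bar>HH (q - p) (q - p) (p + \<zeta> *\<^sub>R (q - p), t) \<bullet> n\<bar> \<le> C * norm (q - p) * norm (q - p)" .
  qed (use \<xi> in auto)
  finally show ?thesis by (simp add: power2_eq_square mult.assoc)
qed

end

text \<open>A hypersurface moving with speed \<open>G\<close> against its normal. The speed function
  \<open>f\<close> does not occur; later lemmas meet it only through a Jensen inequality taken as a
  hypothesis.\<close>

locale flow_patch = smooth_patch W Y
  for W :: "('p::euclidean_space \<times> real) set" and Y :: "'p \<times> real \<Rightarrow> 'e::euclidean_space" +
  fixes N :: "'p \<times> real \<Rightarrow> 'e" and G :: "'p \<times> real \<Rightarrow> real"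
  assumes dim: "DIM('e) = DIM('p) + 1"
    and velocity: "\<And>z. z \<in> W \<Longrightarrow> dd (0, 1) Y z = - (G z *\<^sub>R N z)"
    and unit: "\<And>z. z \<in> W \<Longrightarrow> N z \<bullet> N z = 1"
    and tangent: "\<And>z v. z \<in> W \<Longrightarrow> D v z \<bullet> N z = 0"
    and immersed: "\<And>z v. z \<in> W \<Longrightarrow> D v z = 0 \<Longrightarrow> v = 0"
    and C2N: "Ck_on 2 W N" and C2G: "Ck_on 2 W G"
begin

definition h :: "'p \<Rightarrow> 'p \<Rightarrow> 'p \<times> real \<Rightarrow> real" where "h u v z = - (HH u v z \<bullet> N z)"

lemma diffN: "z \<in> W \<Longrightarrow> N differentiable (at z)" "z \<in> W \<Longrightarrow> dd v N differentiable (at z)"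
  using C2N Ck_on_differentiable[of 1 W N z] Ck_on_differentiable[OF Ck_on_dd, of 0 W N z v]
  by (auto simp only: numeral_2_eq_2 One_nat_def)

lemma diffG: "z \<in> W \<Longrightarrow> G differentiable (at z)" "z \<in> W \<Longrightarrow> dd v G differentiable (at z)"
  using C2G Ck_on_differentiable[of 1 W G z] Ck_on_differentiable[OF Ck_on_dd, of 0 W G z v]
  by (auto simp only: numeral_2_eq_2 One_nat_def)

lemma N_dd: "z \<in> W \<Longrightarrow> N z \<bullet> dd v N z = 0"
proof -
  assume z: "z \<in> W"
  have "dd v (\<lambda>z. N z \<bullet> N z) z = dd v (\<lambda>z. 1) z" by (rule dd_cong_open[OF open_W z unit])
  then show ?thesis by (simp add: dd_inner diffN z dd_const inner_commute)
qed

lemma D_dd_N: "z \<in> W \<Longrightarrow> D v z \<bullet> dd w N z = - (dd w (D v) z \<bullet> N z)"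
proof -
  assume z: "z \<in> W"
  have "dd w (\<lambda>z. D v z \<bullet> N z) z = dd w (\<lambda>z. 0) z" by (rule dd_cong_open[OF open_W z tangent])
  then show ?thesis by (simp add: dd_inner diffN diff z dd_const)
qed

lemma weingarten: "z \<in> W \<Longrightarrow> h u v z = dd (u, 0) N z \<bullet> D v z"
  using D_dd_N[of z v "(u, 0)"] by (simp add: h_def inner_commute)

lemma h_commute: "z \<in> W \<Longrightarrow> h u v z = h v u z"
  by (simp add: h_def HH_commute)

lemma linear_h: "z \<in> W \<Longrightarrow> linear (\<lambda>u. h u v z)"
  unfolding h_def
  by (intro linearI) (simp_all add: linear_add[OF linear_HH] linear_scale[OF linear_HH] inner_add_left)

lemma tangent_range:
  assumes z: "z \<in> W" and w: "w \<bullet> N z = 0" shows "\<exists>v. D v z = w"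
proof -
  have inj: "inj (\<lambda>v. D v z)" using immersed[OF z] by (simp add: linear_injective_0[OF linear_D[OF z]])
  have sub: "range (\<lambda>v. D v z) \<subseteq> {x. N z \<bullet> x = 0}" using tangent[OF z] by (auto simp: inner_commute)
  have "dim (range (\<lambda>v. D v z)) = DIM('p)"
    using dim_image_eq[OF linear_D[OF z], of UNIV] inj by simp
  moreover have "dim {x. N z \<bullet> x = 0} = DIM('e) - 1"
    by (rule dim_hyperplane) (use unit[OF z] in auto)
  ultimately have "range (\<lambda>v. D v z) = {x. N z \<bullet> x = 0}"
    using dim sub by (intro subspace_dim_equal linear_subspace_image[OF linear_D[OF z]] subspace_hyperplane) auto
  moreover have "w \<in> {x. N z \<bullet> x = 0}" using w by (simp add: inner_commute)
  ultimately have "w \<in> range (\<lambda>v. D v z)" by simp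
  then show ?thesis by (rule rangeE) (rule exI, rule sym)
qed

lemma vector_eqI:
  assumes z: "z \<in> W" and N: "x \<bullet> N z = y \<bullet> N z" and T: "\<And>v. x \<bullet> D v z = y \<bullet> D v z"
  shows "x = y"
proof -
  have "(x - y) \<bullet> N z = 0" using N by (simp add: inner_diff_left)
  then obtain v where v: "D v z = x - y" using tangent_range[OF z] by blast
  have "(x - y) \<bullet> (x - y) = 0" using T[of v] unfolding v by (simp add: inner_diff_left)
  then show ?thesis by simp
qed

lemma dd_velocity:
  assumes "z \<in> W" shows "dd v (dd (0, 1) Y) z = - (G z *\<^sub>R dd v N z + dd v G z *\<^sub>R N z)"
proof -
  have "dd v (dd (0, 1) Y) z = dd v (\<lambda>z. - (G z *\<^sub>R N z)) z"
    by (rule dd_cong_open[OF open_W assms velocity])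
  also have "\<dots> = - dd v (\<lambda>z. G z *\<^sub>R N z) z"
    by (rule dd_minus_fun) (use diffN diffG assms in \<open>auto intro: differentiable_scaleR\<close>)
  finally show ?thesis by (simp add: dd_scaleR_fun diffN diffG assms)
qed

lemma dd_time_D:
  assumes "z \<in> W" shows "dd (0, 1) (D v) z = - (G z *\<^sub>R dd (v, 0) N z + dd (v, 0) G z *\<^sub>R N z)"
  using dd_velocity[OF assms] dd_commute[OF open_W smooth assms] by metis

text \<open>The evolution equation of the normal, whose time derivative is the gradient of the
  speed, tested with a tangent vector. It follows by differentiating
  \<open>D v z \<bullet> N z = 0\<close> in time.\<close>

lemma time_normal:
  assumes "z \<in> W" shows "dd (0, 1) N z \<bullet> D v z = dd (v, 0) G z"
  using D_dd_N[OF assms, of v "(0, 1)"] unfolding dd_time_D[OF assms]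
  by (simp add: inner_add_left inner_diff_left unit assms N_dd[OF assms, unfolded inner_commute[of "N z"]] inner_commute[of "D v z"])

end

text \<open>\<open>w\<close> is the image of \<open>e\<close> under the rotation in the plane of
  \<open>n\<close> and \<open>m\<close> that takes \<open>n\<close> to \<open>m\<close>. Being
  rational in \<open>m\<close>, it yields an orthonormal tangent frame that is differentiable along
  a curve as soon as the normal is.\<close>

lemma rotated_frame:
  fixes n m :: "'e::real_inner" and e :: "'n \<Rightarrow> 'e"
  assumes nm: "n \<bullet> n = 1" "m \<bullet> m = 1" "1 + n \<bullet> m \<noteq> 0"
    and e: "\<And>i j. e i \<bullet> e j = (if i = j then 1 else 0)" "\<And>i. e i \<bullet> n = 0"
  defines "w \<equiv> \<lambda>i. e i - ((e i \<bullet> m) / (1 + n \<bullet> m)) *\<^sub>R (n + m)"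
  shows "w i \<bullet> m = 0" "w i \<bullet> w j = (if i = j then 1 else 0)"
proof -
  define x where "x i = (e i \<bullet> m) / (1 + n \<bullet> m)" for i
  have x: "e i \<bullet> m = x i * (1 + n \<bullet> m)" for i using nm by (simp add: x_def)
  have w: "w i = e i - x i *\<^sub>R (n + m)" for i by (simp add: w_def x_def)
  show "w i \<bullet> m = 0"
    by (simp add: w inner_diff_left inner_add_left nm x algebra_simps)
  have enm: "e i \<bullet> (n + m) = x i * (1 + n \<bullet> m)" for i by (simp add: inner_add_right e x)
  have nmnm: "(n + m) \<bullet> (n + m) = 2 * (1 + n \<bullet> m)"
    by (simp add: inner_add_left inner_add_right nm inner_commute[of m n])
  have "w i \<bullet> w j = e i \<bullet> e j - x j * (e i \<bullet> (n + m)) - x i * (e j \<bullet> (n + m)) + x i * (x j * ((n + m) \<bullet> (n + m)))"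
    unfolding w by (simp only: inner_diff_left inner_diff_right inner_scaleR_left inner_scaleR_right
        inner_commute[of "n + m" "e j"]) (simp add: right_diff_distrib)
  also have "\<dots> = e i \<bullet> e j" unfolding enm nmnm by (simp add: algebra_simps)
  finally show "w i \<bullet> w j = (if i = j then 1 else 0)" by (simp add: e)
qed

section \<open>First derivatives of the speed and the evolution equations\<close>

context flow_patch
begin

lemma normal_derivative_eigen:
  assumes "z \<in> W" and eig: "\<And>v. h u v z = \<kappa> * (D u z \<bullet> D v z)"
  shows "dd (u, 0) N z = \<kappa> *\<^sub>R D u z"
  by (rule vector_eqI[OF assms(1)])
     (use eig weingarten[OF assms(1)] tangent[OF assms(1)] N_dd[OF assms(1)] in \<open>auto simp: inner_commute\<close>)

text \<open>Polarisation around \<open>u\<close>. The first summand contains \<open>v\<close> only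
  through \<open>D v z\<close>, so it can be differentiated for a frame known only by its image
  vectors; the remainder is quadratic in \<open>v - u\<close>.\<close>

lemma h_shift:
  assumes z: "z \<in> W"
  shows "h v v z = dd (u, 0) N z \<bullet> (2 *\<^sub>R D v z - D u z) + h (v - u) (v - u) z"
proof -
  have "h v v z = h u u z + 2 * h u (v - u) z + h (v - u) (v - u) z"
  proof -
    have l1: "h (v - u) y z = h v y z - h u y z" for y by (rule linear_diff[OF linear_h[OF z]])
    have l2: "h y (v - u) z = h y v z - h y u z" for y
      using l1[of y] h_commute[OF z] by metis
    show ?thesis by (simp add: l1 l2 h_commute[OF z, of v u])
  qed
  also have "h u u z + 2 * h u (v - u) z = dd (u, 0) N z \<bullet> (2 *\<^sub>R D v z - D u z)"
    by (simp add: weingarten[OF z] linear_diff[OF linear_D[OF z]] inner_diff_right)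
  finally show ?thesis .
qed

text \<open>Jensen's inequality for the rotated frame is an equality at \<open>z0\<close>, so both sides have the
  same derivative there. This replaces differentiating the speed as a function of the second
  fundamental form.\<close>

lemma speed_derivative:
  fixes u :: "'n::finite \<Rightarrow> 'p"
  assumes z0: "z0 \<in> W" and orth: "\<And>i j. D (u i) z0 \<bullet> D (u j) z0 = (if i = j then 1 else 0)"
    and eig: "\<And>i v. h (u i) v z0 = \<kappa> i * (D (u i) z0 \<bullet> D v z0)"
    and G0: "(\<Sum>i\<in>UNIV. a i * \<kappa> i) = G z0" and \<epsilon>: "\<epsilon> = 1 \<or> \<epsilon> = (-1::real)"
    and J: "\<And>z (w :: 'n \<Rightarrow> 'p). z \<in> W \<Longrightarrow> (\<And>i j. D (w i) z \<bullet> D (w j) z = (if i = j then 1 else 0)) \<Longrightarrow>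
       \<epsilon> * G z \<le> \<epsilon> * (\<Sum>i\<in>UNIV. a i * h (w i) (w i) z)"
  shows "dd \<tau> G z0 = (\<Sum>i\<in>UNIV. a i * (dd \<tau> (dd (u i, 0) N) z0 \<bullet> D (u i) z0 - \<kappa> i * (D (u i) z0 \<bullet> dd \<tau> (D (u i)) z0)))"
proof -
  define c where "c s = z0 + s *\<^sub>R \<tau>" for s :: real
  have c0: "c 0 = z0" by (simp add: c_def)
  have dc: "(c has_vector_derivative \<tau>) (at 0)" unfolding c_def by (auto intro!: derivative_eq_intros)
  have chain: "((\<lambda>s. f (c s)) has_vector_derivative dd \<tau> f z0) (at 0)" if "f differentiable (at z0)"
    for f :: "'p \<times> real \<Rightarrow> 'q::real_normed_vector"
    using has_vector_derivative_dd_compose[OF _ dc, of f] that by (simp add: c0)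
  have ctend: "(c \<longlongrightarrow> z0) (nhds 0)"
    using has_vector_derivative_continuous[OF dc] c0 by (metis isCont_def tendsto_at_iff_tendsto_nhds)
  obtain r k C where B: "0 < r" "0 < k" "0 < C" "ball z0 r \<subseteq> W"
    "\<And>z v. z \<in> ball z0 r \<Longrightarrow> k * norm v \<le> norm (D v z)"
    "\<And>z u v. z \<in> ball z0 r \<Longrightarrow> norm (HH u v z) \<le> C * norm u * norm v"
    using local_bounds[OF z0 immersed[OF z0]] by metis
  define e where "e i = D (u i) z0" for i
  define N0 where "N0 = N z0"
  define N1 where "N1 = dd \<tau> N z0"
  have N01: "N0 \<bullet> N1 = 0" using N_dd[OF z0] by (simp add: N0_def N1_def)
  have N00: "N0 \<bullet> N0 = 1" using unit[OF z0] by (simp add: N0_def)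
  have eN: "e i \<bullet> N0 = 0" for i by (simp add: e_def N0_def tangent[OF z0])
  have ee: "e i \<bullet> e j = (if i = j then 1 else 0)" for i j by (simp add: e_def orth)
  have Nu0: "dd (u i, 0) N z0 = \<kappa> i *\<^sub>R e i" for i
    unfolding e_def by (rule normal_derivative_eigen[OF z0 eig])
  \<comment> \<open>The eigenframe \<open>e\<close> is rotated from the normal at \<open>z0\<close>
    to the normal at \<open>c s\<close>, as in \<open>rotated_frame\<close>.\<close>
  define x where "x i s = (e i \<bullet> N (c s)) / (1 + N0 \<bullet> N (c s))" for i s
  define w where "w i s = e i - x i s *\<^sub>R (N0 + N (c s))" for i s
  define g where "g i s = w i s - D (u i) (c s)" for i s
  have x0: "x i 0 = 0" for i by (simp add: x_def c0 N0_def[symmetric] eN)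
  have w0: "w i 0 = e i" for i by (simp add: w_def x0)
  have g0: "g i 0 = 0" for i by (simp add: g_def w0 c0 e_def)
  have dN: "((\<lambda>s. N (c s)) has_vector_derivative N1) (at 0)"
    unfolding N1_def by (rule chain[OF diffN(1)[OF z0]])
  have dinn: "((\<lambda>s. y \<bullet> N (c s)) has_real_derivative y \<bullet> N1) (at 0)" for y
    unfolding has_real_derivative_iff_has_vector_derivative
    by (rule bounded_linear.has_vector_derivative[OF bounded_linear_inner_right dN])
  have dx: "(x i has_real_derivative (e i \<bullet> N1) / 2) (at 0)" for i
  proof -
    have "(x i has_real_derivative ((e i \<bullet> N1) * (1 + N0 \<bullet> N (c 0)) - (e i \<bullet> N (c 0)) * (0 + N0 \<bullet> N1))
        / ((1 + N0 \<bullet> N (c 0)) * (1 + N0 \<bullet> N (c 0)))) (at 0)"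
      unfolding x_def
      by (intro DERIV_divide DERIV_add DERIV_const dinn) (simp add: c0 N0_def[symmetric] N00)
    then show ?thesis by (simp add: c0 N0_def[symmetric] N00 N01)
  qed
  have dw: "(w i has_vector_derivative - (e i \<bullet> N1) *\<^sub>R N0) (at 0)" for i
  proof -
    have "(w i has_vector_derivative 0 - (x i 0 *\<^sub>R (0 + N1) + ((e i \<bullet> N1) / 2) *\<^sub>R (N0 + N (c 0)))) (at 0)"
      unfolding w_def
      by (intro has_vector_derivative_diff has_vector_derivative_const has_vector_derivative_scaleR
          has_vector_derivative_add dN dx)
    moreover have "0 - (x i 0 *\<^sub>R (0 + N1) + ((e i \<bullet> N1) / 2) *\<^sub>R (N0 + N (c 0))) = - (e i \<bullet> N1) *\<^sub>R N0"
      by (simp add: x0 c0 N0_def[symmetric] scaleR_add_right scaleR_add_left[symmetric])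
    ultimately show ?thesis by simp
  qed
  define Yu where "Yu i = dd \<tau> (D (u i)) z0" for i
  have dY: "((\<lambda>s. D (u i) (c s)) has_vector_derivative Yu i) (at 0)" for i
    unfolding Yu_def by (rule chain[OF diff(2)[OF z0]])
  have dg: "(g i has_vector_derivative - (e i \<bullet> N1) *\<^sub>R N0 - Yu i) (at 0)" for i
    unfolding g_def by (intro has_vector_derivative_diff dw dY)
  \<comment> \<open>\<open>R\<close> is the first-order part of the frame sum from
    \<open>h_shift\<close>. \<open>Q\<close> dominates the quadratic remainder and has derivative 0,
    because \<open>g i 0 = 0\<close>. Hence \<open>\<Psi>\<close> is nonnegative near 0 and vanishes
    at 0, which forces its derivative to be 0.\<close>
  define R where "R s = (\<Sum>i\<in>UNIV. a i * (dd (u i, 0) N (c s) \<bullet> (2 *\<^sub>R w i s - D (u i) (c s))))" for s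
  define Q where "Q s = (\<Sum>i\<in>UNIV. \<bar>a i\<bar> * (C / k\<^sup>2) * (g i s \<bullet> g i s))" for s
  define \<Psi> where "\<Psi> s = \<epsilon> * R s + Q s - \<epsilon> * G (c s)" for s
  define r1 where "r1 = (\<Sum>i\<in>UNIV. a i * (dd \<tau> (dd (u i, 0) N) z0 \<bullet> e i - \<kappa> i * (e i \<bullet> Yu i)))"
  have dR: "(R has_real_derivative r1) (at 0)"
  proof -
    have "((\<lambda>s. dd (u i, 0) N (c s) \<bullet> (2 *\<^sub>R w i s - D (u i) (c s))) has_real_derivative
       dd \<tau> (dd (u i, 0) N) z0 \<bullet> e i - \<kappa> i * (e i \<bullet> Yu i)) (at 0)" for i
    proof -
      have "((\<lambda>s. dd (u i, 0) N (c s) \<bullet> (2 *\<^sub>R w i s - D (u i) (c s))) has_vector_derivative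
        dd (u i, 0) N (c 0) \<bullet> (2 *\<^sub>R (- (e i \<bullet> N1) *\<^sub>R N0) - Yu i) + dd \<tau> (dd (u i, 0) N) z0 \<bullet> (2 *\<^sub>R w i 0 - D (u i) (c 0))) (at 0)"
        by (intro bounded_bilinear.has_vector_derivative[OF bounded_bilinear_inner] has_vector_derivative_diff
            bounded_linear.has_vector_derivative[OF bounded_linear_scaleR_right] dw dY chain diffN z0)
      moreover have "dd (u i, 0) N (c 0) \<bullet> (2 *\<^sub>R (- (e i \<bullet> N1) *\<^sub>R N0) - Yu i) = - \<kappa> i * (e i \<bullet> Yu i)"
        by (simp add: c0 Nu0 inner_diff_right eN)
      moreover have "2 *\<^sub>R w i 0 - D (u i) (c 0) = e i" by (simp add: w0 c0 e_def[symmetric] scaleR_2)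
      ultimately show ?thesis by (simp add: has_real_derivative_iff_has_vector_derivative)
    qed
    then show ?thesis unfolding R_def r1_def by (intro DERIV_sum DERIV_cmult)
  qed
  have dQ: "(Q has_real_derivative 0) (at 0)"
  proof -
    have "((\<lambda>s. g i s \<bullet> g i s) has_real_derivative 0) (at 0)" for i
      using bounded_bilinear.has_vector_derivative[OF bounded_bilinear_inner dg[of i] dg[of i]]
      by (simp add: g0 has_real_derivative_iff_has_vector_derivative)
    then have "(Q has_real_derivative (\<Sum>i\<in>UNIV. \<bar>a i\<bar> * (C / k\<^sup>2) * 0)) (at 0)"
      unfolding Q_def by (intro DERIV_sum DERIV_cmult)
    then show ?thesis by simp
  qed
  have dG: "((\<lambda>s. G (c s)) has_real_derivative dd \<tau> G z0) (at 0)"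
    unfolding has_real_derivative_iff_has_vector_derivative by (rule chain[OF diffG(1)[OF z0]])
  have d\<Psi>: "(\<Psi> has_real_derivative \<epsilon> * r1 + 0 - \<epsilon> * dd \<tau> G z0) (at 0)"
    unfolding \<Psi>_def by (intro DERIV_diff DERIV_add DERIV_cmult dR dQ dG)
  have \<Psi>0: "\<Psi> 0 = 0"
  proof -
    have "2 *\<^sub>R w i 0 - D (u i) (c 0) = e i" for i by (simp add: w0 c0 e_def[symmetric] scaleR_2)
    then have "R 0 = (\<Sum>i\<in>UNIV. a i * \<kappa> i)" unfolding R_def by (simp add: c0 Nu0 ee)
    then show ?thesis by (simp add: \<Psi>_def Q_def g0 c0 G0)
  qed
  have pos: "0 \<le> \<Psi> s" if s: "c s \<in> ball z0 r" "1 + N0 \<bullet> N (c s) \<noteq> 0" for s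
  proof -
    have sW: "c s \<in> W" using s B by blast
    have wN: "w i s \<bullet> N (c s) = 0" "w i s \<bullet> w j s = (if i = j then 1 else 0)" for i j
      using rotated_frame[OF N00 unit[OF sW] s(2) ee eN] by (simp_all add: w_def x_def)
    have "\<exists>v. D v (c s) = w i s" for i by (rule tangent_range[OF sW wN(1)])
    then obtain v where v: "\<And>i. D (v i) (c s) = w i s" by metis
    have le: "\<epsilon> * G (c s) \<le> \<epsilon> * (\<Sum>i\<in>UNIV. a i * h (v i) (v i) (c s))"
      by (rule J[OF sW]) (simp add: v wN)
    have hd: "\<bar>h \<delta> \<delta> (c s)\<bar> \<le> C / k\<^sup>2 * (D \<delta> (c s) \<bullet> D \<delta> (c s))" for \<delta>
    proof -
      have "\<bar>h \<delta> \<delta> (c s)\<bar> \<le> norm (HH \<delta> \<delta> (c s)) * norm (N (c s))"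
        unfolding h_def by (simp add: Cauchy_Schwarz_ineq2)
      also have "norm (N (c s)) = 1" using unit[OF sW] by (simp add: norm_eq_1)
      also have "norm (HH \<delta> \<delta> (c s)) * 1 \<le> C * (norm \<delta>)\<^sup>2"
        using B(6)[OF s(1), of \<delta> \<delta>] by (simp add: power2_eq_square mult.assoc)
      also have "\<dots> \<le> C * (norm (D \<delta> (c s)) / k)\<^sup>2"
        using B(5)[OF s(1), of \<delta>] B(2,3) by (intro mult_left_mono power_mono) (auto simp: field_simps)
      also have "\<dots> = C / k\<^sup>2 * (D \<delta> (c s) \<bullet> D \<delta> (c s))" by (simp add: power_divide power2_norm_eq_inner)
      finally show ?thesis .
    qed
    have "\<epsilon> * (a i * h (v i) (v i) (c s)) \<le> \<epsilon> * (a i * (dd (u i, 0) N (c s) \<bullet> (2 *\<^sub>R w i s - D (u i) (c s))))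
      + \<bar>a i\<bar> * (C / k\<^sup>2) * (g i s \<bullet> g i s)" for i
    proof -
      have Dg: "D (v i - u i) (c s) = g i s" by (simp add: linear_diff[OF linear_D[OF sW]] v g_def)
      have "\<epsilon> * (a i * h (v i - u i) (v i - u i) (c s)) \<le> \<bar>\<epsilon> * (a i * h (v i - u i) (v i - u i) (c s))\<bar>" by simp
      also have "\<dots> = \<bar>a i\<bar> * \<bar>h (v i - u i) (v i - u i) (c s)\<bar>" using \<epsilon> by (auto simp: abs_mult)
      also have "\<dots> \<le> \<bar>a i\<bar> * (C / k\<^sup>2 * (g i s \<bullet> g i s))" using hd[of "v i - u i"] unfolding Dg by (intro mult_left_mono) auto
      finally have "\<epsilon> * (a i * h (v i - u i) (v i - u i) (c s)) \<le> \<bar>a i\<bar> * (C / k\<^sup>2) * (g i s \<bullet> g i s)" by (simp only: mult.assoc)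
      moreover have "h (v i) (v i) (c s) = dd (u i, 0) N (c s) \<bullet> (2 *\<^sub>R w i s - D (u i) (c s)) + h (v i - u i) (v i - u i) (c s)"
        using h_shift[OF sW, of "v i" "u i"] unfolding v .
      ultimately show ?thesis by (simp only: distrib_left add_left_mono)
    qed
    then have "(\<Sum>i\<in>UNIV. \<epsilon> * (a i * h (v i) (v i) (c s))) \<le> (\<Sum>i\<in>UNIV. \<epsilon> * (a i * (dd (u i, 0) N (c s) \<bullet> (2 *\<^sub>R w i s - D (u i) (c s))))
      + \<bar>a i\<bar> * (C / k\<^sup>2) * (g i s \<bullet> g i s))" by (intro sum_mono)
    then have "\<epsilon> * (\<Sum>i\<in>UNIV. a i * h (v i) (v i) (c s)) \<le> \<epsilon> * R s + Q s"
      by (simp only: sum.distrib sum_distrib_left[symmetric] R_def Q_def)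
    then show ?thesis using le by (simp add: \<Psi>_def)
  qed
  have "((\<lambda>s. 1 + N0 \<bullet> N (c s)) \<longlongrightarrow> 1 + N0 \<bullet> N0) (nhds 0)"
  proof -
    have "isCont (\<lambda>s. N (c s)) 0" using dN has_vector_derivative_continuous by blast
    then have "((\<lambda>s. N (c s)) \<longlongrightarrow> N (c 0)) (nhds 0)"
      using tendsto_at_iff_tendsto_nhds[of "\<lambda>s. N (c s)" 0] by (simp add: isCont_def)
    then have "((\<lambda>s. N (c s)) \<longlongrightarrow> N0) (nhds 0)" by (simp add: c0 N0_def)
    then show ?thesis by (intro tendsto_intros)
  qed
  then have "\<forall>\<^sub>F s in nhds 0. 1 + N0 \<bullet> N (c s) \<noteq> 0"
    by (rule tendsto_imp_eventually_ne) (simp add: N00)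
  moreover have "\<forall>\<^sub>F s in nhds 0. c s \<in> ball z0 r"
    by (rule topological_tendstoD[OF ctend]) (use B in auto)
  ultimately have "\<forall>\<^sub>F s in nhds 0. 0 \<le> \<Psi> s" by eventually_elim (rule pos)
  then obtain d where d: "d > 0" "\<And>s. \<bar>s\<bar> < d \<Longrightarrow> 0 \<le> \<Psi> s"
    unfolding eventually_nhds_metric by (auto simp: dist_real_def)
  have "\<epsilon> * r1 + 0 - \<epsilon> * dd \<tau> G z0 = 0"
    by (rule DERIV_local_min[OF d\<Psi> d(1)]) (use d(2) \<Psi>0 in auto)
  then have "r1 = dd \<tau> G z0" using \<epsilon> by auto
  then show ?thesis by (simp add: r1_def e_def Yu_def)
qed

text \<open>The evolution equations of normal and speed. The vector \<open>b i\<close> bends the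
  parameter line so that the curve on the hypersurface has the purely normal acceleration
  \<open>- \<kappa> i *\<^sub>R N z0\<close>; second derivatives along it are covariant Hessians at
  \<open>z0\<close>. Both claims come from \<open>speed_derivative\<close>, in the directions
  \<open>(v, 0)\<close> and \<open>(0, 1)\<close>.\<close>

lemma evolution:
  fixes u :: "'n::finite \<Rightarrow> 'p"
  assumes z0: "z0 \<in> W" and orth: "\<And>i j. D (u i) z0 \<bullet> D (u j) z0 = (if i = j then 1 else 0)"
    and eig: "\<And>i v. h (u i) v z0 = \<kappa> i * (D (u i) z0 \<bullet> D v z0)"
    and G0: "(\<Sum>i\<in>UNIV. a i * \<kappa> i) = G z0" and \<epsilon>: "\<epsilon> = 1 \<or> \<epsilon> = (-1::real)"
    and J: "\<And>z (w :: 'n \<Rightarrow> 'p). z \<in> W \<Longrightarrow> (\<And>i j. D (w i) z \<bullet> D (w j) z = (if i = j then 1 else 0)) \<Longrightarrow>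
       \<epsilon> * G z \<le> \<epsilon> * (\<Sum>i\<in>UNIV. a i * h (w i) (w i) z)"
    and b: "\<And>i. HH (u i) (u i) z0 + D (b i) z0 = - \<kappa> i *\<^sub>R N z0"
  shows "(\<Sum>i\<in>UNIV. a i *\<^sub>R (dd (u i, 0) (dd (u i, 0) N) z0 + dd (b i, 0) N z0))
      = dd (0, 1) N z0 - (\<Sum>i\<in>UNIV. a i * (\<kappa> i)\<^sup>2) *\<^sub>R N z0"
    and "dd (0, 1) G z0 = (\<Sum>i\<in>UNIV. a i * (dd (u i, 0) (dd (u i, 0) G) z0 + dd (b i, 0) G z0 + G z0 * (\<kappa> i)\<^sup>2))"
proof -
  have sd: "dd \<tau> G z0 = (\<Sum>i\<in>UNIV. a i * (dd \<tau> (dd (u i, 0) N) z0 \<bullet> D (u i) z0 - \<kappa> i * (D (u i) z0 \<bullet> dd \<tau> (D (u i)) z0)))" for \<tau>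
    by (rule speed_derivative[OF z0 orth eig G0 \<epsilon>]) (rule J)
  have Nu: "dd (u i, 0) N z0 = \<kappa> i *\<^sub>R D (u i) z0" for i by (rule normal_derivative_eigen[OF z0 eig])
  have YUU: "HH (u i) (u i) z0 = - \<kappa> i *\<^sub>R N z0 - D (b i) z0" for i
    using b[of i] by (simp add: eq_diff_eq)
  have sym: "dd (x, 0) N z \<bullet> D y z = dd (y, 0) N z \<bullet> D x z" if "z \<in> W" for x y z
    using weingarten[OF that] h_commute[OF that] by metis
  define m where "m i = dd (u i, 0) (dd (u i, 0) N) z0 + dd (b i, 0) N z0" for i
  \<comment> \<open>The Codazzi equation in disguise: differentiating the symmetry of the second
    fundamental form in direction \<open>u i\<close> identifies each summand of \<open>sd\<close>
    with a tangential component of \<open>m i\<close>.\<close>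
  have mD: "m i \<bullet> D v z0 = dd (v, 0) (dd (u i, 0) N) z0 \<bullet> D (u i) z0 - \<kappa> i * (D (u i) z0 \<bullet> dd (v, 0) (D (u i)) z0)" for i v
  proof -
    have "dd (u i, 0) (\<lambda>z. dd (u i, 0) N z \<bullet> D v z) z0 = dd (u i, 0) (\<lambda>z. dd (v, 0) N z \<bullet> D (u i) z) z0"
      by (rule dd_cong_open[OF open_W z0 sym])
    then have "dd (u i, 0) N z0 \<bullet> HH (u i) v z0 + dd (u i, 0) (dd (u i, 0) N) z0 \<bullet> D v z0
       = dd (v, 0) N z0 \<bullet> HH (u i) (u i) z0 + dd (u i, 0) (dd (v, 0) N) z0 \<bullet> D (u i) z0"
      by (simp add: dd_inner diffN diff z0)
    moreover have "dd (u i, 0) (dd (v, 0) N) z0 = dd (v, 0) (dd (u i, 0) N) z0"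
      by (rule dd_commute[OF open_W C2N z0])
    moreover have "dd (v, 0) N z0 \<bullet> HH (u i) (u i) z0 = - (dd (b i, 0) N z0 \<bullet> D v z0)"
      using sym[OF z0, of v "b i"] N_dd[OF z0, of "(v, 0)"]
      unfolding YUU by (simp add: inner_diff_right inner_commute)
    moreover have "HH (u i) v z0 = dd (v, 0) (D (u i)) z0" by (rule HH_commute[OF z0])
    ultimately show ?thesis by (simp add: m_def inner_add_left Nu)
  qed
  \<comment> \<open>The second derivative of the constant \<open>N z \<bullet> N z\<close> in
    direction \<open>u i\<close>.\<close>
  have mN: "m i \<bullet> N z0 = - (\<kappa> i)\<^sup>2" for i
  proof -
    have "dd (u i, 0) (\<lambda>z. N z \<bullet> dd (u i, 0) N z) z0 = dd (u i, 0) (\<lambda>z. 0) z0"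
      by (rule dd_cong_open[OF open_W z0 N_dd])
    then have "N z0 \<bullet> dd (u i, 0) (dd (u i, 0) N) z0 + dd (u i, 0) N z0 \<bullet> dd (u i, 0) N z0 = 0"
      by (simp add: dd_inner diffN z0 dd_const)
    moreover have "dd (u i, 0) N z0 \<bullet> dd (u i, 0) N z0 = (\<kappa> i)\<^sup>2"
      by (simp add: Nu orth power2_eq_square)
    ultimately show ?thesis using N_dd[OF z0, of "(b i, 0)"]
      by (simp add: m_def inner_add_right inner_commute[of _ "N z0"])
  qed
  have "(\<Sum>i\<in>UNIV. a i *\<^sub>R m i) = dd (0, 1) N z0 - (\<Sum>i\<in>UNIV. a i * (\<kappa> i)\<^sup>2) *\<^sub>R N z0"
  proof (rule vector_eqI[OF z0])
    show "(\<Sum>i\<in>UNIV. a i *\<^sub>R m i) \<bullet> N z0 = (dd (0, 1) N z0 - (\<Sum>i\<in>UNIV. a i * (\<kappa> i)\<^sup>2) *\<^sub>R N z0) \<bullet> N z0"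
    proof -
      have "dd (0, 1) N z0 \<bullet> N z0 = 0" using N_dd[OF z0, of "(0, 1)"] by (simp only: inner_commute)
      then show ?thesis by (simp add: inner_sum_left mN inner_diff_left unit[OF z0] sum_negf)
    qed
    show "(\<Sum>i\<in>UNIV. a i *\<^sub>R m i) \<bullet> D v z0 = (dd (0, 1) N z0 - (\<Sum>i\<in>UNIV. a i * (\<kappa> i)\<^sup>2) *\<^sub>R N z0) \<bullet> D v z0" for v
    proof -
      have "N z0 \<bullet> D v z0 = 0" using tangent[OF z0, of v] by (simp only: inner_commute)
      then have "(dd (0, 1) N z0 - (\<Sum>i\<in>UNIV. a i * (\<kappa> i)\<^sup>2) *\<^sub>R N z0) \<bullet> D v z0 = dd (v, 0) G z0"
        by (simp add: inner_diff_left time_normal[OF z0])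
      also have "\<dots> = (\<Sum>i\<in>UNIV. a i * (m i \<bullet> D v z0))" unfolding mD by (rule sd)
      finally show ?thesis by (simp add: inner_sum_left)
    qed
  qed
  then show "(\<Sum>i\<in>UNIV. a i *\<^sub>R (dd (u i, 0) (dd (u i, 0) N) z0 + dd (b i, 0) N z0))
      = dd (0, 1) N z0 - (\<Sum>i\<in>UNIV. a i * (\<kappa> i)\<^sup>2) *\<^sub>R N z0"
    by (simp add: m_def)
  \<comment> \<open>Time and space derivatives are exchanged and \<open>time_normal\<close> is
    differentiated in space. The term \<open>G z0 * (\<kappa> i)\<^sup>2\<close> stems from the
    change of the metric, computed by \<open>dd_time_D\<close>.\<close>
  have "dd (0, 1) (dd (u i, 0) N) z0 \<bullet> D (u i) z0 - \<kappa> i * (D (u i) z0 \<bullet> dd (0, 1) (D (u i)) z0)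
     = dd (u i, 0) (dd (u i, 0) G) z0 + dd (b i, 0) G z0 + G z0 * (\<kappa> i)\<^sup>2" for i
  proof -
    have "dd (u i, 0) (\<lambda>z. dd (0, 1) N z \<bullet> D (u i) z) z0 = dd (u i, 0) (dd (u i, 0) G) z0"
      by (rule dd_cong_open[OF open_W z0 time_normal])
    then have "dd (0, 1) N z0 \<bullet> HH (u i) (u i) z0 + dd (u i, 0) (dd (0, 1) N) z0 \<bullet> D (u i) z0 = dd (u i, 0) (dd (u i, 0) G) z0"
      by (simp add: dd_inner diffN diff z0)
    moreover have "dd (u i, 0) (dd (0, 1) N) z0 = dd (0, 1) (dd (u i, 0) N) z0"
      by (rule dd_commute[OF open_W C2N z0])
    moreover have "dd (0, 1) N z0 \<bullet> HH (u i) (u i) z0 = - dd (b i, 0) G z0"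
      using time_normal[OF z0, of "b i"] N_dd[OF z0, of "(0, 1)"]
      unfolding YUU by (simp add: inner_diff_right inner_commute)
    moreover have "D (u i) z0 \<bullet> dd (0, 1) (D (u i)) z0 = - G z0 * \<kappa> i"
      using tangent[OF z0, of "u i"] unfolding dd_time_D[OF z0] Nu by (simp add: inner_add_right inner_diff_right orth)
    ultimately show ?thesis by (simp add: power2_eq_square)
  qed
  then show "dd (0, 1) G z0 = (\<Sum>i\<in>UNIV. a i * (dd (u i, 0) (dd (u i, 0) G) z0 + dd (b i, 0) G z0 + G z0 * (\<kappa> i)\<^sup>2))"
    by (intro trans[OF sd[of "(0, 1)"]] sum.cong refl) (rule arg_cong)
qed

end

section \<open>The two-point maximum principle\<close>

text \<open>The function W of the overview with speed, endpoints and normal as independent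
  arguments, so that curves can be inserted into each of them.\<close>

definition chord_fun :: "real \<Rightarrow> real \<Rightarrow> 'e::real_inner \<Rightarrow> 'e \<Rightarrow> 'e \<Rightarrow> real" where
  "chord_fun K g x y n = K / 2 * (g * ((y - x) \<bullet> (y - x))) + (y - x) \<bullet> n"

lemma jet2_chord_fun:
  assumes g: "jet2 g g1 g2" and x: "jet2 x x1 x2" and y: "jet2 y y1 y2" and n: "jet2 n n1 n2"
    and d: "d = y 0 - x 0" and g0: "g 0 = G" and n0: "n 0 = \<nu>"
  shows "jet2 (\<lambda>s. chord_fun K (g s) (x s) (y s) (n s))
    (K / 2 * (g1 * (norm d)\<^sup>2 + 2 * G * (d \<bullet> (y1 - x1))) + (y1 - x1) \<bullet> \<nu> + d \<bullet> n1)
    (K / 2 * (g2 * (norm d)\<^sup>2 + 4 * g1 * (d \<bullet> (y1 - x1)) + G * (2 * ((y1 - x1) \<bullet> (y1 - x1)) + 2 * (d \<bullet> (y2 - x2))))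
      + (y2 - x2) \<bullet> \<nu> + 2 * ((y1 - x1) \<bullet> n1) + d \<bullet> n2)"
proof -
  note D = jet2_diff[OF y x]
  note A = jet2_add[OF jet2_mult[OF jet2_const[of "K / 2"] jet2_mult[OF g jet2_inner[OF D D]]] jet2_inner[OF D n]]
  show ?thesis
    unfolding chord_fun_def
    using A by (simp add: d[symmetric] g0 n0 power2_norm_eq_inner inner_commute[of "y1 - x1" d]
        inner_commute[of "y2 - x2" d] algebra_simps del: inner_diff_left inner_diff_right)
qed

text \<open>One-sided, because nonnegativity is known only before the first touching time.\<close>

lemma left_derivative_nonpos:
  fixes f :: "real \<Rightarrow> real"
  assumes d: "(f has_real_derivative l) (at t)" and f0: "f t = 0" and pos: "\<forall>\<^sub>F s in at_left t. 0 \<le> f s"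
  shows "l \<le> 0"
proof -
  have "((\<lambda>s. (f s - f t) / (s - t)) \<longlongrightarrow> l) (at t)" using d by (simp add: has_field_derivative_iff)
  then have "((\<lambda>s. (f s - f t) / (s - t)) \<longlongrightarrow> l) (at_left t)"
    by (rule filterlim_mono) (auto simp: at_le)
  then show ?thesis
  proof (rule tendsto_upperbound)
    have "\<forall>\<^sub>F s in at_left t. s < t" by (simp add: eventually_at_filter)
    with pos show "\<forall>\<^sub>F s in at_left t. (f s - f t) / (s - t) \<le> 0"
      by eventually_elim (simp add: f0 divide_nonneg_neg)
  qed simp
qed

locale two_patches = P: flow_patch W Y N G + Q: flow_patch W' Y' N' G'
  for W Y N G W' Y' N' G' :: "_" +
  constrains W :: "('p::euclidean_space \<times> real) set" and Y :: "'p \<times> real \<Rightarrow> 'e::euclidean_space"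
    and N :: "'p \<times> real \<Rightarrow> 'e" and G :: "'p \<times> real \<Rightarrow> real"
    and W' :: "('p \<times> real) set" and Y' :: "'p \<times> real \<Rightarrow> 'e"
    and N' :: "'p \<times> real \<Rightarrow> 'e" and G' :: "'p \<times> real \<Rightarrow> real"
begin

text \<open>Derives the hypotheses of \<open>touching_impossible\<close> from a first touching pair
  given in two patches. Varying y alone yields the relation between the normals, varying x alone the
  gradient of the speed, varying both the second-order inequality. Assumption \<open>side\<close>
  decides the sign of \<open>\<rho>\<close>, and \<open>small\<close> keeps \<open>\<rho>\<close>
  away from 0.\<close>

lemma no_touching:
  fixes u :: "'n::finite \<Rightarrow> 'p"
  assumes z0: "(p, t) \<in> W" and z0': "(q, t) \<in> W'"
    and card: "CARD('n) = DIM('p)"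
    and orth: "\<And>i j. P.D (u i) (p, t) \<bullet> P.D (u j) (p, t) = (if i = j then 1 else 0)"
    and eig: "\<And>i v. P.h (u i) v (p, t) = \<kappa> i * (P.D (u i) (p, t) \<bullet> P.D v (p, t))"
    and a: "\<And>i. 0 \<le> a i" and G0: "(\<Sum>i\<in>UNIV. a i * \<kappa> i) = G (p, t)" and \<epsilon>: "\<epsilon> = 1 \<or> \<epsilon> = (-1::real)"
    and J: "\<And>z (w :: 'n \<Rightarrow> 'p). z \<in> W \<Longrightarrow> (\<And>i j. P.D (w i) z \<bullet> P.D (w j) z = (if i = j then 1 else 0)) \<Longrightarrow>
       \<epsilon> * G z \<le> \<epsilon> * (\<Sum>i\<in>UNIV. a i * P.h (w i) (w i) z)"
    and J': "\<And>z (w :: 'n \<Rightarrow> 'p). z \<in> W' \<Longrightarrow> (\<And>i j. Q.D (w i) z \<bullet> Q.D (w j) z = (if i = j then 1 else 0)) \<Longrightarrow>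
       \<epsilon> * G' z \<le> \<epsilon> * (\<Sum>i\<in>UNIV. a i * Q.h (w i) (w i) z)"
    and touch: "chord_fun K (G (p, t)) (Y (p, t)) (Y' (q, t)) (N (p, t)) = - \<epsilon> * \<theta> t"
    and \<theta>: "0 < \<theta> t" "(\<theta> has_real_derivative L * \<theta> t) (at t)"
    and min: "\<And>p' q'. (p', t) \<in> W \<Longrightarrow> (q', t) \<in> W' \<Longrightarrow>
       - \<theta> t \<le> \<epsilon> * chord_fun K (G (p', t)) (Y (p', t)) (Y' (q', t)) (N (p', t))"
    and before: "\<forall>\<^sub>F s in at_left t. - \<theta> s \<le> \<epsilon> * chord_fun K (G (p, s)) (Y (p, s)) (Y' (q, s)) (N (p, s))"
    and side: "2 * \<bar>K * G (p, t)\<bar> * \<theta> t < norm ((K * G (p, t)) *\<^sub>R (Y' (q, t) - Y (p, t)) + N (p, t) + N' (q, t))"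
    and small: "2 * \<bar>K * G (p, t)\<bar> * \<theta> t \<le> 3 / 4"
    and C: "\<theta> t \<le> C * (norm (Y' (q, t) - Y (p, t)))\<^sup>2" "12 * C * \<theta> t \<le> 1" "0 \<le> C"
    and L: "(\<Sum>i\<in>UNIV. a i * (\<kappa> i)\<^sup>2) + 64 * C * (\<Sum>i\<in>UNIV. a i * \<bar>K * G (p, t) - \<kappa> i\<bar>) < L"
  shows False
proof -
  define z where "z = (p, t)"
  define z' where "z' = (q, t)"
  define k where "k = K * G z"
  define d where "d = Y' z' - Y z"
  define \<nu> where "\<nu> = N z"
  define \<nu>' where "\<nu>' = N' z'"
  define th where "th = \<theta> t"
  define D where "D = (norm d)\<^sup>2"
  have zW: "z \<in> W" "z' \<in> W'" using z0 z0' by (simp_all add: z_def z'_def)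
  have nn: "\<nu> \<bullet> \<nu> = 1" "\<nu>' \<bullet> \<nu>' = 1" using P.unit[OF zW(1)] Q.unit[OF zW(2)] by (simp_all add: \<nu>_def \<nu>'_def)
  have Weq: "k / 2 * (norm d)\<^sup>2 + d \<bullet> \<nu> = - \<epsilon> * th"
    using touch unfolding chord_fun_def by (simp add: k_def d_def \<nu>_def th_def z_def z'_def power2_norm_eq_inner)
  have test: "F1 = 0 \<and> 0 \<le> \<epsilon> * F2"
    if jet: "jet2 (\<lambda>s. chord_fun K (G (c s, t)) (Y (c s, t)) (Y' (c' s, t)) (N (c s, t))) F1 F2"
      and c: "isCont c 0" "c 0 = p" and c': "isCont c' 0" "c' 0 = q" for c c' F1 F2
  proof -
    have j: "jet2 (\<lambda>s. \<epsilon> * chord_fun K (G (c s, t)) (Y (c s, t)) (Y' (c' s, t)) (N (c s, t))) (\<epsilon> * F1) (\<epsilon> * F2)"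
      using jet2_mult[OF jet2_const[of \<epsilon>] jet] by simp
    have "((\<lambda>s. (c s, t)) \<longlongrightarrow> (p, t)) (nhds 0)" "((\<lambda>s. (c' s, t)) \<longlongrightarrow> (q, t)) (nhds 0)"
      using c c' tendsto_at_iff_tendsto_nhds[of c 0] tendsto_at_iff_tendsto_nhds[of c' 0]
      by (auto simp: isCont_def intro!: tendsto_Pair)
    then have "\<forall>\<^sub>F s in nhds 0. (c s, t) \<in> W" "\<forall>\<^sub>F s in nhds 0. (c' s, t) \<in> W'"
      using topological_tendstoD[OF _ P.open_W z0] topological_tendstoD[OF _ Q.open_W z0'] by blast+
    then have "\<forall>\<^sub>F s in nhds 0. \<epsilon> * chord_fun K (G (c 0, t)) (Y (c 0, t)) (Y' (c' 0, t)) (N (c 0, t))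
       \<le> \<epsilon> * chord_fun K (G (c s, t)) (Y (c s, t)) (Y' (c' s, t)) (N (c s, t))"
    proof eventually_elim
      case (elim s)
      have "\<epsilon> * chord_fun K (G (c 0, t)) (Y (c 0, t)) (Y' (c' 0, t)) (N (c 0, t)) = - \<theta> t"
        using touch \<epsilon> by (auto simp: c c')
      then show ?case using min[OF elim] by simp
    qed
    from jet2_min[OF j this] show ?thesis using \<epsilon> by auto
  qed
  have curve: "jet2 (\<lambda>s. \<Phi> (x + s *\<^sub>R v + (s\<^sup>2 / 2) *\<^sub>R b, t)) (dd (v, 0) \<Phi> (x, t)) (dd (v, 0) (dd (v, 0) \<Phi>) (x, t) + dd (b, 0) \<Phi> (x, t))"
    if "open V" "(x, t) \<in> V" "Ck_on 2 V \<Phi>" for V x v b and \<Phi> :: "'p \<times> real \<Rightarrow> 'q::real_normed_vector"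
    using jet2_compose[OF that, of "(v, 0)" "(b, 0)"] by simp
  have cont: "isCont (\<lambda>s. x + s *\<^sub>R v + (s\<^sup>2 / 2) *\<^sub>R b) (0::real)" for x v b :: 'p
    by (intro continuous_intros) auto

  \<comment> \<open>Only y moves: the gradient of W in y is \<open>k *\<^sub>R d + \<nu>\<close>, so
    this vector is normal to the hypersurface at y.\<close>
  have normal: "(k *\<^sub>R d + \<nu>) \<bullet> Q.D v z' = 0" for v
  proof -
    have A: "d = Y' (q + 0 *\<^sub>R v + (0\<^sup>2 / 2) *\<^sub>R 0, t) - Y (p, t)" "G (p, t) = G z" "N (p, t) = \<nu>"
      by (simp_all add: d_def z_def z'_def \<nu>_def)
    note j = jet2_chord_fun[OF jet2_const jet2_const curve[OF Q.open_W z0' Q.smooth[of 2], of v 0] jet2_const A, of K]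
    have "K / 2 * (0 * (norm d)\<^sup>2 + 2 * G z * (d \<bullet> (Q.D v (q, t) - 0))) + (Q.D v (q, t) - 0) \<bullet> \<nu> + d \<bullet> 0 = 0"
      by (rule conjunct1[OF test[where c="\<lambda>s. p" and c'="\<lambda>s. q + s *\<^sub>R v + (s\<^sup>2 / 2) *\<^sub>R 0", OF j _ _ cont]]) simp_all
    then show ?thesis by (simp add: inner_add_left k_def z'_def inner_commute)
  qed
  define \<rho> where "\<rho> = (k *\<^sub>R d + \<nu>) \<bullet> \<nu>'"
  have n: "k *\<^sub>R d + \<nu> = \<rho> *\<^sub>R \<nu>'"
  proof (rule Q.vector_eqI[OF zW(2)])
    show "(k *\<^sub>R d + \<nu>) \<bullet> N' z' = (\<rho> *\<^sub>R \<nu>') \<bullet> N' z'" using nn by (simp add: \<rho>_def \<nu>'_def)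
    show "(k *\<^sub>R d + \<nu>) \<bullet> Q.D v z' = (\<rho> *\<^sub>R \<nu>') \<bullet> Q.D v z'" for v
      unfolding normal using Q.tangent[OF zW(2), of v] by (simp add: \<nu>'_def inner_commute)
  qed
  have \<rho>2: "\<rho>\<^sup>2 = 1 + 2 * k * (- \<epsilon> * th)"
  proof -
    have "\<rho>\<^sup>2 = (\<rho> *\<^sub>R \<nu>') \<bullet> (\<rho> *\<^sub>R \<nu>')" by (simp add: nn power2_eq_square)
    also have "\<dots> = k\<^sup>2 * (norm d)\<^sup>2 + 2 * k * (d \<bullet> \<nu>) + 1"
      unfolding n[symmetric] power2_norm_eq_inner
      by (simp add: inner_add_left inner_add_right nn inner_commute[of \<nu> d] power2_eq_square algebra_simps)
    also have "\<dots> = 1 + 2 * k * (k / 2 * (norm d)\<^sup>2 + d \<bullet> \<nu>)" by (simp add: algebra_simps power2_eq_square)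
    finally show ?thesis unfolding Weq .
  qed
  have th: "0 < th" using \<theta> by (simp add: th_def)
  have kth: "\<bar>2 * k * (- \<epsilon> * th)\<bar> = 2 * \<bar>k\<bar> * th" using \<epsilon> th by (auto simp: abs_mult)
  \<comment> \<open>If \<rho> <= 0 then |1 - \<rho>| >= 1, so |1 + \<rho>| <= |\<rho>^2 - 1| = 2 |k|
    \<theta>: the normals would be almost opposite in the sense excluded by
    \<open>side\<close>.\<close>
  have \<rho>pos: "0 < \<rho>"
  proof (rule ccontr)
    assume "\<not> 0 < \<rho>"
    then have neg: "\<rho> \<le> 0" by simp
    have "norm (k *\<^sub>R d + \<nu> + \<nu>') = \<bar>1 + \<rho>\<bar>"
    proof -
      have "k *\<^sub>R d + \<nu> + \<nu>' = (1 + \<rho>) *\<^sub>R \<nu>'" unfolding n by (simp add: algebra_simps)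
      moreover have "norm \<nu>' = 1" using nn by (simp add: norm_eq_1)
      ultimately show ?thesis by simp
    qed
    also have "\<bar>1 + \<rho>\<bar> \<le> \<bar>1 + \<rho>\<bar> * \<bar>1 - \<rho>\<bar>" using neg mult_left_mono[of 1 "\<bar>1 - \<rho>\<bar>" "\<bar>1 + \<rho>\<bar>"] by simp
    also have "\<dots> = \<bar>\<rho>\<^sup>2 - 1\<bar>" by (simp add: abs_mult[symmetric] power2_eq_square algebra_simps abs_minus_commute)
    also have "\<dots> = 2 * \<bar>k\<bar> * th" unfolding \<rho>2 using kth by simp
    finally show False using side by (simp add: k_def d_def \<nu>_def \<nu>'_def th_def z_def z'_def)
  qed
  \<comment> \<open>By \<open>small\<close>, \<rho>^2 is at least 1 - 3/4.\<close>
  have \<rho>half: "1 / 2 \<le> \<rho>"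
  proof -
    have "(1/2)\<^sup>2 \<le> \<rho>\<^sup>2" using kth small unfolding \<rho>2 k_def th_def z_def by (simp add: power2_eq_square)
    then show ?thesis using \<rho>pos power2_le_imp_le[of "1/2" \<rho>] by simp
  qed
  define \<tau> where "\<tau> = 2 * (- \<epsilon> * th) / (1 + \<rho>)"
  have C': "th \<le> C * D" "12 * C * th \<le> 1" using C by (simp_all add: th_def D_def d_def z_def z'_def)
  have Dpos: "0 < D"
  proof -
    have "0 < C * D" using C' th by linarith
    then show ?thesis using C(3) by (simp add: zero_less_mult_iff)
  qed
  have \<tau>D: "\<tau>\<^sup>2 < (norm d)\<^sup>2"
  proof -
    have "\<bar>\<tau>\<bar> = 2 * th / (1 + \<rho>)" using \<epsilon> th \<rho>pos unfolding \<tau>_def by (auto simp: abs_mult)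
    also have "\<dots> \<le> 2 * th" using th \<rho>pos by (simp add: field_simps)
    finally have "\<bar>\<tau>\<bar>\<^sup>2 \<le> (2 * th)\<^sup>2" by (intro power_mono) auto
    then have "\<tau>\<^sup>2 \<le> 4 * th * th" by (simp add: power2_eq_square)
    also have "\<dots> \<le> 4 * th * (C * D)" using C' th by (intro mult_left_mono) auto
    also have "\<dots> = (12 * C * th) * (D / 3)" by simp
    also have "\<dots> \<le> 1 * (D / 3)" using C' Dpos by (intro mult_right_mono) auto
    also have "\<dots> < D" using Dpos by simp
    finally show ?thesis by (simp add: D_def)
  qed
  define e where "e i = P.D (u i) z" for i
  have ee: "e i \<bullet> e j = (if i = j then 1 else 0)" "e i \<bullet> \<nu> = 0" for i j
    using orth P.tangent[OF zW(1)] by (simp_all add: e_def z_def \<nu>_def)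
  have norms: "norm \<nu> = 1" "norm \<nu>' = 1" using nn by (simp_all add: norm_eq_1)
  obtain e' :: "'n \<Rightarrow> 'e" where e': "\<And>i j. e' i \<bullet> e' j = (if i = j then 1 else 0)" "\<And>i. e' i \<bullet> \<nu>' = 0"
     "\<And>i. d \<bullet> e' i = - (d \<bullet> e i) / \<rho>"
     "\<And>i. e i \<bullet> e' i = 1 - 2 * (d \<bullet> e i)\<^sup>2 / (\<rho> * ((norm d)\<^sup>2 - \<tau>\<^sup>2))"
    using reflection_frame[OF norms n \<rho>pos Weq[symmetric] \<tau>_def \<tau>D ee] by metis
  have "\<exists>v. Q.D v z' = e' i" for i using Q.tangent_range[OF zW(2)] e'(2)[of i] by (simp add: \<nu>'_def)
  then obtain v where v: "\<And>i. Q.D (v i) z' = e' i" by metis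
  define hy where "hy i = Q.h (v i) (v i) z'" for i
  \<comment> \<open>The choice of the parameter curves cancels the tangential accelerations, at x
    here and at y below; only the normal parts \<open>- \<kappa> i\<close> and \<open>- hy i\<close>
    remain.\<close>
  have "\<exists>b. P.D b z = - \<kappa> i *\<^sub>R \<nu> - P.HH (u i) (u i) z" for i
  proof (rule P.tangent_range[OF zW(1)])
    have "P.h (u i) (u i) z = \<kappa> i" using eig orth by (simp add: z_def)
    then show "(- \<kappa> i *\<^sub>R \<nu> - P.HH (u i) (u i) z) \<bullet> N z = 0"
      using nn by (simp add: inner_diff_left P.h_def \<nu>_def)
  qed
  then obtain b where b: "\<And>i. P.D (b i) z = - \<kappa> i *\<^sub>R \<nu> - P.HH (u i) (u i) z" by metis
  have "\<exists>b. Q.D b z' = - hy i *\<^sub>R \<nu>' - Q.HH (v i) (v i) z'" for i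
  proof (rule Q.tangent_range[OF zW(2)])
    show "(- hy i *\<^sub>R \<nu>' - Q.HH (v i) (v i) z') \<bullet> N' z' = 0"
      using nn by (simp add: inner_diff_left hy_def Q.h_def \<nu>'_def)
  qed
  then obtain b' where b': "\<And>i. Q.D (b' i) z' = - hy i *\<^sub>R \<nu>' - Q.HH (v i) (v i) z'" by metis
  have bb: "P.HH (u i) (u i) (p, t) + P.D (b i) (p, t) = - \<kappa> i *\<^sub>R N (p, t)" for i
    using b[of i] by (simp add: z_def \<nu>_def)
  define m where "m i = dd (u i, 0) (dd (u i, 0) N) z + dd (b i, 0) N z" for i
  define g1 where "g1 i = dd (u i, 0) G z" for i
  define g2 where "g2 i = dd (u i, 0) (dd (u i, 0) G) z + dd (b i, 0) G z" for i
  have m: "(\<Sum>i\<in>UNIV. a i *\<^sub>R m i) = dd (0, 1) N z - (\<Sum>i\<in>UNIV. a i * (\<kappa> i)\<^sup>2) *\<^sub>R \<nu>"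
    unfolding m_def z_def \<nu>_def
    by (rule P.evolution(1)[OF z0 orth eig G0 \<epsilon>]) (rule J bb; assumption)+
  have Gt: "dd (0, 1) G z = (\<Sum>i\<in>UNIV. a i * (g2 i + G z * (\<kappa> i)\<^sup>2))"
    unfolding g2_def z_def
    by (rule P.evolution(2)[OF z0 orth eig G0 \<epsilon>]) (rule J bb; assumption)+
  have Nu: "dd (u i, 0) N (p, t) = \<kappa> i *\<^sub>R e i" for i
    unfolding e_def z_def by (rule P.normal_derivative_eigen[OF z0 eig])
  define cx where "cx i s = p + s *\<^sub>R u i + (s\<^sup>2 / 2) *\<^sub>R b i" for i s
  have cx: "isCont (cx i) 0" "cx i 0 = p" for i unfolding cx_def by (rule cont) simp
  have jG: "jet2 (\<lambda>s. G (cx i s, t)) (g1 i) (g2 i)" for i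
    unfolding cx_def g1_def g2_def z_def by (rule curve[OF P.open_W z0 P.C2G])
  have jN: "jet2 (\<lambda>s. N (cx i s, t)) (\<kappa> i *\<^sub>R e i) (m i)" for i
    unfolding cx_def m_def z_def using curve[OF P.open_W z0 P.C2N, of "u i" "b i"] by (simp only: Nu)
  have jY: "jet2 (\<lambda>s. Y (cx i s, t)) (e i) (- \<kappa> i *\<^sub>R \<nu>)" for i
    unfolding cx_def e_def z_def \<nu>_def using curve[OF P.open_W z0 P.smooth[of 2], of "u i" "b i"] by (simp only: bb)
  \<comment> \<open>Only x moves: its velocity \<open>e i\<close> is orthogonal to
    \<open>\<nu>\<close>, and the normal turns with velocity
    \<open>\<kappa> i *\<^sub>R e i\<close>.\<close>
  have first: "K * g1 i * (norm d)\<^sup>2 / 2 = (k - \<kappa> i) * (d \<bullet> e i)" for i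
  proof -
    have A: "d = Y' (q, t) - Y (cx i 0, t)" "G (cx i 0, t) = G z" "N (cx i 0, t) = \<nu>"
      by (simp_all add: d_def z_def z'_def \<nu>_def cx)
    note j = jet2_chord_fun[OF jG[of i] jY[of i] jet2_const jN[of i] A, of K]
    have "K / 2 * (g1 i * (norm d)\<^sup>2 + 2 * G z * (d \<bullet> (0 - e i))) + (0 - e i) \<bullet> \<nu> + d \<bullet> (\<kappa> i *\<^sub>R e i) = 0"
      by (rule conjunct1[OF test[where c="cx i" and c'="\<lambda>s. q", OF j cx]]) simp_all
    then show ?thesis using ee(2)[of i] by (simp add: k_def inner_diff_left algebra_simps)
  qed
  have second: "0 \<le> \<epsilon> * (K / 2 * (g2 i * (norm d)\<^sup>2 + 4 * g1 i * (d \<bullet> D1) + G z * (2 * (D1 \<bullet> D1) + 2 * (d \<bullet> D2)))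
          + D2 \<bullet> \<nu> + 2 * (D1 \<bullet> (\<kappa> i *\<^sub>R e i)) + d \<bullet> m i)"
    if \<sigma>: "\<sigma> = 1 \<or> \<sigma> = (-1::real)" and D1: "D1 = \<sigma> *\<^sub>R e' i - e i" and D2: "D2 = - hy i *\<^sub>R \<nu>' - (- \<kappa> i *\<^sub>R \<nu>)" for i \<sigma> D1 D2
  proof -
    define cy where "cy s = q + s *\<^sub>R (\<sigma> *\<^sub>R v i) + (s\<^sup>2 / 2) *\<^sub>R b' i" for s
    have cy: "isCont cy 0" "cy 0 = q" unfolding cy_def by (rule cont) simp
    have "Q.HH (\<sigma> *\<^sub>R v i) (\<sigma> *\<^sub>R v i) z' = (\<sigma> * \<sigma>) *\<^sub>R Q.HH (v i) (v i) z'"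
      by (simp only: linear_scale[OF Q.linear_HH[OF zW(2)]] linear_scale[OF Q.linear_HH'[OF zW(2)]] scaleR_scaleR)
    then have "Q.HH (\<sigma> *\<^sub>R v i) (\<sigma> *\<^sub>R v i) z' + Q.D (b' i) z' = - hy i *\<^sub>R \<nu>'"
      using \<sigma> b'[of i] by auto
    moreover have "Q.D (\<sigma> *\<^sub>R v i) z' = \<sigma> *\<^sub>R e' i" by (simp only: linear_scale[OF Q.linear_D[OF zW(2)]] v)
    ultimately have jY': "jet2 (\<lambda>s. Y' (cy s, t)) (\<sigma> *\<^sub>R e' i) (- hy i *\<^sub>R \<nu>')"
      unfolding cy_def using curve[OF Q.open_W z0' Q.smooth[of 2], of "\<sigma> *\<^sub>R v i" "b' i"] by (simp only: z'_def)
    have A: "d = Y' (cy 0, t) - Y (cx i 0, t)" "G (cx i 0, t) = G z" "N (cx i 0, t) = \<nu>"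
      by (simp_all add: d_def z_def z'_def \<nu>_def cx cy)
    note j = jet2_chord_fun[OF jG[of i] jY[of i] jY' jN[of i] A, of K]
    show ?thesis unfolding D1 D2 by (rule conjunct2[OF test[OF j cx cy]])
  qed
  have Gy: "\<epsilon> * G' z' \<le> \<epsilon> * (\<Sum>i\<in>UNIV. a i * hy i)"
    unfolding hy_def by (rule J'[OF zW(2)]) (simp add: v e')
  have time: "\<epsilon> * (K / 2 * (dd (0, 1) G z * (norm d)\<^sup>2 + 2 * G z * (d \<bullet> (- G' z' *\<^sub>R \<nu>' - (- G z *\<^sub>R \<nu>))))
          + (- G' z' *\<^sub>R \<nu>' - (- G z *\<^sub>R \<nu>)) \<bullet> \<nu> + d \<bullet> dd (0, 1) N z) \<le> - L * th"
  proof -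
    have dt: "((\<lambda>s. (x, s)) has_vector_derivative (0, 1)) (at t)" for x :: 'p
      by (rule has_vector_derivative_Pair) (auto intro!: derivative_eq_intros)
    have dG: "((\<lambda>s. G (p, s)) has_vector_derivative dd (0, 1) G z) (at t)"
      unfolding z_def by (rule has_vector_derivative_dd_compose[OF P.diffG(1)[OF z0] dt])
    have dN: "((\<lambda>s. N (p, s)) has_vector_derivative dd (0, 1) N z) (at t)"
      unfolding z_def by (rule has_vector_derivative_dd_compose[OF P.diffN(1)[OF z0] dt])
    have dY: "((\<lambda>s. Y (p, s)) has_vector_derivative - G z *\<^sub>R \<nu>) (at t)"
      using has_vector_derivative_dd_compose[OF P.diff(1)[OF z0] dt] P.velocity[OF z0] by (simp add: z_def \<nu>_def)
    have dY': "((\<lambda>s. Y' (q, s)) has_vector_derivative - G' z' *\<^sub>R \<nu>') (at t)"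
      using has_vector_derivative_dd_compose[OF Q.diff(1)[OF z0'] dt] Q.velocity[OF z0'] by (simp add: z'_def \<nu>'_def)
    define dv where "dv = - G' z' *\<^sub>R \<nu>' - (- G z *\<^sub>R \<nu>)"
    have dd: "((\<lambda>s. Y' (q, s) - Y (p, s)) has_vector_derivative dv) (at t)"
      unfolding dv_def by (rule has_vector_derivative_diff[OF dY' dY])
    have "((\<lambda>s. chord_fun K (G (p, s)) (Y (p, s)) (Y' (q, s)) (N (p, s))) has_vector_derivative
       (K / 2 * (G (p, t) * ((Y' (q, t) - Y (p, t)) \<bullet> dv + dv \<bullet> (Y' (q, t) - Y (p, t))) + dd (0, 1) G z * ((Y' (q, t) - Y (p, t)) \<bullet> (Y' (q, t) - Y (p, t))))
        + ((Y' (q, t) - Y (p, t)) \<bullet> dd (0, 1) N z + dv \<bullet> N (p, t)))) (at t)"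
      unfolding chord_fun_def
      by (intro has_vector_derivative_add bounded_linear.has_vector_derivative[OF bounded_linear_mult_right]
          bounded_bilinear.has_vector_derivative[OF bounded_bilinear_mult]
          bounded_bilinear.has_vector_derivative[OF bounded_bilinear_inner] dG dN dd)
    moreover have "(K / 2 * (G (p, t) * ((Y' (q, t) - Y (p, t)) \<bullet> dv + dv \<bullet> (Y' (q, t) - Y (p, t))) + dd (0, 1) G z * ((Y' (q, t) - Y (p, t)) \<bullet> (Y' (q, t) - Y (p, t))))
        + ((Y' (q, t) - Y (p, t)) \<bullet> dd (0, 1) N z + dv \<bullet> N (p, t))) =
       K / 2 * (dd (0, 1) G z * (norm d)\<^sup>2 + 2 * G z * (d \<bullet> dv)) + dv \<bullet> \<nu> + d \<bullet> dd (0, 1) N z" (is "?A = ?B")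
      unfolding d_def[unfolded z_def z'_def, symmetric]
      by (simp add: z_def[symmetric] \<nu>_def[symmetric] power2_norm_eq_inner inner_commute[of dv d] distrib_left)
    ultimately have dw: "((\<lambda>s. chord_fun K (G (p, s)) (Y (p, s)) (Y' (q, s)) (N (p, s))) has_real_derivative ?B) (at t)"
      by (simp add: has_real_derivative_iff_has_vector_derivative)
    have "((\<lambda>s. \<epsilon> * chord_fun K (G (p, s)) (Y (p, s)) (Y' (q, s)) (N (p, s)) + \<theta> s) has_real_derivative \<epsilon> * ?B + L * \<theta> t) (at t)"
      by (intro DERIV_add DERIV_cmult dw \<theta>)
    then have "\<epsilon> * ?B + L * \<theta> t \<le> 0"
    proof (rule left_derivative_nonpos)
      show "\<epsilon> * chord_fun K (G (p, t)) (Y (p, t)) (Y' (q, t)) (N (p, t)) + \<theta> t = 0" using touch \<epsilon> by auto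
      show "\<forall>\<^sub>F s in at_left t. 0 \<le> \<epsilon> * chord_fun K (G (p, s)) (Y (p, s)) (Y' (q, s)) (N (p, s)) + \<theta> s"
        using before by eventually_elim simp
    qed
    then show ?thesis by (simp add: th_def dv_def)
  qed
  show False
    by (rule touching_impossible[where e=e and e'=e' and m=m and a=a and \<kappa>=\<kappa> and h=hy and K=K and G="G z" and Gy="G' z'" and L=L
          and \<tau>=\<tau> and \<theta>=th and C=C and k=k and d=d and \<nu>=\<nu> and \<nu>'=\<nu>' and \<rho>=\<rho> and \<epsilon>=\<epsilon> and ?g1.0=g1 and ?g2.0=g2 and Gt="dd (0, 1) G z" and Nt="dd (0, 1) N z"])
       (use \<epsilon> nn ee e' n \<rho>half Weq th C C' a G0 m Gt first Gy second time L in
        \<open>simp_all add: k_def \<tau>_def z_def[symmetric] D_def[symmetric]\<close>)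
qed

end

section \<open>Curvature flows on compact manifolds\<close>

text \<open>Tangent vectors and curvatures are defined by differentiating a chart representation at
  a fixed time, whereas the proof differentiates a space-time extension. Agreement on one time slice
  suffices to identify the two.\<close>

lemma dd_slice:
  assumes g: "g differentiable (at (p, t))" and W: "open W" "(p, t) \<in> W"
    and r: "\<And>p'. (p', t) \<in> W \<Longrightarrow> r p' = g (p', t)"
  shows "r differentiable (at p)" "frechet_derivative r (at p) v = dd (v, 0) g (p, t)"
proof -
  define V where "V = (\<lambda>p'. (p', t)) -` W"
  have V: "open V" "p \<in> V"
    unfolding V_def using W by (auto intro!: open_vimage continuous_intros)
  have "((\<lambda>p'. g (p', t)) has_derivative (\<lambda>v. dd (v, 0) g (p, t))) (at p)"
    using has_derivative_compose[OF has_derivative_Pair[OF has_derivative_ident has_derivative_const] has_derivative_dd[OF g]]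
    by (simp add: o_def)
  then have d: "(r has_derivative (\<lambda>v. dd (v, 0) g (p, t))) (at p)"
    by (rule has_derivative_transform_within_open[OF _ V]) (simp add: r V_def)
  then show "r differentiable (at p)" by (auto simp: differentiable_def)
  show "frechet_derivative r (at p) v = dd (v, 0) g (p, t)"
    using frechet_derivative_at[OF d] by metis
qed

lemma has_vector_derivative_unique_within:
  fixes f :: "real \<Rightarrow> 'a::real_normed_vector"
  assumes "(f has_vector_derivative a) (at t within S)" "(f has_vector_derivative b) (at t within S)"
    and "t islimpt S"
  shows "a = b"
proof -
  have "at t within S \<noteq> bot" using assms(3) by (simp add: trivial_limit_within)
  then show ?thesis using assms(1,2) vector_derivative_unique_within by blast
qed

locale curvature_flow = speed \<Gamma> f
  for \<Gamma> :: "(real^'n::finite) set" and f :: "real^'n \<Rightarrow> real" +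
  fixes A :: "('m::t2_space, 'n) chart set"
    and X :: "'m \<Rightarrow> real \<Rightarrow> real^'k::finite"
    and \<nu> :: "'m \<Rightarrow> real \<Rightarrow> real^'k"
    and \<Omega> :: "real \<Rightarrow> (real^'k) set"
    and \<kappa> :: "'m \<Rightarrow> real \<Rightarrow> real^'n"
    and F :: "'m \<Rightarrow> real \<Rightarrow> real"
    and T :: ereal
  assumes dim: "CARD('k) = CARD('n) + 1"
    and T: "0 < T"
    and compact_M: "compact (UNIV :: 'm set)"
    and atlas: "smooth_atlas A"
    and family: "smooth_family A T X"
    and embedding: "\<And>t. t \<in> time_interval T \<Longrightarrow> smooth_embedding A (\<lambda>x. X x t)"
    and region: "\<And>t. t \<in> time_interval T \<Longrightarrow> compact_region_bounded_by (\<Omega> t) (range (\<lambda>x. X x t))"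
    and normal: "\<And>x t. t \<in> time_interval T \<Longrightarrow> outward_unit_normal A (\<lambda>x. X x t) (\<Omega> t) x (\<nu> x t)"
    and curvatures: "\<And>x t. t \<in> time_interval T \<Longrightarrow> principal_curvatures A (\<lambda>x. X x t) (\<nu> x t) x (\<kappa> x t)"
    and in_cone: "\<And>x t. t \<in> time_interval T \<Longrightarrow> \<kappa> x t \<in> \<Gamma>"
    and F_eq: "\<And>x t. t \<in> time_interval T \<Longrightarrow> F x t = f (\<kappa> x t)"
    and motion: "\<And>x t. t \<in> time_interval T \<Longrightarrow>
           ((\<lambda>s. X x s) has_vector_derivative - (F x t *\<^sub>R \<nu> x t)) (at t within time_interval T)"
    and F_pos: "\<And>x t. t \<in> time_interval T \<Longrightarrow> 0 < F x t"
begin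

abbreviation I where "I \<equiv> time_interval T"

lemma norm_normal: "t \<in> I \<Longrightarrow> norm (\<nu> x t) = 1"
  using normal[of t x] by (simp add: outward_unit_normal_def)

lemma inj_X: "t \<in> I \<Longrightarrow> X x t = X y t \<longleftrightarrow> x = y"
  using embedding[of t] by (auto simp: smooth_embedding_def embedding_map_def homeomorphic_map_def dest: injD
      simp: inj_on_def homeomorphic_eq_everything_map)

lemma I_later: "t \<in> I \<Longrightarrow> \<exists>t'>t. {t..t'} \<subseteq> I"
proof -
  assume t: "t \<in> I"
  then obtain t' where t': "ereal t < ereal t'" "ereal t' < T"
    using ereal_dense2[of "ereal t" T] by (auto simp: time_interval_def)
  have "{t..t'} \<subseteq> I"
  proof
    fix s assume "s \<in> {t..t'}"
    then have "0 \<le> s" "ereal s \<le> ereal t'" using t by (auto simp: time_interval_def)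
    then show "s \<in> I" using le_less_trans[OF _ t'(2)] by (simp add: time_interval_def)
  qed
  then show ?thesis using t' by auto
qed

text \<open>Makes derivatives within the time interval unique, also at the initial time, where only
  one side is available.\<close>

lemma islimpt_I: "t \<in> I \<Longrightarrow> t islimpt I"
proof -
  assume "t \<in> I"
  then obtain t' where t': "t < t'" "{t..t'} \<subseteq> I" using I_later by blast
  have "t islimpt {t<..<t'}" using t' by (simp add: islimpt_greaterThanLessThan1)
  then show ?thesis by (rule islimpt_subset) (use t' in auto)
qed

lemma I_convex: "s \<in> I \<Longrightarrow> t \<in> I \<Longrightarrow> {s..t} \<subseteq> I"
proof
  fix r assume "s \<in> I" "t \<in> I" "r \<in> {s..t}"
  then have r: "0 \<le> r" "ereal r \<le> ereal t" "ereal t < T" by (auto simp: time_interval_def)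
  then show "r \<in> I" using le_less_trans[OF r(2,3)] by (simp add: time_interval_def)
qed

lemma open_I_pos: "open (I \<inter> {0<..})"
proof -
  have "I \<inter> {0<..} = ereal -` {..<T} \<inter> {0<..}" by (auto simp: time_interval_def)
  then show ?thesis by (auto intro!: open_Int open_vimage continuous_on_ereal continuous_on_id)
qed

text \<open>\<open>Y\<close> is a smooth extension of the chart representation to an open set of
  space-time, so that two-sided derivatives exist at time 0. It is tied to \<open>X\<close> only at
  times in \<open>I\<close>; its other values carry no geometric meaning.\<close>

definition patch :: "'m set \<Rightarrow> ('m \<Rightarrow> real^'n) \<Rightarrow> ((real^'n) \<times> real) set \<Rightarrow> ((real^'n) \<times> real \<Rightarrow> real^'k) \<Rightarrow> bool" where
  "patch U \<phi> W Y \<longleftrightarrow> (U, \<phi>) \<in> A \<and> open W \<and> fst ` W \<subseteq> \<phi> ` U \<and> (\<forall>k. Ck_on k W Y) \<and>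
     (\<forall>p t. (p, t) \<in> W \<longrightarrow> t \<in> I \<longrightarrow> Y (p, t) = X (inv_into U \<phi> p) t)"

lemma chart_facts:
  assumes "(U, \<phi>) \<in> A"
  shows "open U" "open (\<phi> ` U)" "continuous_on U \<phi>" "x \<in> U \<Longrightarrow> inv_into U \<phi> (\<phi> x) = x"
    "p \<in> \<phi> ` U \<Longrightarrow> \<phi> (inv_into U \<phi> p) = p" "p \<in> \<phi> ` U \<Longrightarrow> inv_into U \<phi> p \<in> U"
proof -
  have c: "is_chart (U, \<phi>)" using atlas assms by (auto simp: smooth_atlas_def)
  then show "open U" "open (\<phi> ` U)" "continuous_on U \<phi>" by (auto simp: is_chart_def homeomorphism_def)
  show "inv_into U \<phi> (\<phi> x) = x" if "x \<in> U" using c that by (auto simp: is_chart_def homeomorphism_def)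
  show "\<phi> (inv_into U \<phi> p) = p" if "p \<in> \<phi> ` U" using that by (rule f_inv_into_f)
  show "inv_into U \<phi> p \<in> U" if "p \<in> \<phi> ` U" using that by (rule inv_into_into)
qed

lemma patch_exists:
  assumes "t0 \<in> I"
  obtains U \<phi> W Y where "patch U \<phi> W Y" "x0 \<in> U" "(\<phi> x0, t0) \<in> W"
proof -
  have "x0 \<in> (\<Union>(U, \<phi>)\<in>A. U)" using atlas by (simp add: smooth_atlas_def)
  then obtain U \<phi> where U: "(U, \<phi>) \<in> A" "x0 \<in> U" by auto
  have "smooth_on (\<phi> ` U \<times> I) (\<lambda>(p, t). local_rep (U, \<phi>) (\<lambda>x. X x t) p)"
    using family U(1) by (auto simp: smooth_family_def)
  moreover have "(\<phi> x0, t0) \<in> \<phi> ` U \<times> I" using U assms by auto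
  ultimately obtain W g where W: "open W" "(\<phi> x0, t0) \<in> W" "\<forall>k. Ck_on k W g"
    "\<forall>q\<in>W \<inter> \<phi> ` U \<times> I. g q = (\<lambda>(p, t). local_rep (U, \<phi>) (\<lambda>x. X x t) p) q"
    unfolding smooth_on_def by metis
  have "patch U \<phi> (W \<inter> \<phi> ` U \<times> UNIV) g"
    unfolding patch_def
  proof (intro conjI allI impI)
    show "open (W \<inter> \<phi> ` U \<times> UNIV)" by (intro open_Int W open_Times chart_facts(2)[OF U(1)] open_UNIV)
    show "Ck_on k (W \<inter> \<phi> ` U \<times> UNIV) g" for k using W(3) Ck_on_subset by blast
    show "g (p, t) = X (inv_into U \<phi> p) t" if "(p, t) \<in> W \<inter> \<phi> ` U \<times> UNIV" "t \<in> I" for p t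
      using W(4) that by (auto simp: local_rep_def)
  qed (use U in auto)
  then show ?thesis using that[of U \<phi> "W \<inter> \<phi> ` U \<times> UNIV" g] U W by auto
qed

lemma patch_subset: "patch U \<phi> W Y \<Longrightarrow> open V \<Longrightarrow> V \<subseteq> W \<Longrightarrow> patch U \<phi> V Y"
  by (auto simp: patch_def intro: Ck_on_subset)

lemma patch_smooth: "patch U \<phi> W Y \<Longrightarrow> smooth_patch W Y"
  by (simp add: patch_def smooth_patch_def)

section \<open>Geometry of the flow in one patch\<close>

context
  fixes U \<phi> W Y p t
  assumes patch: "patch U \<phi> W Y" and pt: "(p, t) \<in> W" and t: "t \<in> I"
begin

interpretation smooth_patch W Y by (rule patch_smooth[OF patch])

lemma patch_point: "p \<in> \<phi> ` U" "inv_into U \<phi> p \<in> U" "\<phi> (inv_into U \<phi> p) = p" "(U, \<phi>) \<in> A"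
proof -
  show UA: "(U, \<phi>) \<in> A" using patch by (simp add: patch_def)
  show "p \<in> \<phi> ` U" using patch pt by (auto simp: patch_def)
  then show "inv_into U \<phi> p \<in> U" "\<phi> (inv_into U \<phi> p) = p" using chart_facts[OF UA] by auto
qed

lemma patch_value: "Y (p, t) = X (inv_into U \<phi> p) t"
  using patch pt t by (simp add: patch_def)

text \<open>Extension and flow agree within the time interval and are both differentiable there, so
  the time derivative of the extension is the velocity of the flow even at time 0.\<close>

lemma patch_velocity: "dd (0, 1) Y (p, t) = - (F (inv_into U \<phi> p) t *\<^sub>R \<nu> (inv_into U \<phi> p) t)"
proof (rule has_vector_derivative_unique_within[OF _ motion[OF t] islimpt_I[OF t]])
  let ?x = "inv_into U \<phi> p"
  have "((\<lambda>s. (p, s)) has_vector_derivative (0, 1)) (at t within I)"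
    by (rule has_vector_derivative_Pair) (auto intro!: derivative_eq_intros)
  then have d: "((\<lambda>s. Y (p, s)) has_vector_derivative dd (0, 1) Y (p, t)) (at t within I)"
    by (rule has_vector_derivative_dd_compose[where c="\<lambda>s. (p, s)" and s=t, OF diff(1)[OF pt]])
  have "((\<lambda>s. (p, s)) \<longlongrightarrow> (p, t)) (at t within I)" by (intro tendsto_intros)
  then have "\<forall>\<^sub>F s in at t within I. (p, s) \<in> W" using topological_tendstoD open_W pt by blast
  moreover have "\<forall>\<^sub>F s in at t within I. s \<in> I" by (simp add: eventually_at_filter)
  ultimately have ev: "\<forall>\<^sub>F s in at t within I. Y (p, s) = X ?x s"
    by eventually_elim (use patch in \<open>simp add: patch_def\<close>)
  show "((\<lambda>s. X ?x s) has_vector_derivative dd (0, 1) Y (p, t)) (at t within I)"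
    unfolding has_vector_derivative_def
    by (rule has_derivative_transform_eventually[OF d[unfolded has_vector_derivative_def] ev patch_value t])
qed

lemma patch_F: "F (inv_into U \<phi> p) t = norm (dd (0, 1) Y (p, t))"
  unfolding patch_velocity using F_pos[OF t, of "inv_into U \<phi> p"] norm_normal[OF t] by simp

lemma patch_normal: "\<nu> (inv_into U \<phi> p) t = - (1 / norm (dd (0, 1) Y (p, t))) *\<^sub>R dd (0, 1) Y (p, t)"
  unfolding patch_F[symmetric] unfolding patch_velocity using F_pos[OF t, of "inv_into U \<phi> p"] by simp

lemma patch_slice_value: "(p', t) \<in> W \<Longrightarrow> local_rep (U, \<phi>) (\<lambda>x. X x t) p' = Y (p', t)"
  using patch t by (simp add: patch_def local_rep_def)

lemma patch_partial: "partial_deriv i (local_rep (U, \<phi>) (\<lambda>x. X x t)) p = D (axis i 1) (p, t)"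
  unfolding partial_deriv_def by (rule dd_slice(2)[OF diff(1)[OF pt] open_W pt patch_slice_value])

lemma patch_tangent: "D v (p, t) \<bullet> \<nu> (inv_into U \<phi> p) t = 0"
proof -
  let ?x = "inv_into U \<phi> p"
  have "\<forall>i. partial_deriv i (local_rep (U, \<phi>) (\<lambda>x. X x t)) (\<phi> ?x) \<bullet> \<nu> ?x t = 0"
    using normal[OF t, of ?x] patch_point unfolding outward_unit_normal_def by blast
  then have 0: "D (axis i 1) (p, t) \<bullet> \<nu> ?x t = 0" for i
    using patch_partial patch_point by simp
  have "D v (p, t) = D (\<Sum>i\<in>UNIV. v $ i *\<^sub>R axis i 1) (p, t)"
    by (metis (no_types, lifting) basis_expansion scalar_mult_eq_scaleR sum.cong)
  also have "\<dots> = (\<Sum>i\<in>UNIV. v $ i *\<^sub>R D (axis i 1) (p, t))"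
    by (simp only: linear_sum[OF linear_D[OF pt]] linear_scale[OF linear_D[OF pt]])
  finally show ?thesis by (simp add: inner_sum_left 0)
qed

lemma patch_immersed: "D v (p, t) = 0 \<Longrightarrow> v = 0"
proof -
  assume v: "D v (p, t) = 0"
  have "inj (frechet_derivative (local_rep (U, \<phi>) (\<lambda>x. X x t)) (at p))"
    using embedding[OF t] patch_point(1,4) unfolding smooth_embedding_def by blast
  moreover have "frechet_derivative (local_rep (U, \<phi>) (\<lambda>x. X x t)) (at p) w = D w (p, t)" for w
    by (rule dd_slice(2)[OF diff(1)[OF pt] open_W pt patch_slice_value])
  ultimately have "inj (\<lambda>w. D w (p, t))" by (simp add: inj_def)
  then show "v = 0" using v by (simp add: linear_injective_0[OF linear_D[OF pt]])
qed

end

lemma patch_partial2: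
  assumes patch: "patch U \<phi> W Y" and pt: "(p, t) \<in> W" and t: "t \<in> I"
  shows "partial_deriv i (partial_deriv j (local_rep (U, \<phi>) (\<lambda>x. X x t))) p = dd (axis i 1, 0) (dd (axis j 1, 0) Y) (p, t)"
proof -
  interpret smooth_patch W Y by (rule patch_smooth[OF patch])
  show ?thesis
    unfolding partial_deriv_def[of i]
    by (rule dd_slice(2)[OF diff(2)[OF pt] open_W pt]) (rule patch_partial[OF patch _ t])
qed

text \<open>Passes from the matrix eigenvalue problem in coordinates to the bilinear forms of the
  patch, then orthonormalises without reordering the entries of \<open>\<kappa> x t\<close>.\<close>

lemma patch_eigenframe:
  assumes patch: "patch U \<phi> W Y" and pt: "(p, t) \<in> W" and t: "t \<in> I" and x: "x = inv_into U \<phi> p"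
  shows "\<exists>u :: 'n \<Rightarrow> real^'n. (\<forall>i j. dd (u i, 0) Y (p, t) \<bullet> dd (u j, 0) Y (p, t) = (if i = j then 1 else 0)) \<and>
     (\<forall>i v. - (dd (u i, 0) (dd (v, 0) Y) (p, t) \<bullet> \<nu> x t) = \<kappa> x t $ i * (dd (u i, 0) Y (p, t) \<bullet> dd (v, 0) Y (p, t)))"
proof -
  interpret smooth_patch W Y by (rule patch_smooth[OF patch])
  let ?R = "local_rep (U, \<phi>) (\<lambda>x. X x t)"
  note pp = patch_point[OF patch pt t]
  have "eigenvalues_wrt (metric_matrix ?R p) (second_fundamental_matrix ?R (\<nu> x t) p) (\<kappa> x t)"
  proof -
    have "x \<in> U" "\<phi> x = p" using pp by (simp_all add: x)
    moreover have "x \<in> U \<longrightarrow> eigenvalues_wrt (metric_matrix ?R (\<phi> x)) (second_fundamental_matrix ?R (\<nu> x t) (\<phi> x)) (\<kappa> x t)"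
      using bspec[OF curvatures[OF t, of x, unfolded principal_curvatures_def] pp(4)] by simp
    ultimately show ?thesis by simp
  qed
  then obtain e :: "'n \<Rightarrow> real^'n" where e: "inj e" "independent (range e)"
    "\<And>i. second_fundamental_matrix ?R (\<nu> x t) p *v e i = (\<kappa> x t $ i) *\<^sub>R (metric_matrix ?R p *v e i)"
    unfolding eigenvalues_wrt_def by blast
  define H where "H u v = - (HH u v (p, t) \<bullet> \<nu> x t)" for u v
  have Hlin: "linear (\<lambda>u. H u v)" for v
    unfolding H_def by (intro linearI)
      (simp_all add: linear_add[OF linear_HH[OF pt]] linear_scale[OF linear_HH[OF pt]] inner_add_left)
  have Hsym: "H u v = H v u" for u v by (simp add: H_def HH_commute[OF pt])
  have ex: "v = (\<Sum>i\<in>UNIV. v $ i *\<^sub>R axis i 1)" for v :: "real^'n"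
    by (metis (no_types, lifting) basis_expansion scalar_mult_eq_scaleR sum.cong)
  have Hexp: "H v w = (\<Sum>i\<in>UNIV. v $ i * H (axis i 1) w)" for v w
    by (subst ex[of v]) (simp only: linear_sum[OF Hlin] linear_scale[OF Hlin] real_scaleR_def)
  have Dexp: "D v (p, t) \<bullet> w = (\<Sum>i\<in>UNIV. v $ i * (D (axis i 1) (p, t) \<bullet> w))" for v w
    by (subst ex[of v]) (simp only: linear_sum[OF linear_D[OF pt]] linear_scale[OF linear_D[OF pt]] inner_sum_left inner_scaleR_left)
  have hm: "second_fundamental_matrix ?R (\<nu> x t) p $ i $ j = H (axis i 1) (axis j 1)" for i j
    by (simp add: second_fundamental_matrix_def patch_partial2[OF patch pt t] H_def)
  have gm: "metric_matrix ?R p $ i $ j = D (axis i 1) (p, t) \<bullet> D (axis j 1) (p, t)" for i j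
    by (simp add: metric_matrix_def patch_partial[OF patch pt t])
  have eig: "H (e i) v = \<kappa> x t $ i * (D (e i) (p, t) \<bullet> D v (p, t))" for i v
  proof -
    have l: "H (axis l 1) (e i) = \<kappa> x t $ i * (D (axis l 1) (p, t) \<bullet> D (e i) (p, t))" for l
    proof -
      have "(second_fundamental_matrix ?R (\<nu> x t) p *v e i) $ l = ((\<kappa> x t $ i) *\<^sub>R (metric_matrix ?R p *v e i)) $ l"
        by (simp only: e(3))
      then have "(\<Sum>j\<in>UNIV. H (axis l 1) (axis j 1) * e i $ j)
         = \<kappa> x t $ i * (\<Sum>j\<in>UNIV. (D (axis l 1) (p, t) \<bullet> D (axis j 1) (p, t)) * e i $ j)"
        by (simp add: matrix_vector_mult_def hm gm)
      moreover have "H (axis l 1) (e i) = (\<Sum>j\<in>UNIV. H (axis l 1) (axis j 1) * e i $ j)"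
        unfolding Hsym[of "axis l 1"] by (subst Hexp) (simp add: mult.commute)
      moreover have "D (axis l 1) (p, t) \<bullet> D (e i) (p, t) = (\<Sum>j\<in>UNIV. (D (axis l 1) (p, t) \<bullet> D (axis j 1) (p, t)) * e i $ j)"
        unfolding inner_commute[of "D (axis l 1) (p, t)"] by (subst Dexp) (simp add: mult.commute)
      ultimately show ?thesis by simp
    qed
    have "H (e i) v = H v (e i)" by (rule Hsym)
    also have "\<dots> = (\<Sum>l\<in>UNIV. v $ l * (\<kappa> x t $ i * (D (axis l 1) (p, t) \<bullet> D (e i) (p, t))))"
      by (subst Hexp) (simp only: l)
    also have "\<dots> = \<kappa> x t $ i * (D v (p, t) \<bullet> D (e i) (p, t))"
      by (subst Dexp) (simp add: sum_distrib_left mult_ac)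
    finally show ?thesis by (simp add: inner_commute)
  qed
  have "inj (\<lambda>v. D v (p, t))"
    using patch_immersed[OF patch pt t] by (simp add: linear_injective_0[OF linear_D[OF pt]])
  from orthonormal_eigenframe[OF linear_D[OF pt] this Hlin Hsym e(1,2) eig]
  show ?thesis by (simp add: H_def)
qed

text \<open>As \<open>W\<close> is open, the condition on the times confines the patch to positive
  times, and extension and flow coincide on all of it. The field \<open>dd (0, 1) Y\<close> is
  smooth and has no zeros, so its norm and its direction are C^2; these are the speed and, up to
  sign, the normal.\<close>

lemma patch_flow:
  assumes patch: "patch U \<phi> W Y" and WI: "snd ` W \<subseteq> I"
  shows "flow_patch W Y (\<lambda>z. \<nu> (inv_into U \<phi> (fst z)) (snd z)) (\<lambda>z. F (inv_into U \<phi> (fst z)) (snd z))"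
proof -
  interpret smooth_patch W Y by (rule patch_smooth[OF patch])
  have tI: "t \<in> I" if "(p, t) \<in> W" for p t using WI that by force
  let ?V = "dd (0, 1) Y"
  have ne: "?V z \<noteq> 0" if "z \<in> W" for z
  proof -
    obtain p t where z: "z = (p, t)" by (cases z)
    have "0 < norm (?V z)" using patch_F[OF patch that[unfolded z] tI[OF that[unfolded z]]] F_pos[OF tI[OF that[unfolded z]]]
      unfolding z by metis
    then show ?thesis by auto
  qed
  have CG: "Ck_on 2 W (\<lambda>z. norm (?V z))"
    unfolding norm_eq_sqrt_inner using ne smooth_dd
    by (intro Ck_on_sqrt[OF open_W] Ck_on_bilinear[OF bounded_bilinear_inner open_W]) auto
  have CN: "Ck_on 2 W (\<lambda>z. (- 1 * inverse (norm (?V z))) *\<^sub>R ?V z)"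
    using ne smooth_dd CG
    by (intro Ck_on_bilinear[OF bounded_bilinear_scaleR open_W] Ck_on_bilinear[OF bounded_bilinear_mult open_W]
        Ck_on_const Ck_on_inverse[OF open_W]) auto
  show ?thesis
  proof (unfold_locales)
    show "DIM(real ^ 'k) = DIM(real ^ 'n) + 1" using dim by simp
  next
    fix z assume z: "z \<in> W"
    obtain p t where pt: "z = (p, t)" by (cases z)
    have ptW: "(p, t) \<in> W" and t: "t \<in> I" using z pt tI by auto
    show "dd (0, 1) Y z = - (F (inv_into U \<phi> (fst z)) (snd z) *\<^sub>R \<nu> (inv_into U \<phi> (fst z)) (snd z))"
      using patch_velocity[OF patch ptW t] by (simp add: pt)
    show "\<nu> (inv_into U \<phi> (fst z)) (snd z) \<bullet> \<nu> (inv_into U \<phi> (fst z)) (snd z) = 1"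
      using norm_normal[OF t] by (simp add: pt norm_eq_1)
    show "D v z \<bullet> \<nu> (inv_into U \<phi> (fst z)) (snd z) = 0" for v
      using patch_tangent[OF patch ptW t] by (simp add: pt)
    show "v = 0" if "D v z = 0" for v using patch_immersed[OF patch ptW t] that by (simp add: pt)
  next
    show "Ck_on 2 W (\<lambda>z. \<nu> (inv_into U \<phi> (fst z)) (snd z))"
    proof (rule Ck_on_cong[OF open_W _ CN])
      fix z assume z: "z \<in> W"
      obtain p t where pt: "z = (p, t)" by (cases z)
      show "(- 1 * inverse (norm (?V z))) *\<^sub>R ?V z = \<nu> (inv_into U \<phi> (fst z)) (snd z)"
        using patch_normal[OF patch _ tI, of p t] z by (simp add: pt divide_inverse)
    qed
    show "Ck_on 2 W (\<lambda>z. F (inv_into U \<phi> (fst z)) (snd z))"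
    proof (rule Ck_on_cong[OF open_W _ CG])
      fix z assume z: "z \<in> W"
      obtain p t where pt: "z = (p, t)" by (cases z)
      show "norm (?V z) = F (inv_into U \<phi> (fst z)) (snd z)"
        using patch_F[OF patch _ tI, of p t] z by (simp add: pt)
    qed
  qed
qed

text \<open>The manifold carries only a Hausdorff topology, so nearness is expressed by filters and
  transported through charts.\<close>

lemma chart_near:
  assumes U: "(U, \<phi>) \<in> A" "x0 \<in> U" and V: "open V" "(\<phi> x0, t0 :: real) \<in> V"
  shows "\<forall>\<^sub>F z in nhds (x0, t0). fst z \<in> U \<and> (\<phi> (fst z), snd z) \<in> V"
proof -
  have "continuous_on (U \<times> UNIV) (\<lambda>z. \<phi> (fst z))"
    by (rule continuous_on_compose2[OF chart_facts(3)[OF U(1)]]) (auto intro!: continuous_intros)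
  then have "continuous_on (U \<times> UNIV) (\<lambda>z. (\<phi> (fst z), snd z :: real))"
    by (intro continuous_on_Pair continuous_on_snd continuous_on_id)
  moreover have "open (U \<times> (UNIV :: real set))" by (intro open_Times chart_facts(1)[OF U(1)] open_UNIV)
  ultimately have "open ((\<lambda>z. (\<phi> (fst z), snd z)) -` V \<inter> U \<times> UNIV)"
    using V(1) by (simp only: continuous_on_open_vimage)
  then have "\<forall>\<^sub>F z in nhds (x0, t0). z \<in> (\<lambda>z. (\<phi> (fst z), snd z)) -` V \<inter> U \<times> UNIV"
    by (rule eventually_nhds_in_open) (use U V in auto)
  then show ?thesis by eventually_elim auto
qed

lemma patch_tendsto:
  assumes patch: "patch U \<phi> W Y" and x0: "x0 \<in> U" "(\<phi> x0, t0) \<in> W"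
    and g: "isCont g (\<phi> x0, t0)"
  shows "((\<lambda>z. g (\<phi> (fst z), snd z)) \<longlongrightarrow> g (\<phi> x0, t0)) (nhds (x0, t0))"
proof (rule topological_tendstoI)
  fix S assume S: "open S" "g (\<phi> x0, t0) \<in> S"
  have "\<forall>\<^sub>F z in nhds (\<phi> x0, t0). g z \<in> S"
    using g S tendsto_at_iff_tendsto_nhds[of g "(\<phi> x0, t0)"] topological_tendstoD unfolding isCont_def by blast
  then obtain V where V: "open V" "(\<phi> x0, t0) \<in> V" "\<And>z. z \<in> V \<Longrightarrow> g z \<in> S" unfolding eventually_nhds by blast
  show "\<forall>\<^sub>F z in nhds (x0, t0). g (\<phi> (fst z), snd z) \<in> S"
  proof -
    have "(U, \<phi>) \<in> A" using patch by (simp add: patch_def)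
    from chart_near[OF this x0(1) V(1,2)] show ?thesis by eventually_elim (use V(3) in blast)
  qed
qed

lemma tendsto_flow:
  assumes t0: "t0 \<in> I"
  shows "((\<lambda>z. X (fst z) (snd z)) \<longlongrightarrow> X x0 t0) (inf (nhds (x0, t0)) (principal (UNIV \<times> I)))" (is ?X)
    and "((\<lambda>z. \<nu> (fst z) (snd z)) \<longlongrightarrow> \<nu> x0 t0) (inf (nhds (x0, t0)) (principal (UNIV \<times> I)))" (is ?N)
    and "((\<lambda>z. F (fst z) (snd z)) \<longlongrightarrow> F x0 t0) (inf (nhds (x0, t0)) (principal (UNIV \<times> I)))" (is ?F)
proof -
  obtain U \<phi> W Y where P: "patch U \<phi> W Y" and x0: "x0 \<in> U" "(\<phi> x0, t0) \<in> W" using patch_exists[OF t0] .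
  interpret smooth_patch W Y by (rule patch_smooth[OF P])
  have UA: "(U, \<phi>) \<in> A" using P by (simp add: patch_def)
  have inv0: "inv_into U \<phi> (\<phi> x0) = x0" by (rule chart_facts(4)[OF UA x0(1)])
  let ?Fl = "inf (nhds (x0, t0)) (principal (UNIV \<times> I))"
  have near: "\<forall>\<^sub>F z in ?Fl. fst z \<in> U \<and> (\<phi> (fst z), snd z) \<in> W \<and> snd z \<in> I"
    using chart_near[OF UA x0(1) open_W x0(2)] unfolding eventually_inf_principal
    by eventually_elim auto
  have ne: "dd (0, 1) Y (\<phi> x0, t0) \<noteq> 0"
    using patch_F[OF P x0(2) t0] F_pos[OF t0, of x0] unfolding inv0 by auto
  have cV: "isCont (dd (0, 1) Y) (\<phi> x0, t0)" by (rule isCont_dd[OF x0(2)])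
  have Yc: "isCont Y (\<phi> x0, t0)" using diff(1)[OF x0(2)] by (rule differentiable_imp_continuous_within)
  have tr: "(h \<longlongrightarrow> h0) ?Fl" if "isCont g (\<phi> x0, t0)" "g (\<phi> x0, t0) = h0"
    "\<And>x t. x \<in> U \<Longrightarrow> (\<phi> x, t) \<in> W \<Longrightarrow> t \<in> I \<Longrightarrow> h (x, t) = g (\<phi> x, t)" for g h and h0 :: "'q::topological_space"
  proof -
    have "((\<lambda>z. g (\<phi> (fst z), snd z)) \<longlongrightarrow> h0) ?Fl"
      using tendsto_mono[OF inf_le1 patch_tendsto[OF P x0 that(1)]] that(2) by simp
    moreover have "\<forall>\<^sub>F z in ?Fl. h z = g (\<phi> (fst z), snd z)"
      using near by eventually_elim (use that(3) in \<open>metis prod.collapse\<close>)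
    ultimately show ?thesis using tendsto_cong[of h "\<lambda>z. g (\<phi> (fst z), snd z)"] by blast
  qed
  have inv: "inv_into U \<phi> (\<phi> x) = x" if "x \<in> U" for x by (rule chart_facts(4)[OF UA that])
  have at: "X x t = Y (\<phi> x, t)" "F x t = norm (dd (0, 1) Y (\<phi> x, t))"
    "\<nu> x t = - (1 / norm (dd (0, 1) Y (\<phi> x, t))) *\<^sub>R dd (0, 1) Y (\<phi> x, t)"
    if "x \<in> U" "(\<phi> x, t) \<in> W" "t \<in> I" for x t
    using patch_value[OF P that(2,3)] patch_F[OF P that(2,3)] patch_normal[OF P that(2,3)]
    unfolding inv[OF that(1)] by simp_all
  show ?X by (rule tr[OF Yc]) (simp_all add: at x0 t0)
  show ?F by (rule tr[of "\<lambda>z. norm (dd (0, 1) Y z)"]) (simp_all add: at x0 t0 continuous_norm[OF cV])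
  show ?N
  proof (rule tr[of "\<lambda>z. - (1 / norm (dd (0, 1) Y z)) *\<^sub>R dd (0, 1) Y z"])
    show "isCont (\<lambda>z. - (1 / norm (dd (0, 1) Y z)) *\<^sub>R dd (0, 1) Y z) (\<phi> x0, t0)"
      using ne by (intro continuous_intros cV) auto
  qed (simp_all add: at x0 t0)
qed

end

section \<open>Uniform bounds on compact time intervals\<close>

context curvature_flow
begin

abbreviation near :: "'m \<Rightarrow> real \<Rightarrow> real set \<Rightarrow> ('m \<times> real) filter" where
  "near x t S \<equiv> inf (nhds (x, t)) (principal (UNIV \<times> S))"

abbreviation near2 :: "'m \<Rightarrow> 'm \<Rightarrow> real \<Rightarrow> real set \<Rightarrow> ('m \<times> 'm \<times> real) filter" where
  "near2 x y t S \<equiv> inf (nhds (x, y, t)) (principal (UNIV \<times> UNIV \<times> S))"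

lemma near_mono: "S \<subseteq> S' \<Longrightarrow> near x t S \<le> near x t S'"
  by (intro inf_mono) auto

lemma near2_proj:
  "filterlim (\<lambda>z. (fst z, snd (snd z))) (near x t S) (near2 x y t S)"
  "filterlim (\<lambda>z. (fst (snd z), snd (snd z))) (near y t S) (near2 x y t S)"
proof -
  have id: "((\<lambda>z. z) \<longlongrightarrow> (x, y, t)) (near2 x y t S)" by (rule tendsto_mono[OF inf_le1]) (rule filterlim_ident)
  have pr: "\<forall>\<^sub>F z in near2 x y t S. snd (snd z) \<in> S"
    unfolding eventually_inf_principal by (rule always_eventually) auto
  have "((\<lambda>z. (fst z, snd (snd z))) \<longlongrightarrow> (fst (x, y, t), snd (snd (x, y, t)))) (near2 x y t S)"
    "((\<lambda>z. (fst (snd z), snd (snd z))) \<longlongrightarrow> (fst (snd (x, y, t)), snd (snd (x, y, t)))) (near2 x y t S)"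
    by (intro tendsto_Pair tendsto_fst tendsto_snd id)+
  then show "filterlim (\<lambda>z. (fst z, snd (snd z))) (near x t S) (near2 x y t S)"
    "filterlim (\<lambda>z. (fst (snd z), snd (snd z))) (near y t S) (near2 x y t S)"
    using pr by (auto simp: filterlim_inf filterlim_principal elim: eventually_mono)
qed

lemma tendsto_flow2:
  assumes t: "t \<in> I" and S: "S \<subseteq> I"
  shows "((\<lambda>z. X (fst z) (snd (snd z))) \<longlongrightarrow> X x t) (near2 x y t S)"
    "((\<lambda>z. X (fst (snd z)) (snd (snd z))) \<longlongrightarrow> X y t) (near2 x y t S)"
    "((\<lambda>z. \<nu> (fst z) (snd (snd z))) \<longlongrightarrow> \<nu> x t) (near2 x y t S)"
    "((\<lambda>z. \<nu> (fst (snd z)) (snd (snd z))) \<longlongrightarrow> \<nu> y t) (near2 x y t S)"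
    "((\<lambda>z. F (fst z) (snd (snd z))) \<longlongrightarrow> F x t) (near2 x y t S)"
  using filterlim_compose[OF tendsto_mono[OF near_mono[OF S] tendsto_flow(1)[OF t]] near2_proj(1)]
    filterlim_compose[OF tendsto_mono[OF near_mono[OF S] tendsto_flow(1)[OF t]] near2_proj(2)]
    filterlim_compose[OF tendsto_mono[OF near_mono[OF S] tendsto_flow(2)[OF t]] near2_proj(1)]
    filterlim_compose[OF tendsto_mono[OF near_mono[OF S] tendsto_flow(2)[OF t]] near2_proj(2)]
    filterlim_compose[OF tendsto_mono[OF near_mono[OF S] tendsto_flow(3)[OF t]] near2_proj(1)]
  by simp_all

text \<open>Off the diagonal, injectivity of \<open>X\<close> at a fixed time keeps the chord away
  from 0; on the diagonal, \<open>quadratic_tangency\<close> and the chord bound of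
  \<open>local_bounds\<close> apply. The result controls both W and the sphere curvatures, uniformly
  up to the diagonal.\<close>

lemma quadratic_bound:
  assumes ab: "a \<in> I" "b \<in> I"
  shows "\<exists>C>0. \<forall>t\<in>{a..b}. \<forall>x y. \<bar>(X y t - X x t) \<bullet> \<nu> x t\<bar> \<le> C * (norm (X y t - X x t))\<^sup>2"
proof -
  let ?K = "UNIV \<times> UNIV \<times> {a..b} :: ('m \<times> 'm \<times> real) set"
  \<comment> \<open>Here \<open>m\<close> is the inverse of the wanted constant, so the condition
    weakens as \<open>m\<close> decreases, as \<open>compact_uniform\<close> requires.\<close>
  let ?P = "\<lambda>m (x, y, t). m * \<bar>(X y t - X x t) \<bullet> \<nu> x t\<bar> \<le> (norm (X y t - X x t))\<^sup>2"
  have sub: "{a..b} \<subseteq> I" by (rule I_convex[OF ab])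
  have "\<exists>m>0. \<forall>z\<in>?K. ?P m z"
  proof (rule compact_uniform)
    show "compact ?K" by (intro compact_Times compact_M compact_Icc)
    show "?P m' z" if "?P m z" "0 < m'" "m' \<le> m" for z m m'
    proof -
      obtain x y t where z: "z = (x, y, t)" by (cases z) auto
      from order_trans[OF mult_right_mono[OF that(3) abs_ge_zero]] that(1) show ?thesis by (simp add: z)
    qed
    fix z assume "z \<in> ?K"
    then obtain x0 y0 s0 where z: "z = (x0, y0, s0)" and s0: "s0 \<in> {a..b}" by auto
    have s0I: "s0 \<in> I" using s0 sub by blast
    have ev: "\<forall>\<^sub>F z' in near2 x0 y0 s0 {a..b}. snd (snd z') \<in> I"
      unfolding eventually_inf_principal by (rule always_eventually) (use sub in auto)
    have "\<exists>m>0. \<forall>\<^sub>F z' in near2 x0 y0 s0 {a..b}. ?P m z'"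
    proof (cases "x0 = y0")
      case False
      define d0 where "d0 = norm (X y0 s0 - X x0 s0)"
      have d0: "0 < d0" using False inj_X[OF s0I] by (auto simp: d0_def)
      have "((\<lambda>z. norm (X (fst (snd z)) (snd (snd z)) - X (fst z) (snd (snd z)))) \<longlongrightarrow> d0) (near2 x0 y0 s0 {a..b})"
        unfolding d0_def by (intro tendsto_norm tendsto_diff tendsto_flow2[OF s0I sub])
      then have "\<forall>\<^sub>F z in near2 x0 y0 s0 {a..b}. d0 / 2 < norm (X (fst (snd z)) (snd (snd z)) - X (fst z) (snd (snd z)))"
        using d0 by (intro order_tendstoD(1)) auto
      with ev have "\<forall>\<^sub>F z in near2 x0 y0 s0 {a..b}. ?P (d0 / 2) z"
      proof eventually_elim
        case (elim z)
        obtain x y t where z: "z = (x, y, t)" by (cases z) auto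
        have "\<bar>(X y t - X x t) \<bullet> \<nu> x t\<bar> \<le> norm (X y t - X x t)"
          using Cauchy_Schwarz_ineq2[of _ "\<nu> x t"] norm_normal[of t x] elim by (simp add: z)
        then have "d0 / 2 * \<bar>(X y t - X x t) \<bullet> \<nu> x t\<bar> \<le> norm (X y t - X x t) * norm (X y t - X x t)"
          using elim d0 by (intro mult_mono) (auto simp: z)
        then show ?case by (simp add: z power2_eq_square)
      qed
      then show ?thesis using d0 by (intro exI[of _ "d0 / 2"]) auto
    next
      case True
      obtain U \<phi> W Y where P: "patch U \<phi> W Y" and x0: "x0 \<in> U" "(\<phi> x0, s0) \<in> W" using patch_exists[OF s0I] .
      interpret smooth_patch W Y by (rule patch_smooth[OF P])
      have UA: "(U, \<phi>) \<in> A" using P by (simp add: patch_def)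
      obtain r c C where B: "0 < r" "0 < c" "0 < C" "ball (\<phi> x0, s0) r \<subseteq> W"
        "\<And>z u v. z \<in> ball (\<phi> x0, s0) r \<Longrightarrow> norm (HH u v z) \<le> C * norm u * norm v"
        "\<And>p q t. (p, t) \<in> ball (\<phi> x0, s0) r \<Longrightarrow> (q, t) \<in> ball (\<phi> x0, s0) r \<Longrightarrow> c * norm (q - p) \<le> norm (Y (q, t) - Y (p, t))"
        using local_bounds[OF x0(2) patch_immersed[OF P x0(2) s0I]] by metis
      have n: "\<forall>\<^sub>F z in near x0 s0 {a..b}. fst z \<in> U \<and> (\<phi> (fst z), snd z) \<in> ball (\<phi> x0, s0) r"
        using chart_near[OF UA x0(1) open_ball, of s0] B(1) by (intro filter_leD[OF inf_le1]) simp
      have "\<forall>\<^sub>F z in near2 x0 y0 s0 {a..b}. ?P (c\<^sup>2 / C) z"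
        using ev filterlim_iff[THEN iffD1, OF near2_proj(1)[of x0 s0 "{a..b}" y0], rule_format, OF n]
          filterlim_iff[THEN iffD1, OF near2_proj(2)[of y0 s0 "{a..b}" x0], rule_format, OF n[unfolded True]]
      proof eventually_elim
        case (elim z)
        obtain x y t where z: "z = (x, y, t)" by (cases z) auto
        define p where "p = \<phi> x"
        define q where "q = \<phi> y"
        have e: "t \<in> I" "x \<in> U" "y \<in> U" "(p, t) \<in> ball (\<phi> x0, s0) r" "(q, t) \<in> ball (\<phi> x0, s0) r"
          using elim by (auto simp: z p_def q_def True)
        have pW: "(p, t) \<in> W" "(q, t) \<in> W" using e B(4) by blast+
        have inv: "inv_into U \<phi> p = x" "inv_into U \<phi> q = y" using chart_facts(4)[OF UA] e by (simp_all add: p_def q_def)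
        have XY: "X x t = Y (p, t)" "X y t = Y (q, t)"
          using patch_value[OF P pW(1) e(1)] patch_value[OF P pW(2) e(1)] inv by simp_all
        have "\<bar>(Y (q, t) - Y (p, t)) \<bullet> \<nu> x t\<bar> \<le> C * (norm (q - p))\<^sup>2"
          using patch_tangent[OF P pW(1) e(1), of "q - p"] norm_normal[OF e(1)] inv
          by (intro quadratic_tangency[OF B(4,5) e(4,5)] B) auto
        also have "(norm (q - p))\<^sup>2 \<le> (norm (Y (q, t) - Y (p, t)) / c)\<^sup>2"
          using B(6)[OF e(4,5)] B(2) by (intro power_mono) (auto simp: field_simps)
        finally have "\<bar>(Y (q, t) - Y (p, t)) \<bullet> \<nu> x t\<bar> \<le> C * (norm (Y (q, t) - Y (p, t)) / c)\<^sup>2" using B(3) by simp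
        then have "c\<^sup>2 / C * \<bar>(Y (q, t) - Y (p, t)) \<bullet> \<nu> x t\<bar> \<le> c\<^sup>2 / C * (C * (norm (Y (q, t) - Y (p, t)) / c)\<^sup>2)"
          using B by (intro mult_left_mono) auto
        also have "\<dots> = (norm (Y (q, t) - Y (p, t)))\<^sup>2" using B by (simp add: power_divide)
        finally show ?case by (simp add: z XY)
      qed
      then show ?thesis using B by (intro exI[of _ "c\<^sup>2 / C"]) auto
    qed
    then show "\<exists>m>0. \<forall>\<^sub>F z' in inf (nhds z) (principal ?K). ?P m z'" by (simp add: z)
  qed
  then obtain m where m: "m > 0" "\<And>x y t. t \<in> {a..b} \<Longrightarrow> ?P m (x, y, t)" by blast
  show ?thesis
  proof (intro exI[of _ "1 / m"] conjI ballI allI)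
    fix t x y assume "t \<in> {a..b}"
    from m(2)[OF this, of x y] show "\<bar>(X y t - X x t) \<bullet> \<nu> x t\<bar> \<le> 1 / m * (norm (X y t - X x t))\<^sup>2"
      using m(1) by (simp add: field_simps)
  qed (use m in auto)
qed

lemma speed_bounds:
  assumes ab: "a \<in> I" "b \<in> I"
  shows "\<exists>m>0. \<forall>t\<in>{a..b}. \<forall>x. m \<le> F x t \<and> F x t \<le> 1 / m"
proof -
  let ?K = "UNIV \<times> {a..b} :: ('m \<times> real) set"
  let ?P = "\<lambda>m (x, t). m \<le> F x t \<and> m * F x t \<le> 1"
  have sub: "{a..b} \<subseteq> I" by (rule I_convex[OF ab])
  have "\<exists>m>0. \<forall>z\<in>?K. ?P m z"
  proof (rule compact_uniform)
    show "compact ?K" by (intro compact_Times compact_M compact_Icc)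
    show "?P m' z" if "?P m z" "0 < m'" "m' \<le> m" for z m m'
    proof -
      obtain x t where z: "z = (x, t)" by (cases z)
      have "0 < F x t" using that by (auto simp: z)
      then have "m' * F x t \<le> m * F x t" using that by (intro mult_right_mono) auto
      moreover have "m \<le> F x t" "m * F x t \<le> 1" using that by (auto simp: z)
      ultimately show ?thesis using that(3) unfolding z by simp
    qed
    fix z assume "z \<in> ?K"
    then obtain x0 s0 where z: "z = (x0, s0)" and s0: "s0 \<in> {a..b}" by auto
    have s0I: "s0 \<in> I" using s0 sub by blast
    define m where "m = min (F x0 s0 / 2) (1 / (2 * F x0 s0))"
    note F0 = F_pos[OF s0I, of x0]
    have m: "0 < m" using F0 by (simp add: m_def)
    note lim = tendsto_mono[OF near_mono[OF sub] tendsto_flow(3)[OF s0I, of x0]]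
    have "\<forall>\<^sub>F z in near x0 s0 {a..b}. F x0 s0 / 2 < F (fst z) (snd z)" "\<forall>\<^sub>F z in near x0 s0 {a..b}. F (fst z) (snd z) < 2 * F x0 s0"
      by (rule order_tendstoD(1)[OF lim], use F0 in simp) (rule order_tendstoD(2)[OF lim], use F0 in simp)
    then have "\<forall>\<^sub>F z in near x0 s0 {a..b}. ?P m z"
    proof eventually_elim
      case (elim z)
      have "m * F (fst z) (snd z) \<le> 1 / (2 * F x0 s0) * (2 * F x0 s0)"
        using elim F0 m by (intro mult_mono) (auto simp: m_def)
      then show ?case using elim F0 by (auto simp: m_def split: prod.splits)
    qed
    then show "\<exists>m>0. \<forall>\<^sub>F z' in inf (nhds z) (principal ?K). ?P m z'" using m by (auto simp: z)
  qed
  then obtain m where "m > 0" "\<And>x t. t \<in> {a..b} \<Longrightarrow> m \<le> F x t \<and> m * F x t \<le> 1" by auto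
  then show ?thesis by (intro exI[of _ m]) (auto simp: field_simps)
qed

text \<open>The vector \<open>\<kappa> x t\<close> lists eigenvalues in an arbitrary order at each
  point, so continuity arguments do not apply to it directly. Along a sequence violating the bound,
  orthonormal eigenframes have a convergent subsequence; the diagonal in the limit frame lies in
  \<Gamma>, where the gradient of \<open>f\<close> is continuous, so the sums stay bounded after
  all.\<close>

lemma curvature_bound:
  assumes ab: "a \<in> I" "b \<in> I"
  shows "\<exists>B>0. \<forall>t\<in>{a..b}. \<forall>x. (\<Sum>i\<in>UNIV. \<bar>\<kappa> x t $ i\<bar>) + (\<Sum>i\<in>UNIV. \<bar>gradient f (\<kappa> x t) i\<bar>) \<le> B"
proof -
  define S where "S x t = (\<Sum>i\<in>UNIV. \<bar>\<kappa> x t $ i\<bar>) + (\<Sum>i\<in>UNIV. \<bar>gradient f (\<kappa> x t) i\<bar>)" for x t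
  have S0: "0 \<le> S x t" for x t by (auto simp: S_def intro!: add_nonneg_nonneg sum_nonneg)
  let ?K = "UNIV \<times> {a..b} :: ('m \<times> real) set"
  let ?P = "\<lambda>m z. m * S (fst z) (snd z) \<le> 1"
  have sub: "{a..b} \<subseteq> I" by (rule I_convex[OF ab])
  have "\<exists>m>0. \<forall>z\<in>?K. ?P m z"
  proof (rule compact_uniform)
    show "compact ?K" by (intro compact_Times compact_M compact_Icc)
    show "?P m' z" if "?P m z" "0 < m'" "m' \<le> m" for z m m'
      using that mult_right_mono[OF that(3) S0, of "fst z" "snd z"] by linarith
    fix z assume "z \<in> ?K"
    then obtain x0 s0 where z: "z = (x0, s0)" and s0: "s0 \<in> {a..b}" by auto
    have s0I: "s0 \<in> I" using s0 sub by blast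
    obtain U \<phi> W Y where P: "patch U \<phi> W Y" and x0: "x0 \<in> U" "(\<phi> x0, s0) \<in> W" using patch_exists[OF s0I] .
    interpret smooth_patch W Y by (rule patch_smooth[OF P])
    define z0 where "z0 = (\<phi> x0, s0)"
    have UA: "(U, \<phi>) \<in> A" using P by (simp add: patch_def)
    have z0W: "z0 \<in> W" using x0 by (simp add: z0_def)
    have inv: "inv_into U \<phi> (\<phi> x) = x" if "x \<in> U" for x by (rule chart_facts(4)[OF UA that])
    obtain r c where B: "0 < r" "0 < c" "ball z0 r \<subseteq> W"
        "\<And>z v. z \<in> ball z0 r \<Longrightarrow> c * norm v \<le> norm (D v z)"
      using local_bounds[OF x0(2) patch_immersed[OF P x0(2) s0I]] unfolding z0_def by metis
    show "\<exists>m>0. \<forall>\<^sub>F z' in inf (nhds z) (principal ?K). ?P m z'"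
    proof (rule ccontr)
      assume neg: "\<not> ?thesis"
      \<comment> \<open>The negated local bound, tested with \<open>1 / (real j + 1)\<close>, yields
        points approaching (x0, s0). They are read in one chart, where subsequences are
        available.\<close>
      have "\<exists>x t. t \<in> {a..b} \<and> x \<in> U \<and> (\<phi> x, t) \<in> ball z0 r \<and> dist (\<phi> x, t) z0 < 1 / (real j + 1) \<and>
          dist (\<nu> x t) (\<nu> x0 s0) < 1 / (real j + 1) \<and> real j + 1 < S x t" for j
      proof (rule ccontr)
        assume no: "\<not> ?thesis"
        have j: "0 < 1 / (real j + 1)" by simp
        have 1: "\<forall>\<^sub>F z in near x0 s0 {a..b}. fst z \<in> U \<and> (\<phi> (fst z), snd z) \<in> ball z0 (min r (1 / (real j + 1)))"
        proof (rule filter_leD[OF inf_le1], rule chart_near[OF UA x0(1) open_ball])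
          show "(\<phi> x0, s0) \<in> ball z0 (min r (1 / (real j + 1)))" using B(1) j by (simp add: z0_def)
        qed
        have 2: "\<forall>\<^sub>F z in near x0 s0 {a..b}. dist (\<nu> (fst z) (snd z)) (\<nu> x0 s0) < 1 / (real j + 1)"
          using tendstoD[OF tendsto_mono[OF near_mono[OF sub] tendsto_flow(2)[OF s0I]] j] .
        have 3: "\<forall>\<^sub>F z in near x0 s0 {a..b}. snd z \<in> {a..b}"
          unfolding eventually_inf_principal by (rule always_eventually) auto
        have "\<forall>\<^sub>F z in near x0 s0 {a..b}. ?P (1 / (real j + 1)) z"
          using 1 2 3
        proof eventually_elim
          case (elim z)
          then have "\<not> real j + 1 < S (fst z) (snd z)" using no by (auto simp: dist_commute)
          then show ?case by (simp add: field_simps)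
        qed
        then show False using neg j unfolding z by blast
      qed
      then obtain x t where xt: "\<And>j. t j \<in> {a..b}" "\<And>j. x j \<in> U" "\<And>j. (\<phi> (x j), t j) \<in> ball z0 r"
        "\<And>j. dist (\<phi> (x j), t j) z0 < 1 / (real j + 1)" "\<And>j. dist (\<nu> (x j) (t j)) (\<nu> x0 s0) < 1 / (real j + 1)"
        "\<And>j. real j + 1 < S (x j) (t j)" by metis
      define zz where "zz j = (\<phi> (x j), t j)" for j
      have zzW: "zz j \<in> W" for j using xt(3) B(3) by (auto simp: zz_def)
      have tI: "t j \<in> I" for j using xt(1) sub by blast
      have lim0: "(\<lambda>j. 1 / (real j + 1)) \<longlonglongrightarrow> 0"
        using LIMSEQ_inverse_real_of_nat by (simp add: inverse_eq_divide add.commute)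
      have zzlim: "zz \<longlonglongrightarrow> z0"
      proof (rule metric_tendsto_imp_tendsto[OF lim0], rule always_eventually, rule allI)
        show "dist (zz j) (z0) \<le> dist (1 / (real j + 1)) 0" for j
          using xt(4)[of j] by (simp add: zz_def less_imp_le)
      qed
      have \<nu>lim: "(\<lambda>j. \<nu> (x j) (t j)) \<longlonglongrightarrow> \<nu> x0 s0"
      proof (rule metric_tendsto_imp_tendsto[OF lim0], rule always_eventually, rule allI)
        show "dist (\<nu> (x j) (t j)) (\<nu> x0 s0) \<le> dist (1 / (real j + 1)) 0" for j
          using xt(5)[of j] by (simp add: less_imp_le)
      qed
      have "\<exists>u :: 'n \<Rightarrow> real^'n. (\<forall>i i'. D (u i) (zz j) \<bullet> D (u i') (zz j) = (if i = i' then 1 else 0)) \<and>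
         (\<forall>i v. - (HH (u i) v (zz j) \<bullet> \<nu> (x j) (t j)) = \<kappa> (x j) (t j) $ i * (D (u i) (zz j) \<bullet> D v (zz j)))" for j
        unfolding zz_def by (rule patch_eigenframe[OF P _ tI]) (use zzW inv xt(2) in \<open>auto simp: zz_def\<close>)
      then obtain u :: "nat \<Rightarrow> 'n \<Rightarrow> real^'n" where u: "\<And>j i i'. D (u j i) (zz j) \<bullet> D (u j i') (zz j) = (if i = i' then 1 else 0)"
         "\<And>j i v. - (HH (u j i) v (zz j) \<bullet> \<nu> (x j) (t j)) = \<kappa> (x j) (t j) $ i * (D (u j i) (zz j) \<bullet> D v (zz j))"
        by metis
      define uv where "uv j = (\<chi> i. u j i)" for j
      \<comment> \<open>Orthonormality fixes the length of the image vectors, and the immersion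
        bound \<open>c\<close> pulls this back to the parameter vectors.\<close>
      have ub: "norm (u j i) \<le> 1 / c" for j i
      proof -
        have "norm (D (u j i) (zz j)) = 1" using u(1)[of j i i] by (simp add: norm_eq_1)
        then show ?thesis using B(4)[of "zz j" "u j i"] xt(3) B(2) by (simp add: zz_def field_simps)
      qed
      have "norm (uv j) \<le> (\<Sum>i\<in>(UNIV::'n set). 1 / c)" for j
      proof -
        have "norm (uv j) = L2_set (\<lambda>i. norm (uv j $ i)) UNIV" by (rule norm_vec_def)
        also have "\<dots> \<le> (\<Sum>i\<in>UNIV. norm (uv j $ i))" by (rule L2_set_le_sum) simp
        also have "\<dots> \<le> (\<Sum>i\<in>(UNIV::'n set). 1 / c)" by (intro sum_mono) (simp add: uv_def ub)
        finally show ?thesis .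
      qed
      then have "bounded (range uv)" unfolding bounded_iff by blast
      then obtain ul \<rho> where \<rho>: "strict_mono \<rho>" "(uv \<circ> \<rho>) \<longlonglongrightarrow> ul"
        using bounded_imp_convergent_subsequence by blast
      have ulim: "(\<lambda>j. u (\<rho> j) i) \<longlonglongrightarrow> ul $ i" for i
        using tendsto_vec_nth[OF \<rho>(2), of i] by (simp add: uv_def o_def)
      have zl: "(\<lambda>j. zz (\<rho> j)) \<longlonglongrightarrow> z0" and nl: "(\<lambda>j. \<nu> (x (\<rho> j)) (t (\<rho> j))) \<longlonglongrightarrow> \<nu> x0 s0"
        using LIMSEQ_subseq_LIMSEQ[OF zzlim \<rho>(1)] LIMSEQ_subseq_LIMSEQ[OF \<nu>lim \<rho>(1)] by (simp_all add: o_def)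
      have Dl: "(\<lambda>j. D (u (\<rho> j) i) (zz (\<rho> j))) \<longlonglongrightarrow> D (ul $ i) z0" for i
        by (subst D_expand[OF zzW], subst D_expand[OF z0W])
           (intro tendsto_intros ulim isCont_tendsto_compose[OF isCont_dd[OF z0W]] zl)
      have Hl: "(\<lambda>j. HH (u (\<rho> j) i) (u (\<rho> j) i) (zz (\<rho> j))) \<longlonglongrightarrow> HH (ul $ i) (ul $ i) z0" for i
        by (subst HH_expand[OF zzW], subst HH_expand[OF z0W])
           (intro tendsto_intros ulim isCont_tendsto_compose[OF isCont_dd2[OF z0W]] zl)
      have ulorth: "D (ul $ i) z0 \<bullet> D (ul $ i') z0 = (if i = i' then 1 else 0)" for i i'
      proof (rule LIMSEQ_unique[OF tendsto_inner[OF Dl Dl]])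
        show "(\<lambda>j. D (u (\<rho> j) i) (zz (\<rho> j)) \<bullet> D (u (\<rho> j) i') (zz (\<rho> j))) \<longlonglongrightarrow> (if i = i' then 1 else 0)"
          by (simp only: u(1) tendsto_const)
      qed
      obtain w :: "'n \<Rightarrow> real^'n" where w: "\<And>i j. D (w i) z0 \<bullet> D (w j) z0 = (if i = j then 1 else 0)"
         "\<And>i v. - (HH (w i) v z0 \<bullet> \<nu> x0 s0) = \<kappa> x0 s0 $ i * (D (w i) z0 \<bullet> D v z0)"
        using patch_eigenframe[OF P x0(2) s0I inv[OF x0(1), symmetric]] unfolding z0_def by metis
      define Q where "Q i j = (D (ul $ i) z0 \<bullet> D (w j) z0)\<^sup>2" for i j
      \<comment> \<open>The limit of the curvature vectors. It need not be a reordering of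
        \<open>\<kappa> x0 s0\<close> for the argument to work: being a doubly stochastic average of
        it is enough to lie in \<Gamma>.\<close>
      define kl where "kl = (\<chi> i. \<Sum>j\<in>UNIV. Q i j * \<kappa> x0 s0 $ j)"
      have card: "CARD('n) = DIM(real^'n)" by simp
      have "kl \<in> \<Gamma>"
        unfolding kl_def
      proof (rule stochastic_in_cone[OF in_cone[OF s0I]])
        show "(\<Sum>j\<in>UNIV. Q i j) = 1" for i
          unfolding Q_def by (rule orthonormal_frame_stochastic[OF linear_D[OF z0W] card w(1) ulorth])
        show "(\<Sum>i\<in>UNIV. Q i j) = 1" for j
          unfolding Q_def inner_commute[of "D (ul $ _) z0"]
          by (rule orthonormal_frame_stochastic[OF linear_D[OF z0W] card ulorth w(1)])
      qed (simp add: Q_def)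
      have linH: "linear (\<lambda>u. - (HH u v z0 \<bullet> \<nu> x0 s0))" for v
        by (intro linearI) (simp_all add: linear_add[OF linear_HH[OF z0W]] linear_scale[OF linear_HH[OF z0W]] inner_add_left)
      have kli: "- (HH (ul $ i) (ul $ i) z0 \<bullet> \<nu> x0 s0) = kl $ i" for i
        using frame_diagonal[OF linear_D[OF z0W] card w(1) linH w(2), of "ul $ i"] by (simp add: kl_def Q_def)
      have klim: "(\<lambda>j. \<kappa> (x (\<rho> j)) (t (\<rho> j))) \<longlonglongrightarrow> kl"
      proof (rule vec_tendstoI)
        fix i
        have "(\<lambda>j. - (HH (u (\<rho> j) i) (u (\<rho> j) i) (zz (\<rho> j)) \<bullet> \<nu> (x (\<rho> j)) (t (\<rho> j)))) \<longlonglongrightarrow> kl $ i"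
          unfolding kli[symmetric] by (intro tendsto_intros Hl nl)
        then show "(\<lambda>j. \<kappa> (x (\<rho> j)) (t (\<rho> j)) $ i) \<longlonglongrightarrow> kl $ i" by (simp add: u)
      qed
      have "(\<lambda>j. S (x (\<rho> j)) (t (\<rho> j))) \<longlonglongrightarrow> (\<Sum>i\<in>UNIV. \<bar>kl $ i\<bar>) + (\<Sum>i\<in>UNIV. \<bar>gradient f kl i\<bar>)"
        unfolding S_def by (intro tendsto_intros tendsto_vec_nth klim isCont_tendsto_compose[OF gradient_isCont[OF \<open>kl \<in> \<Gamma>\<close>]])
      then have "Bseq (\<lambda>j. S (x (\<rho> j)) (t (\<rho> j)))" by (rule convergent_imp_Bseq[OF convergentI])
      then obtain M where M: "\<And>j. norm (S (x (\<rho> j)) (t (\<rho> j))) \<le> M" unfolding Bseq_def by blast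
      obtain j :: nat where j: "M < real j" using reals_Archimedean2 by blast
      have "real j \<le> real (\<rho> j)" using seq_suble[OF \<rho>(1), of j] by simp
      then show False using M[of j] xt(6)[of "\<rho> j"] j by (simp add: abs_le_iff)
    qed
  qed
  then obtain m where "m > 0" "\<And>x t. t \<in> {a..b} \<Longrightarrow> m * S x t \<le> 1" by force
  then show ?thesis by (intro exI[of _ "1 / m"]) (auto simp: field_simps S_def)
qed

end

text \<open>Completing the square shows a ball, a half-space or the exterior of a ball, according to
  the sign of \<open>a\<close>. The exterior of a ball is where dimension at least 2 enters.\<close>

lemma connected_quadric_region:
  fixes b :: "'e::euclidean_space"
  assumes "2 \<le> DIM('e)"
  shows "connected {v. a * (v \<bullet> v) + v \<bullet> b < 0}"
proof (cases "a = 0")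
  case True
  then have "{v. a * (v \<bullet> v) + v \<bullet> b < 0} = {v. b \<bullet> v < 0}" by (auto simp: inner_commute)
  then show ?thesis by (simp add: convex_connected convex_halfspace_lt)
next
  case False
  define c where "c = - (1 / (2 * a)) *\<^sub>R b"
  define r where "r = norm c"
  have eq: "a * (v \<bullet> v) + v \<bullet> b = a * ((dist c v)\<^sup>2 - r\<^sup>2)" for v
  proof -
    have ca: "(2 * a) *\<^sub>R c = - b" using False by (simp add: c_def)
    have h: "(dist c v)\<^sup>2 - r\<^sup>2 = v \<bullet> v - 2 * (c \<bullet> v)"
      by (simp add: dist_norm r_def power2_norm_eq_inner inner_diff_left inner_diff_right inner_commute)
    have "a * ((dist c v)\<^sup>2 - r\<^sup>2) = a * (v \<bullet> v) - ((2 * a) *\<^sub>R c) \<bullet> v" unfolding h by (simp add: right_diff_distrib)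
    then show ?thesis unfolding ca by (simp add: inner_commute)
  qed
  have sq: "(dist c v)\<^sup>2 < r\<^sup>2 \<longleftrightarrow> dist c v < r" "(dist c v)\<^sup>2 > r\<^sup>2 \<longleftrightarrow> dist c v > r" for v
    by (auto simp: r_def power2_less_imp_less abs_le_square_iff[symmetric] not_le[symmetric])
  show ?thesis
  proof (cases "0 < a")
    case True
    then have "{v. a * (v \<bullet> v) + v \<bullet> b < 0} = ball c r"
      by (auto simp: eq mult_less_0_iff sq)
    then show ?thesis by simp
  next
    case neg: False
    then have "{v. a * (v \<bullet> v) + v \<bullet> b < 0} = - cball c r"
      using False by (auto simp: eq mult_less_0_iff sq)
    then show ?thesis using connected_complement_bounded_convex[OF bounded_cball convex_cball assms] by simp
  qed
qed

lemma linear_term_dominates: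
  fixes A :: real shows "\<exists>r>0. \<forall>s. 0 < s \<longrightarrow> s < r \<longrightarrow> A * s\<^sup>2 - s < 0"
proof (intro exI[of _ "1 / (\<bar>A\<bar> + 1)"] conjI allI impI)
  fix s assume s: "0 < s" "s < 1 / (\<bar>A\<bar> + 1)"
  have "A * s \<le> \<bar>A\<bar> * s" using s by (intro mult_right_mono) auto
  also have "\<dots> < (\<bar>A\<bar> + 1) * s" using s by (intro mult_strict_right_mono) auto
  also have "\<dots> < 1" using s by (simp add: field_simps)
  finally have "A * s < 1" .
  then have "(A * s) * s < 1 * s" using s by (intro mult_strict_right_mono) auto
  then show "A * s\<^sup>2 - s < 0" by (simp add: power2_eq_square mult.assoc)
qed simp

section \<open>The two sides of the hypersurface, and exclusion of opposite normals\<close>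

context curvature_flow
begin

text \<open>Near \<open>X x t\<close> the hypersurface has two sides. The outer side misses the region, so the inner
  side lies in it because the region is the closure of its interior.\<close>

lemma inner_side:
  assumes t: "t \<in> I"
  shows "\<exists>e>0. \<forall>s. 0 < s \<longrightarrow> s < e \<longrightarrow> X x t - s *\<^sub>R \<nu> x t \<in> \<Omega> t"
proof -
  obtain U \<phi> W Y where P: "patch U \<phi> W Y" and x: "x \<in> U" "(\<phi> x, t) \<in> W" using patch_exists[OF t] .
  interpret smooth_patch W Y by (rule patch_smooth[OF P])
  define p0 where "p0 = \<phi> x"
  define n where "n = \<nu> x t"
  have UA: "(U, \<phi>) \<in> A" using P by (simp add: patch_def)
  have z0: "(p0, t) \<in> W" using x by (simp add: p0_def)
  have inv: "inv_into U \<phi> (\<phi> y) = y" if "y \<in> U" for y by (rule chart_facts(4)[OF UA that])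
  obtain r c C where B: "0 < r" "0 < c" "ball (p0, t) r \<subseteq> W"
    "\<And>p q t'. (p, t') \<in> ball (p0, t) r \<Longrightarrow> (q, t') \<in> ball (p0, t) r \<Longrightarrow> c * norm (q - p) \<le> norm (Y (q, t') - Y (p, t')) \<and>
       norm (Y (q, t') - Y (p, t') - D (q - p) (p0, t)) \<le> c / 2 * norm (q - p)"
    using local_bounds[OF z0 patch_immersed[OF P z0 t]] by metis
  have slice: "(p, t) \<in> ball (p0, t) r \<longleftrightarrow> p \<in> ball p0 r" for p by (simp add: dist_Pair_Pair)
  have nn: "n \<bullet> n = 1" using norm_normal[OF t] by (simp add: n_def norm_eq_1)
  have Dn: "D v (p0, t) \<bullet> n = 0" for v
    using patch_tangent[OF P z0 t] inv[OF x(1)] by (simp add: p0_def n_def)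
  \<comment> \<open>A collar made by translating the hypersurface along the fixed vector
    \<open>n\<close>, not along the varying normals. It is injective near \<open>p0\<close> because
    \<open>n\<close> is orthogonal to the tangent space at \<open>p0\<close>.\<close>
  define \<Phi> where "\<Phi> = (\<lambda>(p, s). Y (p, t) + s *\<^sub>R n)"
  have \<Phi>: "\<Phi> (p, s) = Y (p, t) + s *\<^sub>R n" for p s by (simp add: \<Phi>_def)
  have inj: "s = s' \<and> p = p'" if "p \<in> ball p0 r" "p' \<in> ball p0 r" "\<Phi> (p, s) = \<Phi> (p', s')" for p p' s s'
  proof -
    have d: "Y (p', t) - Y (p, t) = (s - s') *\<^sub>R n" using that(3) by (simp add: \<Phi> algebra_simps)
    have b: "c * norm (p' - p) \<le> norm (Y (p', t) - Y (p, t))"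
       "norm (Y (p', t) - Y (p, t) - D (p' - p) (p0, t)) \<le> c / 2 * norm (p' - p)"
      using B(4)[of p t p'] slice that by auto
    have "norm n = 1" using nn by (simp add: norm_eq_1)
    then have "norm (Y (p', t) - Y (p, t)) = \<bar>s - s'\<bar>" unfolding d by simp
    moreover have "\<bar>s - s'\<bar> \<le> norm (Y (p', t) - Y (p, t) - D (p' - p) (p0, t))"
    proof -
      have "(Y (p', t) - Y (p, t) - D (p' - p) (p0, t)) \<bullet> n = s - s'"
        unfolding d inner_diff_left Dn by (simp add: nn)
      then show ?thesis using Cauchy_Schwarz_ineq2[of "Y (p', t) - Y (p, t) - D (p' - p) (p0, t)" n] \<open>norm n = 1\<close> by simp
    qed
    \<comment> \<open>Two opposing bounds: the chord has length at least c |p' - p|, while its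
      component along \<open>n\<close>, which is all of it, is at most c/2 |p' - p|. Hence both are
      0.\<close>
    ultimately have le: "c * norm (p' - p) \<le> \<bar>s - s'\<bar>" "\<bar>s - s'\<bar> \<le> c / 2 * norm (p' - p)" using b by linarith+
    then have "c * norm (p' - p) \<le> 0" by linarith
    then have "norm (p' - p) \<le> 0" using B(2) by (simp add: mult_le_0_iff)
    then show ?thesis using le by simp
  qed
  have cont: "continuous_on (ball p0 r \<times> UNIV) \<Phi>"
  proof -
    have "continuous_on W Y" using Ck_on_continuous smooth by blast
    then have "continuous_on (ball p0 r \<times> (UNIV :: real set)) (\<lambda>z. Y (fst z, t))"
      by (rule continuous_on_compose2) (use slice B(3) in \<open>auto intro!: continuous_intros\<close>)
    then have "continuous_on (ball p0 r \<times> UNIV) (\<lambda>z. Y (fst z, t) + snd z *\<^sub>R n)"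
      by (intro continuous_intros)
    then show ?thesis by (simp add: \<Phi>_def case_prod_unfold)
  qed
  \<comment> \<open>An embedding is open onto its image, so close to \<open>X x t\<close> the
    hypersurface has no further sheet outside the chart.\<close>
  have "\<exists>O'. open O' \<and> X x t \<in> O' \<and> (\<forall>y. X y t \<in> O' \<longrightarrow> y \<in> U \<and> \<phi> y \<in> ball p0 r)"
  proof -
    have o: "open (\<phi> -` ball p0 r \<inter> U)"
      using chart_facts(1,3)[OF UA] continuous_on_open_vimage open_ball by blast
    have om: "open_map euclidean (subtopology euclidean (range (\<lambda>x. X x t))) (\<lambda>x. X x t)"
      using embedding[OF t] by (auto simp: smooth_embedding_def embedding_map_def intro: homeomorphic_imp_open_map)
    have "openin (subtopology euclidean (range (\<lambda>x. X x t))) ((\<lambda>x. X x t) ` (\<phi> -` ball p0 r \<inter> U))"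
      by (rule om[unfolded open_map_def, rule_format, OF open_openin[THEN iffD1, OF o]])
    then obtain O' where O': "open O'" "(\<lambda>x. X x t) ` (\<phi> -` ball p0 r \<inter> U) = range (\<lambda>x. X x t) \<inter> O'"
      unfolding openin_open by blast
    show ?thesis
    proof (intro exI[of _ O'] conjI allI impI)
      have "X x t \<in> (\<lambda>x. X x t) ` (\<phi> -` ball p0 r \<inter> U)" using x B(1) by (auto simp: p0_def)
      then show "X x t \<in> O'" using O'(2) by blast
      fix y assume "X y t \<in> O'"
      then have "X y t \<in> (\<lambda>x. X x t) ` (\<phi> -` ball p0 r \<inter> U)" using O'(2) by blast
      then obtain y' where "X y t = X y' t" "y' \<in> U" "\<phi> y' \<in> ball p0 r" by auto
      then show "y \<in> U" "\<phi> y \<in> ball p0 r" using inj_X[OF t] by auto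
    qed (rule O')
  qed
  then obtain O' where O': "open O'" "X x t \<in> O'" "\<And>y. X y t \<in> O' \<Longrightarrow> y \<in> U \<and> \<phi> y \<in> ball p0 r" by blast
  have \<Phi>0: "\<Phi> (p0, 0) = X x t" using patch_value[OF P z0 t] inv[OF x(1)] by (simp add: \<Phi> p0_def)
  have "open (\<Phi> -` O' \<inter> ball p0 r \<times> UNIV)"
    using cont continuous_on_open_vimage[of "ball p0 r \<times> UNIV" \<Phi>] O'(1) by (simp add: open_Times)
  moreover have "(p0, 0) \<in> \<Phi> -` O' \<inter> ball p0 r \<times> UNIV" using \<Phi>0 O'(2) B(1) by simp
  ultimately obtain S1 S2 where S: "open S1" "open S2" "p0 \<in> S1" "0 \<in> S2" "S1 \<times> S2 \<subseteq> \<Phi> -` O' \<inter> ball p0 r \<times> UNIV"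
    by (rule open_prod_elim) auto
  obtain r1 where r1: "r1 > 0" "ball p0 r1 \<subseteq> S1" using S open_contains_ball by blast
  obtain r2 where r2: "r2 > 0" "ball 0 r2 \<subseteq> S2" using S open_contains_ball by blast
  define B1 where "B1 = ball p0 r1"
  have B1: "B1 \<subseteq> ball p0 r" "p0 \<in> B1"
  proof -
    show "B1 \<subseteq> ball p0 r"
    proof
      fix p assume "p \<in> B1"
      then have "(p, 0) \<in> S1 \<times> S2" using r1 S(4) by (auto simp: B1_def)
      then show "p \<in> ball p0 r" using S(5) by blast
    qed
  qed (use r1 in \<open>simp add: B1_def\<close>)
  have maps: "\<Phi> (p, s) \<in> O'" if "p \<in> B1" "\<bar>s\<bar> < r2" for p s
  proof -
    have "(p, s) \<in> S1 \<times> S2" using that r1 r2 by (auto simp: B1_def)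
    then show ?thesis using S(5) by auto
  qed
  let ?R = "range (\<lambda>x. X x t)"
  have onS: "s = 0" if "p \<in> B1" "\<bar>s\<bar> < r2" "\<Phi> (p, s) \<in> ?R" for p s
  proof -
    from that(3) obtain y where y: "\<Phi> (p, s) = X y t" by (rule rangeE)
    then have yU: "y \<in> U" "\<phi> y \<in> ball p0 r" using O'(3) maps[OF that(1,2)] by auto
    have "(\<phi> y, t) \<in> W" using yU slice B(3) by blast
    then have "X y t = \<Phi> (\<phi> y, 0)" using patch_value[OF P _ t, of "\<phi> y"] inv[OF yU(1)] by (simp add: \<Phi>)
    then show ?thesis using inj[of p "\<phi> y" s 0] y yU that B1 by auto
  qed
  have reg: "compact (\<Omega> t)" "closure (interior (\<Omega> t)) = \<Omega> t" "frontier (\<Omega> t) = ?R"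
    using region[OF t] by (auto simp: compact_region_bounded_by_def)
  have side: "\<Phi> ` (B1 \<times> J) \<subseteq> \<Omega> t \<or> \<Phi> ` (B1 \<times> J) \<inter> \<Omega> t = {}"
    if J: "connected J" "\<And>s. s \<in> J \<Longrightarrow> \<bar>s\<bar> < r2 \<and> s \<noteq> 0" for J
  proof -
    have "connected (\<Phi> ` (B1 \<times> J))"
      by (rule connected_continuous_image[OF continuous_on_subset[OF cont]])
         (use B1 J in \<open>auto intro!: connected_Times simp: B1_def\<close>)
    moreover have "\<Phi> ` (B1 \<times> J) \<inter> frontier (\<Omega> t) = {}" unfolding reg using onS J by fastforce
    ultimately show ?thesis using connected_Int_frontier[of "\<Phi> ` (B1 \<times> J)" "\<Omega> t"] by blast
  qed
  have outer: "\<Phi> ` (B1 \<times> {0<..<r2}) \<inter> \<Omega> t = {}"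
  proof -
    obtain e where e: "e > 0" "\<And>s. 0 < s \<Longrightarrow> s < e \<Longrightarrow> X x t + s *\<^sub>R n \<notin> \<Omega> t"
      using normal[OF t, of x] by (auto simp: outward_unit_normal_def n_def)
    define s where "s = min e r2 / 2"
    have s: "0 < s" "s < e" "s < r2" using e r2 by (auto simp: s_def)
    have "\<Phi> (p0, s) \<in> \<Phi> ` (B1 \<times> {0<..<r2})" using B1 s by auto
    moreover have "\<Phi> (p0, s) \<notin> \<Omega> t" using e(2)[OF s(1,2)] \<Phi>0 by (simp add: \<Phi>)
    ultimately show ?thesis using side[of "{0<..<r2}"] by auto
  qed
  have "\<Phi> ` (B1 \<times> {-r2<..<0}) \<subseteq> \<Omega> t"
  proof (rule ccontr)
    assume "\<not> ?thesis"
    then have inner: "\<Phi> ` (B1 \<times> {-r2<..<0}) \<inter> \<Omega> t = {}" using side[of "{-r2<..<0}"] by auto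
    \<comment> \<open>If the inner side missed the region as well, the collar, open by invariance of
      domain, would meet the region only in frontier points. But it contains a point of the closure
      of the interior.\<close>
    define N' where "N' = \<Phi> ` (B1 \<times> {-r2<..<r2})"
    have oN: "open N'"
      unfolding N'_def
    proof (rule invariance_of_domain_gen)
      show "continuous_on (B1 \<times> {-r2<..<r2}) \<Phi>" by (rule continuous_on_subset[OF cont]) (use B1 in auto)
      show "inj_on \<Phi> (B1 \<times> {-r2<..<r2})" using inj B1 by (fastforce intro!: inj_onI)
    qed (use dim in \<open>auto simp: B1_def open_Times\<close>)
    have "X x t \<in> N'" unfolding N'_def \<Phi>0[symmetric] using B1 r2 by auto
    moreover have "X x t \<in> closure (interior (\<Omega> t))"
      unfolding reg(2) using reg frontier_subset_closed[OF compact_imp_closed] by blast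
    ultimately obtain y where y: "y \<in> N'" "y \<in> interior (\<Omega> t)"
      using oN by (meson closure_iff_nhds_not_empty disjoint_iff order_refl)
    then obtain p s where ps: "y = \<Phi> (p, s)" "p \<in> B1" "\<bar>s\<bar> < r2" by (auto simp: N'_def)
    have y\<Omega>: "y \<in> \<Omega> t" using y interior_subset by blast
    have "s = 0"
    proof (rule ccontr)
      assume "s \<noteq> 0"
      then have "y \<in> \<Phi> ` (B1 \<times> {0<..<r2}) \<or> y \<in> \<Phi> ` (B1 \<times> {-r2<..<0})" using ps by (cases "0 < s") auto
      then show False using outer inner y\<Omega> by blast
    qed
    have "(p, t) \<in> W" using ps B1 slice B(3) by blast
    then have "y = X (inv_into U \<phi> p) t" using patch_value[OF P _ t, of p] ps \<open>s = 0\<close> by (simp add: \<Phi>)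
    then have "y \<in> frontier (\<Omega> t)" unfolding reg by blast
    then show False using y(2) by (simp add: frontier_def)
  qed
  then have "X x t - s *\<^sub>R n \<in> \<Omega> t" if "0 < s" "s < r2" for s
  proof -
    have "\<Phi> (p0, - s) \<in> \<Phi> ` (B1 \<times> {-r2<..<0})" using B1 that by auto
    then have "\<Phi> (p0, - s) \<in> \<Omega> t" using \<open>\<Phi> ` (B1 \<times> {-r2<..<0}) \<subseteq> \<Omega> t\<close> by blast
    then show ?thesis using \<Phi>0 by (simp add: \<Phi>)
  qed
  then show ?thesis using r2(1) by (auto simp: n_def)
qed

definition two_point :: "real \<Rightarrow> 'm \<Rightarrow> 'm \<Rightarrow> real \<Rightarrow> real" where
  "two_point K x y t = chord_fun K (F x t) (X x t) (X y t) (\<nu> x t)"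

text \<open>Opposite normals mean that the comparison sphere touches the hypersurface at x and at y
  from different sides. The set \<open>Q\<close> bounded by that sphere is connected and misses the
  hypersurface, hence lies on one side of it. For \<epsilon> = 1, however, it contains points of the
  region near x and points outside near y, and for \<epsilon> = -1 the reverse.\<close>

lemma no_opposite_normals:
  assumes t: "t \<in> I" and \<epsilon>: "\<epsilon> = 1 \<or> \<epsilon> = (-1::real)"
    and pos: "\<And>x y. 0 \<le> \<epsilon> * two_point K x y t" and W0: "two_point K x y t = 0"
    and opp: "(K * F x t) *\<^sub>R (X y t - X x t) + \<nu> x t + \<nu> y t = 0"
  shows False
proof -
  define k where "k = K * F x t"
  define d where "d = X y t - X x t"
  define g where "g v = \<epsilon> * (k / 2 * (v \<bullet> v) + v \<bullet> \<nu> x t)" for v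
  define Q where "Q = (\<lambda>v. X x t + v) ` {v. g v < 0}"
  have nn: "\<nu> z t \<bullet> \<nu> z t = 1" for z using norm_normal[OF t, of z] by (simp add: norm_eq_1)
  have gW: "g (X z t - X x t) = \<epsilon> * two_point K x z t" for z
    by (simp add: g_def two_point_def chord_fun_def k_def)
  have \<epsilon>2: "\<epsilon> * \<epsilon> = 1" using \<epsilon> by auto
  have "{v. g v < 0} = {v. \<epsilon> * k / 2 * (v \<bullet> v) + v \<bullet> (\<epsilon> *\<^sub>R \<nu> x t) < 0}"
    by (simp add: g_def algebra_simps)
  then have "connected {v. g v < 0}"
    using connected_quadric_region[of "\<epsilon> * k / 2" "\<epsilon> *\<^sub>R \<nu> x t"] dim by simp
  then have conQ: "connected Q" unfolding Q_def by (intro connected_continuous_image continuous_intros)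
  have reg: "frontier (\<Omega> t) = range (\<lambda>x. X x t)" using region[OF t] by (simp add: compact_region_bounded_by_def)
  have "Q \<inter> frontier (\<Omega> t) = {}"
  proof -
    have "X z t \<notin> Q" for z
    proof
      assume "X z t \<in> Q"
      then have "g (X z t - X x t) < 0" by (auto simp: Q_def)
      then show False using gW pos[of x z] by simp
    qed
    then show ?thesis unfolding reg by auto
  qed
  then have QO: "Q \<subseteq> \<Omega> t \<or> Q \<inter> \<Omega> t = {}" using connected_Int_frontier[OF conQ] by blast
  obtain r1 where r1: "r1 > 0" "\<And>s. 0 < s \<Longrightarrow> s < r1 \<Longrightarrow> \<epsilon> * k / 2 * s\<^sup>2 - s < 0"
    using linear_term_dominates by blast
  have inQ1: "X x t - (s * \<epsilon>) *\<^sub>R \<nu> x t \<in> Q" if "0 < s" "s < r1" for s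
  proof -
    have "g (- (s * \<epsilon>) *\<^sub>R \<nu> x t) = \<epsilon> * (k / 2 * (s\<^sup>2 * (\<epsilon> * \<epsilon>)) - s * \<epsilon>)"
      by (simp add: g_def nn power2_eq_square algebra_simps)
    also have "\<dots> = \<epsilon> * k / 2 * s\<^sup>2 - s * (\<epsilon> * \<epsilon>)" unfolding \<epsilon>2 by (simp add: algebra_simps \<epsilon>2)
    also have "\<dots> < 0" using r1(2)[OF that] by (simp add: \<epsilon>2)
    finally show ?thesis unfolding Q_def by (intro image_eqI[of _ _ "- (s * \<epsilon>) *\<^sub>R \<nu> x t"]) auto
  qed
  have inQ2: "X y t + (s * \<epsilon>) *\<^sub>R \<nu> y t \<in> Q" if "0 < s" "s < r1" for s
  proof -
    have o: "k *\<^sub>R d + \<nu> x t = - \<nu> y t" using opp by (simp add: k_def d_def eq_neg_iff_add_eq_0)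
    have o2: "k * (d \<bullet> \<nu> y t) + \<nu> y t \<bullet> \<nu> x t = - 1"
      using arg_cong[OF o, of "\<lambda>w. w \<bullet> \<nu> y t"] by (simp add: inner_add_left nn inner_commute[of "\<nu> y t"])
    have ge: "g (d + a *\<^sub>R \<nu> y t) = g d + \<epsilon> * (a * (k * (d \<bullet> \<nu> y t) + \<nu> y t \<bullet> \<nu> x t)) + \<epsilon> * k / 2 * (a * a)" for a
      by (simp add: g_def inner_add_left inner_add_right nn inner_commute[of "\<nu> y t" d] algebra_simps)
    have "g d = 0" using gW[of y] W0 by (simp add: d_def)
    then have "g (d + (s * \<epsilon>) *\<^sub>R \<nu> y t) = 0 - s * (\<epsilon> * \<epsilon>) + \<epsilon> * k / 2 * (s\<^sup>2 * (\<epsilon> * \<epsilon>))"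
      unfolding ge[of "s * \<epsilon>"] o2 by (simp add: power2_eq_square algebra_simps)
    also have "\<dots> < 0" using r1(2)[OF that] by (simp add: \<epsilon>2)
    finally show ?thesis unfolding Q_def by (intro image_eqI[of _ _ "d + (s * \<epsilon>) *\<^sub>R \<nu> y t"]) (auto simp: d_def)
  qed
  have out: "\<exists>e>0. \<forall>s. 0 < s \<longrightarrow> s < e \<longrightarrow> X z t + s *\<^sub>R \<nu> z t \<notin> \<Omega> t" for z
    using normal[OF t, of z] unfolding outward_unit_normal_def by blast
  obtain e1 e2 e3 e4 where e: "e1 > 0" "\<And>s. 0 < s \<Longrightarrow> s < e1 \<Longrightarrow> X x t - s *\<^sub>R \<nu> x t \<in> \<Omega> t"
     "e2 > 0" "\<And>s. 0 < s \<Longrightarrow> s < e2 \<Longrightarrow> X y t - s *\<^sub>R \<nu> y t \<in> \<Omega> t"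
     "e3 > 0" "\<And>s. 0 < s \<Longrightarrow> s < e3 \<Longrightarrow> X x t + s *\<^sub>R \<nu> x t \<notin> \<Omega> t"
     "e4 > 0" "\<And>s. 0 < s \<Longrightarrow> s < e4 \<Longrightarrow> X y t + s *\<^sub>R \<nu> y t \<notin> \<Omega> t"
    using inner_side[OF t, of x] inner_side[OF t, of y] out[of x] out[of y] by blast
  define s where "s = Min {r1, e1, e2, e3, e4} / 2"
  have m: "0 < Min {r1, e1, e2, e3, e4}" using r1 e by simp
  have s: "0 < s" "s < r1" "s < e1" "s < e2" "s < e3" "s < e4"
    using m unfolding s_def by (auto simp: min_def)
  from \<epsilon> show False
  proof
    assume "\<epsilon> = 1"
    then show False using inQ1[OF s(1,2)] inQ2[OF s(1,2)] e(2)[OF s(1,3)] e(8)[OF s(1,6)] QO by auto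
  next
    assume "\<epsilon> = -1"
    then show False using inQ1[OF s(1,2)] inQ2[OF s(1,2)] e(6)[OF s(1,5)] e(4)[OF s(1,4)] QO by auto
  qed
qed

lemma tendsto_two_point:
  assumes "t \<in> I" "S \<subseteq> I"
  shows "((\<lambda>z. two_point K (fst z) (fst (snd z)) (snd (snd z))) \<longlongrightarrow> two_point K x y t) (near2 x y t S)"
  unfolding two_point_def chord_fun_def by (intro tendsto_intros tendsto_flow2[OF assms])

text \<open>Quantitative form of \<open>no_opposite_normals\<close>, by compactness. The number
  \<open>m\<close> is at once the tolerance for the sign of W, the tolerance for its vanishing and
  the lower bound, so the claim becomes weaker as \<open>m\<close> shrinks.\<close>

lemma normals_not_opposite:
  assumes ab: "a \<in> I" "b \<in> I" and \<epsilon>: "\<epsilon> = 1 \<or> \<epsilon> = (-1::real)"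
  shows "\<exists>m>0. \<forall>t\<in>{a..b}. \<forall>x y. (\<forall>x' y'. - m \<le> \<epsilon> * two_point K x' y' t) \<longrightarrow> \<bar>two_point K x y t\<bar> \<le> m \<longrightarrow>
     m < norm ((K * F x t) *\<^sub>R (X y t - X x t) + \<nu> x t + \<nu> y t)"
proof -
  let ?K = "UNIV \<times> UNIV \<times> {a..b} :: ('m \<times> 'm \<times> real) set"
  define V where "V z = norm ((K * F (fst z) (snd (snd z))) *\<^sub>R (X (fst (snd z)) (snd (snd z)) - X (fst z) (snd (snd z)))
     + \<nu> (fst z) (snd (snd z)) + \<nu> (fst (snd z)) (snd (snd z)))" for z
  define w where "w z = two_point K (fst z) (fst (snd z)) (snd (snd z))" for z
  let ?P = "\<lambda>m z. (\<forall>x' y'. - m \<le> \<epsilon> * two_point K x' y' (snd (snd z))) \<longrightarrow> \<bar>w z\<bar> \<le> m \<longrightarrow> m < V z"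
  have sub: "{a..b} \<subseteq> I" by (rule I_convex[OF ab])
  have "\<exists>m>0. \<forall>z\<in>?K. ?P m z"
  proof (rule compact_uniform)
    show "compact ?K" by (intro compact_Times compact_M compact_Icc)
    show "?P m' z" if "?P m z" "0 < m'" "m' \<le> m" for z m m'
    proof (intro impI)
      assume a1: "\<forall>x' y'. - m' \<le> \<epsilon> * two_point K x' y' (snd (snd z))" and a2: "\<bar>w z\<bar> \<le> m'"
      have "- m \<le> \<epsilon> * two_point K x' y' (snd (snd z))" for x' y' using a1[rule_format, of x' y'] that(3) by linarith
      moreover have "\<bar>w z\<bar> \<le> m" using a2 that(3) by linarith
      ultimately have "m < V z" using that(1) by blast
      then show "m' < V z" using that(3) by linarith
    qed
    fix z assume "z \<in> ?K"
    then obtain x0 y0 s0 where z: "z = (x0, y0, s0)" and s0: "s0 \<in> {a..b}" by auto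
    have s0I: "s0 \<in> I" using s0 sub by blast
    have lw: "(w \<longlongrightarrow> two_point K x y s0) (near2 x y s0 {a..b})" for x y unfolding w_def by (rule tendsto_two_point[OF s0I sub])
    have lV: "(V \<longlongrightarrow> norm ((K * F x0 s0) *\<^sub>R (X y0 s0 - X x0 s0) + \<nu> x0 s0 + \<nu> y0 s0)) (near2 x0 y0 s0 {a..b})"
      unfolding V_def by (intro tendsto_intros tendsto_flow2[OF s0I sub])
    have "\<exists>m>0. \<forall>\<^sub>F z in near2 x0 y0 s0 {a..b}. ?P m z"
    proof (cases "two_point K x0 y0 s0 = 0")
      case False
      define m where "m = \<bar>two_point K x0 y0 s0\<bar> / 2"
      have "\<forall>\<^sub>F z in near2 x0 y0 s0 {a..b}. m < \<bar>w z\<bar>"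
        by (rule order_tendstoD(1)[OF tendsto_rabs[OF lw]]) (use False in \<open>simp add: m_def\<close>)
      then show ?thesis using False by (intro exI[of _ m]) (auto simp: m_def elim: eventually_mono)
    next
      case W0: True
      show ?thesis
      proof (cases "(K * F x0 s0) *\<^sub>R (X y0 s0 - X x0 s0) + \<nu> x0 s0 + \<nu> y0 s0 = 0")
        case False
        define m where "m = norm ((K * F x0 s0) *\<^sub>R (X y0 s0 - X x0 s0) + \<nu> x0 s0 + \<nu> y0 s0) / 2"
        have "\<forall>\<^sub>F z in near2 x0 y0 s0 {a..b}. m < V z"
          by (rule order_tendstoD(1)[OF lV]) (use False in \<open>simp add: m_def\<close>)
        then show ?thesis using False by (intro exI[of _ m]) (auto simp: m_def elim: eventually_mono)
      next
        \<comment> \<open>W and the sum both vanish, so the sign hypothesis itself must fail at some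
          pair (x1, y1). It then fails by the margin \<open>m\<close> at all nearby times, whatever
          pair is considered.\<close>
        case True
        then obtain x1 y1 where neg: "\<epsilon> * two_point K x1 y1 s0 < 0"
          using no_opposite_normals[OF s0I \<epsilon> _ W0 True] not_le by blast
        define m where "m = - (\<epsilon> * two_point K x1 y1 s0) / 2"
        have m: "0 < m" using neg by (simp add: m_def)
        have "((\<lambda>z. \<epsilon> * w z) \<longlongrightarrow> \<epsilon> * two_point K x1 y1 s0) (near2 x1 y1 s0 {a..b})" by (intro tendsto_intros lw)
        then have ev: "\<forall>\<^sub>F z in near2 x1 y1 s0 {a..b}. \<epsilon> * w z < - m"
          by (rule order_tendstoD(2)) (use m in \<open>simp add: m_def\<close>)
        have "filterlim (\<lambda>z. (x1, y1, snd (snd z))) (near2 x1 y1 s0 {a..b}) (near2 x0 y0 s0 {a..b})"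
        proof -
          have id: "((\<lambda>z. z) \<longlongrightarrow> (x0, y0, s0)) (near2 x0 y0 s0 {a..b})"
            by (rule tendsto_mono[OF inf_le1]) (rule filterlim_ident)
          have "((\<lambda>z. (x1, y1, snd (snd z))) \<longlongrightarrow> (x1, y1, snd (snd (x0, y0, s0)))) (near2 x0 y0 s0 {a..b})"
            by (intro tendsto_Pair tendsto_const tendsto_snd id)
          moreover have "\<forall>\<^sub>F z in near2 x0 y0 s0 {a..b}. (x1, y1, snd (snd z)) \<in> ?K"
            unfolding eventually_inf_principal by (rule always_eventually) auto
          ultimately show ?thesis by (simp add: filterlim_inf filterlim_principal)
        qed
        from filterlim_iff[THEN iffD1, OF this, rule_format, OF ev]
        have "\<forall>\<^sub>F z in near2 x0 y0 s0 {a..b}. \<epsilon> * two_point K x1 y1 (snd (snd z)) < - m" by (simp add: w_def)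
        then have "\<forall>\<^sub>F z in near2 x0 y0 s0 {a..b}. ?P m z" by eventually_elim (metis not_le)
        then show ?thesis using m by blast
      qed
    qed
    then show "\<exists>m>0. \<forall>\<^sub>F z' in inf (nhds z) (principal ?K). ?P m z'" by (simp add: z)
  qed
  then obtain m where m: "m > 0" "\<And>z. z \<in> ?K \<Longrightarrow> ?P m z" by blast
  show ?thesis
  proof (intro exI[of _ m] conjI ballI allI m(1))
    fix t x y assume "t \<in> {a..b}"
    then show "(\<forall>x' y'. - m \<le> \<epsilon> * two_point K x' y' t) \<longrightarrow> \<bar>two_point K x y t\<bar> \<le> m \<longrightarrow>
      m < norm ((K * F x t) *\<^sub>R (X y t - X x t) + \<nu> x t + \<nu> y t)"
      using m(2)[of "(x, y, t)"] by (simp add: w_def V_def)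
  qed
qed

end

section \<open>Preservation of the sign of the two-point function\<close>

context curvature_flow
begin

text \<open>The weights are frozen at one curvature vector \<open>z\<close> while the point of the
  patch is arbitrary. The same weights, those of the touching point x, thus serve the patches around
  x and around y.\<close>

lemma patch_jensen:
  fixes w :: "'n \<Rightarrow> real^'n"
  assumes \<epsilon>: "curv_sign \<epsilon>" and z: "z \<in> \<Gamma>"
    and P: "patch U \<phi> W Y" and pt: "(p, t) \<in> W" and t: "t \<in> I"
    and w: "\<And>i j. dd (w i, 0) Y (p, t) \<bullet> dd (w j, 0) Y (p, t) = (if i = j then 1 else 0)"
  shows "\<epsilon> * F (inv_into U \<phi> p) t \<le> \<epsilon> * (\<Sum>i\<in>UNIV. gradient f z i *
     - (dd (w i, 0) (dd (w i, 0) Y) (p, t) \<bullet> \<nu> (inv_into U \<phi> p) t))"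
proof -
  interpret smooth_patch W Y by (rule patch_smooth[OF P])
  let ?x = "inv_into U \<phi> p"
  obtain u :: "'n \<Rightarrow> real^'n" where u: "\<And>i j. D (u i) (p, t) \<bullet> D (u j) (p, t) = (if i = j then 1 else 0)"
     "\<And>i v. - (HH (u i) v (p, t) \<bullet> \<nu> ?x t) = \<kappa> ?x t $ i * (D (u i) (p, t) \<bullet> D v (p, t))"
    using patch_eigenframe[OF P pt t refl] by metis
  have card: "CARD('n) = DIM(real^'n)" by simp
  have lin: "linear (\<lambda>u. - (HH u v (p, t) \<bullet> \<nu> ?x t))" for v
    by (intro linearI) (simp_all add: linear_add[OF linear_HH[OF pt]] linear_scale[OF linear_HH[OF pt]] inner_add_left)
  define S where "S i j = (D (w i) (p, t) \<bullet> D (u j) (p, t))\<^sup>2" for i j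
  have "- (HH (w i) (w i) (p, t) \<bullet> \<nu> ?x t) = (\<Sum>j\<in>UNIV. S i j * \<kappa> ?x t $ j)" for i
    unfolding S_def by (rule frame_diagonal[OF linear_D[OF pt] card u(1) lin u(2)])
  moreover have "\<epsilon> * f (\<kappa> ?x t) \<le> \<epsilon> * (\<Sum>i\<in>UNIV. gradient f z i * (\<Sum>j\<in>UNIV. S i j * \<kappa> ?x t $ j))"
  proof (rule supporting_gradient_stochastic[OF \<epsilon> z in_cone[OF t]])
    show "(\<Sum>j\<in>UNIV. S i j) = 1" for i
      unfolding S_def by (rule orthonormal_frame_stochastic[OF linear_D[OF pt] card u(1) w])
    show "(\<Sum>i\<in>UNIV. S i j) = 1" for j
      unfolding S_def inner_commute[of "D (w _) (p, t)"]
      by (rule orthonormal_frame_stochastic[OF linear_D[OF pt] card w u(1)])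
  qed (simp add: S_def)
  ultimately show ?thesis by (simp only: F_eq[OF t])
qed

lemma two_point_left_limit:
  assumes ab: "a \<in> I" "b \<in> I" and t: "a < t" "t \<le> b"
  shows "((\<lambda>s. two_point K x y s) \<longlongrightarrow> two_point K x y t) (at_left t)"
proof -
  have sub: "{a..b} \<subseteq> I" by (rule I_convex[OF ab])
  have "((\<lambda>s. (x, y, s)) \<longlongrightarrow> (x, y, t)) (at_left t)" by (intro tendsto_intros)
  moreover have "\<forall>\<^sub>F s in at_left t. (x, y, s) \<in> UNIV \<times> UNIV \<times> {a..b}"
    using t by (auto simp: eventually_at_left_field intro!: exI[of _ a])
  ultimately have "filterlim (\<lambda>s. (x, y, s)) (near2 x y t {a..b}) (at_left t)"
    by (simp add: filterlim_inf filterlim_principal)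
  moreover have "t \<in> I" using t sub by auto
  ultimately show ?thesis using filterlim_compose[OF tendsto_two_point[OF _ sub]] by fastforce
qed

text \<open>The first-touching argument for one fixed \<open>K\<close> of any sign. If the
  inequality were lost at time \<open>b\<close>, the barrier \<theta> would be met at a first time t
  > a by some pair, contrary to \<open>no_touching\<close>.\<close>

lemma two_point_preserved:
  assumes ab: "a \<in> I" "b \<in> I" "a \<le> b" and sgn: "curv_sign \<epsilon>"
    and init: "\<And>x y. 0 \<le> \<epsilon> * two_point K x y a"
  shows "0 \<le> \<epsilon> * two_point K x y b"
proof (rule ccontr)
  assume "\<not> ?thesis"
  then have bad: "\<epsilon> * two_point K x y b < 0" by simp
  have \<epsilon>: "\<epsilon> = 1 \<or> \<epsilon> = -1" using sgn by (auto simp: curv_sign_def)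
  have sub: "{a..b} \<subseteq> I" by (rule I_convex[OF ab(1,2)])
  obtain C0 where C0: "C0 > 0" "\<And>t x y. t \<in> {a..b} \<Longrightarrow> \<bar>(X y t - X x t) \<bullet> \<nu> x t\<bar> \<le> C0 * (norm (X y t - X x t))\<^sup>2"
    using quadratic_bound[OF ab(1,2)] by blast
  obtain m0 where m0: "m0 > 0" "\<And>t x. t \<in> {a..b} \<Longrightarrow> m0 \<le> F x t \<and> F x t \<le> 1 / m0"
    using speed_bounds[OF ab(1,2)] by blast
  obtain B where B: "B > 0" "\<And>t x. t \<in> {a..b} \<Longrightarrow> (\<Sum>i\<in>UNIV. \<bar>\<kappa> x t $ i\<bar>) + (\<Sum>i\<in>UNIV. \<bar>gradient f (\<kappa> x t) i\<bar>) \<le> B"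
    using curvature_bound[OF ab(1,2)] by blast
  obtain m1 where m1: "m1 > 0" "\<And>t x y. t \<in> {a..b} \<Longrightarrow> (\<And>x' y'. - m1 \<le> \<epsilon> * two_point K x' y' t) \<Longrightarrow> \<bar>two_point K x y t\<bar> \<le> m1 \<Longrightarrow>
     m1 < norm ((K * F x t) *\<^sub>R (X y t - X x t) + \<nu> x t + \<nu> y t)"
    using normals_not_opposite[OF ab(1,2) \<epsilon>, of K] by blast
  define km where "km = \<bar>K\<bar> / m0"
  have km: "0 \<le> km" using m0 by (simp add: km_def)
  have kb: "\<bar>K * F x t\<bar> \<le> km" if "t \<in> {a..b}" for x t
  proof -
    have "\<bar>K\<bar> * \<bar>F x t\<bar> \<le> \<bar>K\<bar> * (1 / m0)" using m0(2)[OF that, of x] m0(1) by (intro mult_left_mono) auto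
    then show ?thesis by (simp add: km_def abs_mult)
  qed
  \<comment> \<open>Bounds |W| / |d|^2 by its two terms. At a touching pair |W| = \<theta> > 0, so
    touching cannot occur on the diagonal and \<theta> <= C |d|^2.\<close>
  define C where "C = km / 2 + C0"
  have C: "0 < C" using km C0 by (simp add: C_def)
  have Wb: "\<bar>two_point K x y t\<bar> \<le> C * (norm (X y t - X x t))\<^sup>2" if "t \<in> {a..b}" for x y t
  proof -
    have "two_point K x y t = K * F x t / 2 * (norm (X y t - X x t))\<^sup>2 + (X y t - X x t) \<bullet> \<nu> x t"
      by (simp add: two_point_def chord_fun_def power2_norm_eq_inner)
    also have "\<bar>\<dots>\<bar> \<le> \<bar>K * F x t / 2 * (norm (X y t - X x t))\<^sup>2\<bar> + \<bar>(X y t - X x t) \<bullet> \<nu> x t\<bar>" by (rule abs_triangle_ineq)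
    also have "\<bar>K * F x t / 2 * (norm (X y t - X x t))\<^sup>2\<bar> = \<bar>K * F x t\<bar> / 2 * (norm (X y t - X x t))\<^sup>2"
      by (simp add: abs_mult)
    also have "\<dots> \<le> km / 2 * (norm (X y t - X x t))\<^sup>2" using kb[OF that, of x] by (intro mult_right_mono) auto
    finally show ?thesis using C0(2)[OF that, of y x] by (simp add: C_def distrib_right)
  qed
  define nn where "nn = real CARD('n)"
  \<comment> \<open>A crude bound for the sum compared with \<open>L\<close> in
    \<open>no_touching\<close>: every weight and every |\<kappa>| is at most \<open>B\<close>, |K F|
    is at most \<open>km\<close>, there are \<open>nn\<close> summands, and the 1 makes it
    strict.\<close>
  define L where "L = nn * (B * B\<^sup>2) + 64 * C * (nn * (B * (km + B))) + 1"
  have L0: "0 < L" unfolding L_def nn_def using B(1) C km by (intro add_nonneg_pos add_nonneg_nonneg mult_nonneg_nonneg) auto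
  define E where "E = exp (L * (b - a))"
  have E: "E > 0" by (simp add: E_def)
  \<comment> \<open>The largest value of \<theta> on the interval. The five entries secure, in this
    order, the use of \<open>m1\<close>, the assumptions \<open>side\<close> and
    \<open>small\<close> of \<open>no_touching\<close>, the bound
    \<open>12 * C * \<theta> t \<le> 1\<close>, and the failure of the barrier at time
    \<open>b\<close>. The 1 added to \<open>2 * km\<close> avoids division by zero.\<close>
  define M where "M = Min {m1, m1 / (2 * km + 1), (3 / 4) / (2 * km + 1), 1 / (12 * C), - (\<epsilon> * two_point K x y b) / 2}"
  have M: "0 < M" "M \<le> m1" "M \<le> m1 / (2 * km + 1)" "M \<le> (3 / 4) / (2 * km + 1)" "M \<le> 1 / (12 * C)" "M \<le> - (\<epsilon> * two_point K x y b) / 2"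
    unfolding M_def using m1(1) km C bad by (simp_all add: divide_pos_pos add_nonneg_pos)
  have km1: "0 < 2 * km + 1" using km by simp
  have M2: "2 * km * M + M \<le> m1" "2 * km * M + M \<le> 3 / 4" "12 * C * M \<le> 1"
    using M(3,4,5) km1 C by (simp_all add: pos_le_divide_eq algebra_simps)
  define \<theta> where "\<theta> t = M / E * exp (L * (t - a))" for t
  have \<theta>pos: "0 < \<theta> t" for t using M E by (simp add: \<theta>_def)
  have \<theta>M: "\<theta> t \<le> M" if "t \<le> b" for t
  proof -
    have "exp (L * (t - a)) \<le> E" unfolding E_def using L0 that by (simp add: mult_left_mono)
    then have "M / E * exp (L * (t - a)) \<le> M / E * E" using M E by (intro mult_left_mono) auto
    then show ?thesis using E by (simp add: \<theta>_def)
  qed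
  have d\<theta>: "(\<theta> has_real_derivative L * \<theta> t) (at t)" for t
    unfolding \<theta>_def using less_imp_neq[OF E] by (auto intro!: derivative_eq_intros)
  have \<theta>b: "\<theta> b = M" unfolding \<theta>_def E_def[symmetric] using less_imp_neq[OF E] by simp
  let ?K = "UNIV \<times> UNIV \<times> {a..b} :: ('m \<times> 'm \<times> real) set"
  let ?g = "\<lambda>z. \<epsilon> * two_point K (fst z) (fst (snd z)) (snd (snd z)) + \<theta> (snd (snd z))"
  have compK: "compact ?K" by (intro compact_Times compact_M compact_Icc)
  have contg: "continuous_on ?K ?g"
    unfolding continuous_on_def
  proof
    fix z assume "z \<in> ?K"
    then obtain x' y' s where z: "z = (x', y', s)" and s: "s \<in> {a..b}" by auto
    have "(?g \<longlongrightarrow> ?g z) (near2 x' y' s {a..b})"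
    proof (intro tendsto_add tendsto_mult tendsto_const)
      show "((\<lambda>z. two_point K (fst z) (fst (snd z)) (snd (snd z))) \<longlongrightarrow> two_point K (fst z) (fst (snd z)) (snd (snd z))) (near2 x' y' s {a..b})"
        unfolding z fst_conv snd_conv by (rule tendsto_two_point) (use s sub in auto)
      have "isCont \<theta> s" using d\<theta> DERIV_isCont by blast
      moreover have "((\<lambda>z. snd (snd z)) \<longlongrightarrow> snd (snd (x', y', s))) (near2 x' y' s {a..b})"
        by (intro tendsto_snd tendsto_mono[OF inf_le1]) (rule filterlim_ident)
      ultimately show "((\<lambda>z. \<theta> (snd (snd z))) \<longlongrightarrow> \<theta> (snd (snd z))) (near2 x' y' s {a..b})"
        unfolding z using isCont_tendsto_compose[of s \<theta>] by simp
    qed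
    then show "(?g \<longlongrightarrow> ?g z) (at z within ?K)"
      by (rule tendsto_mono[rotated]) (unfold z at_within_def, intro inf_mono order_refl principal_le_iff[THEN iffD2], auto)
  qed
  \<comment> \<open>The compact set of triples at which the barrier is met or crossed; minimising
    the time over it gives the first touching time.\<close>
  define Z where "Z = ?g -` {..0} \<inter> ?K"
  have "closed Z"
    unfolding Z_def using contg continuous_on_closed_vimage[OF compact_imp_closed[OF compK]] by blast
  then have "compact (?K \<inter> Z)" by (rule compact_Int_closed[OF compK])
  moreover have "?K \<inter> Z = Z" unfolding Z_def by blast
  ultimately have compZ: "compact Z" by simp
  have "(x, y, b) \<in> Z" using M(1,6) \<theta>b ab(3) bad by (simp add: Z_def)
  then have "Z \<noteq> {}" by blast
  moreover have "continuous_on Z (\<lambda>z. snd (snd z))" by (intro continuous_intros)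
  ultimately obtain z where z: "z \<in> Z" "\<And>z'. z' \<in> Z \<Longrightarrow> snd (snd z) \<le> snd (snd z')"
    using continuous_attains_inf[OF compZ] by blast
  obtain x1 y1 t where z1: "z = (x1, y1, t)" by (cases z) auto
  have t: "t \<in> {a..b}" and le0: "\<epsilon> * two_point K x1 y1 t + \<theta> t \<le> 0" using z(1) by (auto simp: Z_def z1)
  have tI: "t \<in> I" using t sub by blast
  have earlier: "0 < \<epsilon> * two_point K x' y' s + \<theta> s" if "a \<le> s" "s < t" for x' y' s
  proof (rule ccontr)
    assume "\<not> ?thesis"
    then have "(x', y', s) \<in> Z" using that t by (simp add: Z_def)
    then show False using z(2)[of "(x', y', s)"] that by (simp add: z1)
  qed
  have ta: "a < t"
  proof (rule ccontr)
    assume "\<not> a < t"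
    then have "t = a" using t by simp
    then show False using le0 init[of x1 y1] \<theta>pos[of a] by simp
  qed
  have evs: "\<forall>\<^sub>F s in at_left t. a < s \<and> s < t" using ta by (auto simp: eventually_at_left_field intro!: exI[of _ a])
  \<comment> \<open>A limit from earlier times shows that no pair has crossed the barrier at time
    \<open>t\<close> itself; hence equality at (x1, y1), which is therefore a spatial
    minimum.\<close>
  have ge0: "0 \<le> \<epsilon> * two_point K x' y' t + \<theta> t" for x' y'
  proof (rule tendsto_lowerbound)
    have "(\<theta> \<longlongrightarrow> \<theta> t) (at_left t)"
      using DERIV_isCont[OF d\<theta>, of t] by (simp add: isCont_def filterlim_at_split)
    then show "((\<lambda>s. \<epsilon> * two_point K x' y' s + \<theta> s) \<longlongrightarrow> \<epsilon> * two_point K x' y' t + \<theta> t) (at_left t)"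
      using two_point_left_limit[OF ab(1,2) ta] t by (intro tendsto_intros) auto
    show "\<forall>\<^sub>F s in at_left t. 0 \<le> \<epsilon> * two_point K x' y' s + \<theta> s"
      using evs by eventually_elim (use earlier less_imp_le in blast)
  qed simp
  have eq: "\<epsilon> * two_point K x1 y1 t = - \<theta> t" using le0 ge0[of x1 y1] by linarith
  have tpos: "0 < t" using ta ab(1) by (auto simp: time_interval_def)
  obtain U \<phi> W' Y where P': "patch U \<phi> W' Y" and x1: "x1 \<in> U" "(\<phi> x1, t) \<in> W'" using patch_exists[OF tI] .
  obtain V \<psi> V' Y2 where Q': "patch V \<psi> V' Y2" and y1: "y1 \<in> V" "(\<psi> y1, t) \<in> V'" using patch_exists[OF tI] .
  \<comment> \<open>The patches are cut down to positive times, which is possible as t > a >= 0, so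
    that \<open>patch_flow\<close> applies.\<close>
  define W where "W = W' \<inter> UNIV \<times> (I \<inter> {0<..})"
  define W3 where "W3 = V' \<inter> UNIV \<times> (I \<inter> {0<..})"
  have P: "patch U \<phi> W Y" unfolding W_def
    by (rule patch_subset[OF P']) (use P' open_I_pos in \<open>auto simp: patch_def intro!: open_Int open_Times\<close>)
  have Q: "patch V \<psi> W3 Y2" unfolding W3_def
    by (rule patch_subset[OF Q']) (use Q' open_I_pos in \<open>auto simp: patch_def intro!: open_Int open_Times\<close>)
  define p where "p = \<phi> x1"
  define q where "q = \<psi> y1"
  have pW: "(p, t) \<in> W" and qW: "(q, t) \<in> W3" using x1 y1 tI tpos by (auto simp: W_def W3_def p_def q_def)
  have UA: "(U, \<phi>) \<in> A" "(V, \<psi>) \<in> A" using P Q by (auto simp: patch_def)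
  have ip: "inv_into U \<phi> p = x1" and iq: "inv_into V \<psi> q = y1"
    using chart_facts(4)[OF UA(1) x1(1)] chart_facts(4)[OF UA(2) y1(1)] by (simp_all add: p_def q_def)
  define N where "N z = \<nu> (inv_into U \<phi> (fst z)) (snd z)" for z
  define G where "G z = F (inv_into U \<phi> (fst z)) (snd z)" for z
  define N3 where "N3 z = \<nu> (inv_into V \<psi> (fst z)) (snd z)" for z
  define G3 where "G3 z = F (inv_into V \<psi> (fst z)) (snd z)" for z
  interpret two: two_patches W Y N G W3 Y2 N3 G3
    unfolding two_patches_def N_def G_def N3_def G3_def
    by (intro conjI patch_flow[OF P] patch_flow[OF Q]) (auto simp: W_def W3_def)
  have tW: "s \<in> I" if "(p', s) \<in> W" for p' s using that by (auto simp: W_def)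
  have tW3: "s \<in> I" if "(p', s) \<in> W3" for p' s using that by (auto simp: W3_def)
  have val: "chord_fun K (G (p', s)) (Y (p', s)) (Y2 (q', s)) (N (p', s)) = two_point K (inv_into U \<phi> p') (inv_into V \<psi> q') s"
    if "(p', s) \<in> W" "(q', s) \<in> W3" for p' q' s
    unfolding two_point_def G_def N_def using patch_value[OF P that(1) tW[OF that(1)]] patch_value[OF Q that(2) tW3[OF that(2)]] by simp
  obtain u :: "'n \<Rightarrow> real^'n" where u: "\<And>i j. two.P.D (u i) (p, t) \<bullet> two.P.D (u j) (p, t) = (if i = j then 1 else 0)"
     "\<And>i v. - (two.P.HH (u i) v (p, t) \<bullet> \<nu> x1 t) = \<kappa> x1 t $ i * (two.P.D (u i) (p, t) \<bullet> two.P.D v (p, t))"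
    using patch_eigenframe[OF P pW tI ip[symmetric]] by metis
  let ?a = "gradient f (\<kappa> x1 t)"
  have a0: "0 \<le> ?a i" for i by (rule gradient_nonneg[OF in_cone[OF tI]])
  have Gp: "G (p, t) = F x1 t" and Np: "N (p, t) = \<nu> x1 t" and N3q: "N3 (q, t) = \<nu> y1 t" by (simp_all add: G_def N_def N3_def ip iq)
  have Yp: "Y (p, t) = X x1 t" and Yq: "Y2 (q, t) = X y1 t" using patch_value[OF P pW tI] patch_value[OF Q qW tI] by (simp_all add: ip iq)
  have \<theta>t: "\<theta> t \<le> M" using \<theta>M t by simp
  have kth: "2 * \<bar>K * F x1 t\<bar> * \<theta> t \<le> 2 * km * M"
    using kb[OF t, of x1] \<theta>t \<theta>pos[of t] km by (intro mult_mono) auto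
  have absW: "\<bar>two_point K x1 y1 t\<bar> = \<theta> t" using eq \<epsilon> \<theta>pos[of t] by auto
  show False
  proof (rule two.no_touching[where p=p and q=q and t=t and u=u and a="?a" and \<kappa>="\<lambda>i. \<kappa> x1 t $ i" and \<epsilon>=\<epsilon> and \<theta>=\<theta> and K=K and L=L and C=C])
    show "CARD('n) = DIM(real^'n)" by simp
    show "two.P.h (u i) v (p, t) = \<kappa> x1 t $ i * (two.P.D (u i) (p, t) \<bullet> two.P.D v (p, t))" for i v
      unfolding two.P.h_def Np by (rule u(2))
    show "(\<Sum>i\<in>UNIV. ?a i * \<kappa> x1 t $ i) = G (p, t)" unfolding Gp F_eq[OF tI] by (rule euler[OF in_cone[OF tI]])
    show "\<epsilon> * G z \<le> \<epsilon> * (\<Sum>i\<in>UNIV. ?a i * two.P.h (w i) (w i) z)"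
      if "z \<in> W" "\<And>i j. two.P.D (w i) z \<bullet> two.P.D (w j) z = (if i = j then 1 else 0)" for z and w :: "'n \<Rightarrow> real^'n"
    proof -
      obtain p' s where zz: "z = (p', s)" by (cases z)
      show ?thesis
        using patch_jensen[OF sgn in_cone[OF tI] P that(1)[unfolded zz] tW[OF that(1)[unfolded zz]] that(2)[unfolded zz]]
        by (simp only: zz G_def N_def two.P.h_def fst_conv snd_conv)
    qed
    show "\<epsilon> * G3 z \<le> \<epsilon> * (\<Sum>i\<in>UNIV. ?a i * two.Q.h (w i) (w i) z)"
      if "z \<in> W3" "\<And>i j. two.Q.D (w i) z \<bullet> two.Q.D (w j) z = (if i = j then 1 else 0)" for z and w :: "'n \<Rightarrow> real^'n"
    proof -
      obtain p' s where zz: "z = (p', s)" by (cases z)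
      show ?thesis
        using patch_jensen[OF sgn in_cone[OF tI] Q that(1)[unfolded zz] tW3[OF that(1)[unfolded zz]] that(2)[unfolded zz]]
        by (simp only: zz G3_def N3_def two.Q.h_def fst_conv snd_conv)
    qed
    show "chord_fun K (G (p, t)) (Y (p, t)) (Y2 (q, t)) (N (p, t)) = - \<epsilon> * \<theta> t"
      unfolding val[OF pW qW] ip iq using eq \<epsilon> by auto
    show "- \<theta> t \<le> \<epsilon> * chord_fun K (G (p', t)) (Y (p', t)) (Y2 (q', t)) (N (p', t))" if "(p', t) \<in> W" "(q', t) \<in> W3" for p' q'
      unfolding val[OF that] using ge0[of "inv_into U \<phi> p'" "inv_into V \<psi> q'"] by linarith
    show "\<forall>\<^sub>F s in at_left t. - \<theta> s \<le> \<epsilon> * chord_fun K (G (p, s)) (Y (p, s)) (Y2 (q, s)) (N (p, s))"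
    proof -
      have "((\<lambda>s. (p, s)) \<longlongrightarrow> (p, t)) (at_left t)" "((\<lambda>s. (q, s)) \<longlongrightarrow> (q, t)) (at_left t)" by (intro tendsto_intros)+
      then have "\<forall>\<^sub>F s in at_left t. (p, s) \<in> W" "\<forall>\<^sub>F s in at_left t. (q, s) \<in> W3"
        using topological_tendstoD[OF _ two.P.open_W pW] topological_tendstoD[OF _ two.Q.open_W qW] by blast+
      with evs show ?thesis
      proof eventually_elim
        case (elim s)
        show ?case unfolding val[OF elim(2,3)] ip iq using earlier[of s x1 y1] elim(1) by auto
      qed
    qed
    show "2 * \<bar>K * G (p, t)\<bar> * \<theta> t < norm ((K * G (p, t)) *\<^sub>R (Y2 (q, t) - Y (p, t)) + N (p, t) + N3 (q, t))"
      unfolding Gp Np N3q Yp Yq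
    proof (rule le_less_trans)
      show "2 * \<bar>K * F x1 t\<bar> * \<theta> t \<le> m1" using kth M2(1) M(1) by linarith
      show "m1 < norm ((K * F x1 t) *\<^sub>R (X y1 t - X x1 t) + \<nu> x1 t + \<nu> y1 t)"
      proof (rule m1(2)[OF t])
        show "- m1 \<le> \<epsilon> * two_point K x' y' t" for x' y' using ge0[of x' y'] \<theta>t M(2) by linarith
        show "\<bar>two_point K x1 y1 t\<bar> \<le> m1" using absW \<theta>t M(2) by linarith
      qed
    qed
    show "2 * \<bar>K * G (p, t)\<bar> * \<theta> t \<le> 3 / 4" unfolding Gp using kth M2(2) M(1) by linarith
    show "\<theta> t \<le> C * (norm (Y2 (q, t) - Y (p, t)))\<^sup>2" unfolding Yp Yq absW[symmetric] by (rule Wb[OF t])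
    show "12 * C * \<theta> t \<le> 1"
    proof -
      have "12 * C * \<theta> t \<le> 12 * C * M" using \<theta>t C by (intro mult_left_mono) auto
      then show ?thesis using M2(3) by linarith
    qed
    show "(\<Sum>i\<in>UNIV. ?a i * (\<kappa> x1 t $ i)\<^sup>2) + 64 * C * (\<Sum>i\<in>UNIV. ?a i * \<bar>K * G (p, t) - \<kappa> x1 t $ i\<bar>) < L"
    proof -
      have s0: "0 \<le> (\<Sum>i\<in>UNIV. \<bar>\<kappa> x1 t $ i\<bar>)" "0 \<le> (\<Sum>i\<in>UNIV. \<bar>?a i\<bar>)" by (auto intro!: sum_nonneg)
      have ki: "\<bar>\<kappa> x1 t $ i\<bar> \<le> B" for i
        by (rule order_trans[OF add_increasing2[OF s0(2) member_le_sum] B(2)[OF t]]) auto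
      have ai: "?a i \<le> B" for i
        by (rule order_trans[OF abs_ge_self order_trans[OF add_increasing[OF s0(1) member_le_sum] B(2)[OF t]]]) auto
      have "?a i * (\<kappa> x1 t $ i)\<^sup>2 \<le> B * B\<^sup>2" for i
        using power_mono[OF ki[of i], of 2] ai[of i] a0[of i] B(1) by (intro mult_mono) auto
      then have 1: "(\<Sum>i\<in>UNIV. ?a i * (\<kappa> x1 t $ i)\<^sup>2) \<le> nn * (B * B\<^sup>2)"
        unfolding nn_def by (intro sum_bounded_above) auto
      have "?a i * \<bar>K * G (p, t) - \<kappa> x1 t $ i\<bar> \<le> B * (km + B)" for i
        using kb[OF t, of x1] ki[of i] ai[of i] a0[of i] B(1) km unfolding Gp by (intro mult_mono) auto
      then have "(\<Sum>i\<in>UNIV. ?a i * \<bar>K * G (p, t) - \<kappa> x1 t $ i\<bar>) \<le> nn * (B * (km + B))"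
        unfolding nn_def by (intro sum_bounded_above) auto
      then have "64 * C * (\<Sum>i\<in>UNIV. ?a i * \<bar>K * G (p, t) - \<kappa> x1 t $ i\<bar>) \<le> 64 * C * (nn * (B * (km + B)))"
        using C by (intro mult_left_mono) auto
      then show ?thesis using 1 unfolding L_def by linarith
    qed
  qed (use pW qW u a0 \<epsilon> \<theta>pos d\<theta> C in auto)
qed

section \<open>From the two-point function to the sphere curvatures\<close>

lemma other_point: "\<exists>y. y \<noteq> (x :: 'm)"
proof -
  have "x \<in> (\<Union>(U, \<phi>)\<in>A. U)" using atlas by (simp add: smooth_atlas_def)
  then obtain U \<phi> where U: "(U, \<phi>) \<in> A" "x \<in> U" by auto
  \<comment> \<open>Chart images are open in a space of positive dimension, since an index type is
    nonempty; singletons are not open there.\<close>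
  have "\<phi> ` U \<noteq> {\<phi> x}" using chart_facts(2)[OF U(1)] not_open_singleton by metis
  then obtain y where "y \<in> U" "\<phi> y \<noteq> \<phi> x" using U(2) by blast
  then show ?thesis by auto
qed

text \<open>The factor |d|^2 / 2 is positive off the diagonal, so the sign of W decides on which
  side of \<open>K * F x t\<close> the ball curvature lies.\<close>

lemma two_point_ball_curvature:
  assumes "t \<in> I" "x \<noteq> y"
  shows "two_point K x y t = (norm (X y t - X x t))\<^sup>2 / 2 * (K * F x t - ball_curvature X \<nu> x y t)"
proof -
  have "norm (X y t - X x t) \<noteq> 0" using inj_X[OF assms(1)] assms(2) by auto
  moreover have "(X x t - X y t) \<bullet> \<nu> x t = - ((X y t - X x t) \<bullet> \<nu> x t)" by (simp add: inner_diff_left)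
  ultimately show ?thesis
    by (simp add: two_point_def chord_fun_def ball_curvature_def norm_minus_commute[of "X x t"] power2_norm_eq_inner[symmetric] field_simps)
qed

lemma two_point_sign:
  assumes "t \<in> I"
  shows "0 \<le> \<epsilon> * two_point K x y t \<longleftrightarrow> x = y \<or> 0 \<le> \<epsilon> * (K * F x t - ball_curvature X \<nu> x y t)"
proof (cases "x = y")
  case False
  define D where "D = (norm (X y t - X x t))\<^sup>2 / 2"
  have D: "0 < D" using inj_X[OF assms] False by (auto simp: D_def)
  have "\<epsilon> * two_point K x y t = D * (\<epsilon> * (K * F x t - ball_curvature X \<nu> x y t))"
    unfolding two_point_ball_curvature[OF assms False] D_def by simp
  then show ?thesis
    using False mult_le_cancel_left_pos[OF D, of 0 "\<epsilon> * (K * F x t - ball_curvature X \<nu> x y t)"]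
    by (simp only: mult_zero_right simp_thms)
qed (simp add: two_point_def chord_fun_def)

lemma ball_curvature_bounded:
  assumes t: "t \<in> I"
  shows "\<exists>C>0. \<forall>x y. x \<noteq> y \<longrightarrow> \<bar>ball_curvature X \<nu> x y t\<bar> \<le> C"
proof -
  obtain C where C: "C > 0" "\<And>x y. \<bar>(X y t - X x t) \<bullet> \<nu> x t\<bar> \<le> C * (norm (X y t - X x t))\<^sup>2"
    using quadratic_bound[OF t t] by auto
  have "\<bar>ball_curvature X \<nu> x y t\<bar> \<le> 2 * C" if "x \<noteq> y" for x y
  proof -
    have n: "0 < (norm (X x t - X y t))\<^sup>2" using inj_X[OF t] that by auto
    have "(X x t - X y t) \<bullet> \<nu> x t = - ((X y t - X x t) \<bullet> \<nu> x t)" by (simp add: inner_diff_left)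
    then have "\<bar>(X x t - X y t) \<bullet> \<nu> x t\<bar> \<le> C * (norm (X x t - X y t))\<^sup>2"
      using C(2)[of y x] by (simp add: norm_minus_commute)
    then show ?thesis using n by (simp add: ball_curvature_def abs_mult field_simps)
  qed
  then show ?thesis using C(1) by (intro exI[of _ "2 * C"]) auto
qed

text \<open>Real suprema and infima are meaningful only over nonempty bounded sets. Nonemptiness is
  \<open>other_point\<close>; boundedness is the quadratic bound, combined with the positive lower
  bound of \<open>F\<close> for the ratios.\<close>

lemma sphere_curvature_facts:
  assumes t: "t \<in> I"
  shows "x \<noteq> y \<Longrightarrow> ball_curvature X \<nu> x y t \<le> interior_sphere_curvature X \<nu> x t"
    and "x \<noteq> y \<Longrightarrow> exterior_sphere_curvature X \<nu> x t \<le> ball_curvature X \<nu> x y t"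
    and "(\<And>y. x \<noteq> y \<Longrightarrow> ball_curvature X \<nu> x y t \<le> c) \<Longrightarrow> interior_sphere_curvature X \<nu> x t \<le> c"
    and "(\<And>y. x \<noteq> y \<Longrightarrow> c \<le> ball_curvature X \<nu> x y t) \<Longrightarrow> c \<le> exterior_sphere_curvature X \<nu> x t"
    and "bdd_above (range (\<lambda>x. interior_sphere_curvature X \<nu> x t / F x t))"
    and "bdd_below (range (\<lambda>x. exterior_sphere_curvature X \<nu> x t / F x t))"
proof -
  obtain C where C: "C > 0" "\<And>x y. x \<noteq> y \<Longrightarrow> \<bar>ball_curvature X \<nu> x y t\<bar> \<le> C"
    using ball_curvature_bounded[OF t] by blast
  obtain m where m: "m > 0" "\<And>x. m \<le> F x t" using speed_bounds[OF t t] by auto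
  have ne: "- {x} \<noteq> {}" for x :: 'm using other_point[of x] by blast
  have bdd: "bdd_above ((\<lambda>y. ball_curvature X \<nu> x y t) ` (- {x}))" "bdd_below ((\<lambda>y. ball_curvature X \<nu> x y t) ` (- {x}))" for x
    using C(2)[of x] by (force simp: abs_le_iff intro!: bdd_aboveI2[of _ _ C] bdd_belowI2[of _ "- C"])+
  show "x \<noteq> y \<Longrightarrow> ball_curvature X \<nu> x y t \<le> interior_sphere_curvature X \<nu> x t" for x y
    unfolding interior_sphere_curvature_def by (rule cSUP_upper[OF _ bdd(1)]) auto
  show "x \<noteq> y \<Longrightarrow> exterior_sphere_curvature X \<nu> x t \<le> ball_curvature X \<nu> x y t" for x y
    unfolding exterior_sphere_curvature_def by (rule cINF_lower[OF bdd(2)]) auto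
  show int: "(\<And>y. x \<noteq> y \<Longrightarrow> ball_curvature X \<nu> x y t \<le> c) \<Longrightarrow> interior_sphere_curvature X \<nu> x t \<le> c" for x c
    unfolding interior_sphere_curvature_def by (rule cSUP_least[OF ne]) auto
  show ext: "(\<And>y. x \<noteq> y \<Longrightarrow> c \<le> ball_curvature X \<nu> x y t) \<Longrightarrow> c \<le> exterior_sphere_curvature X \<nu> x t" for x c
    unfolding exterior_sphere_curvature_def by (rule cINF_greatest[OF ne]) auto
  have CF: "C \<le> C / m * F x t" for x
  proof -
    have "C / m * m \<le> C / m * F x t" using m(2)[of x] m(1) C(1) by (intro mult_left_mono) auto
    then show ?thesis using m(1) by simp
  qed
  have Fp: "0 < F x t" for x by (rule F_pos[OF t])
  show "bdd_above (range (\<lambda>x. interior_sphere_curvature X \<nu> x t / F x t))"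
  proof (rule bdd_aboveI2)
    fix x
    have "interior_sphere_curvature X \<nu> x t \<le> C" by (rule int) (use C(2) in \<open>auto simp: abs_le_iff\<close>)
    then show "interior_sphere_curvature X \<nu> x t / F x t \<le> C / m" using CF[of x] Fp[of x] by (simp add: pos_divide_le_eq)
  qed
  show "bdd_below (range (\<lambda>x. exterior_sphere_curvature X \<nu> x t / F x t))"
  proof (rule bdd_belowI2)
    fix x
    have "- C \<le> exterior_sphere_curvature X \<nu> x t" by (rule ext) (use C(2) in \<open>force simp: abs_le_iff\<close>)
    then show "- (C / m) \<le> exterior_sphere_curvature X \<nu> x t / F x t" using CF[of x] Fp[of x] by (simp add: pos_le_divide_eq)
  qed
qed

text \<open>With \<open>K\<close> the infimum at the earlier time, the sign condition holds there by
  definition; its persistence says that \<open>K\<close> is still a lower bound at the later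
  time.\<close>

lemma exterior_ratio_mono:
  assumes cv: "convex_on \<Gamma> f"
  shows "mono_on I (\<lambda>t. INF x. exterior_sphere_curvature X \<nu> x t / F x t)"
proof (rule mono_onI)
  fix s t assume st: "s \<in> I" "t \<in> I" "s \<le> t"
  define K where "K = (INF x. exterior_sphere_curvature X \<nu> x s / F x s)"
  have init: "0 \<le> (-1) * two_point K x y s" for x y
  proof -
    have "K \<le> exterior_sphere_curvature X \<nu> x s / F x s"
      unfolding K_def by (rule cINF_lower[OF sphere_curvature_facts(6)[OF st(1)]]) simp
    then have "K * F x s \<le> exterior_sphere_curvature X \<nu> x s" using F_pos[OF st(1), of x] by (simp add: pos_le_divide_eq)
    then show ?thesis using sphere_curvature_facts(2)[OF st(1), of x y] unfolding two_point_sign[OF st(1)] by fastforce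
  qed
  show "K \<le> (INF x. exterior_sphere_curvature X \<nu> x t / F x t)"
  proof (rule cINF_greatest)
    fix x
    have "K * F x t \<le> exterior_sphere_curvature X \<nu> x t"
    proof (rule sphere_curvature_facts(4)[OF st(2)])
      fix y assume "x \<noteq> y"
      moreover have "0 \<le> (-1) * two_point K x y t"
        by (rule two_point_preserved[OF st]) (use cv init in \<open>auto simp: curv_sign_def\<close>)
      ultimately show "K * F x t \<le> ball_curvature X \<nu> x y t" unfolding two_point_sign[OF st(2)] by auto
    qed
    then show "K \<le> exterior_sphere_curvature X \<nu> x t / F x t" using F_pos[OF st(2), of x] by (simp add: pos_le_divide_eq)
  qed simp
qed

lemma interior_ratio_antimono:
  assumes cv: "concave_on \<Gamma> f"
  shows "antimono_on I (\<lambda>t. SUP x. interior_sphere_curvature X \<nu> x t / F x t)"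
proof (rule monotone_onI)
  fix s t assume st: "s \<in> I" "t \<in> I" "s \<le> t"
  define K where "K = (SUP x. interior_sphere_curvature X \<nu> x s / F x s)"
  have init: "0 \<le> 1 * two_point K x y s" for x y
  proof -
    have "interior_sphere_curvature X \<nu> x s / F x s \<le> K"
      unfolding K_def by (rule cSUP_upper[OF _ sphere_curvature_facts(5)[OF st(1)]]) simp
    then have "interior_sphere_curvature X \<nu> x s \<le> K * F x s" using F_pos[OF st(1), of x] by (simp add: pos_divide_le_eq)
    then show ?thesis using sphere_curvature_facts(1)[OF st(1), of x y] unfolding two_point_sign[OF st(1)] by fastforce
  qed
  show "(SUP x. interior_sphere_curvature X \<nu> x t / F x t) \<le> K"
  proof (rule cSUP_least)
    fix x
    have "interior_sphere_curvature X \<nu> x t \<le> K * F x t"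
    proof (rule sphere_curvature_facts(3)[OF st(2)])
      fix y assume "x \<noteq> y"
      moreover have "0 \<le> 1 * two_point K x y t"
        by (rule two_point_preserved[OF st]) (use cv init in \<open>auto simp: curv_sign_def\<close>)
      ultimately show "ball_curvature X \<nu> x y t \<le> K * F x t" unfolding two_point_sign[OF st(2)] by auto
    qed
    then show "interior_sphere_curvature X \<nu> x t / F x t \<le> K" using F_pos[OF st(2), of x] by (simp add: pos_divide_le_eq)
  qed simp
qed

end


theorem corollary3:
  fixes A :: "('m::t2_space, 'n::finite) chart set"
    and X :: "'m \<Rightarrow> real \<Rightarrow> real^'k::finite"
    and \<nu> :: "'m \<Rightarrow> real \<Rightarrow> real^'k"
    and \<Omega> :: "real \<Rightarrow> (real^'k) set"
    and \<kappa> :: "'m \<Rightarrow> real \<Rightarrow> real^'n"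
    and F :: "'m \<Rightarrow> real \<Rightarrow> real"
    and f :: "real^'n \<Rightarrow> real"
    and \<Gamma> :: "(real^'n) set"
    and T :: ereal
  assumes "CARD('k) = CARD('n) + 1"
    and "0 < T"
    and "compact (UNIV :: 'm set)"
    and "smooth_atlas A"
    and "smooth_family A T X"
    and "\<And>t. t \<in> time_interval T \<Longrightarrow> smooth_embedding A (\<lambda>x. X x t)"
    and "\<And>t. t \<in> time_interval T \<Longrightarrow> compact_region_bounded_by (\<Omega> t) (range (\<lambda>x. X x t))"
    and "\<And>x t. t \<in> time_interval T \<Longrightarrow> outward_unit_normal A (\<lambda>x. X x t) (\<Omega> t) x (\<nu> x t)"
    and "\<And>x t. t \<in> time_interval T \<Longrightarrow> principal_curvatures A (\<lambda>x. X x t) (\<nu> x t) x (\<kappa> x t)"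
    and "admissible_cone \<Gamma>"
    and "admissible_speed \<Gamma> f"
    and "\<And>x t. t \<in> time_interval T \<Longrightarrow> \<kappa> x t \<in> \<Gamma>"
    and "\<And>x t. t \<in> time_interval T \<Longrightarrow> F x t = f (\<kappa> x t)"
    and "\<And>x t. t \<in> time_interval T \<Longrightarrow>
           ((\<lambda>s. X x s) has_vector_derivative - (F x t *\<^sub>R \<nu> x t)) (at t within time_interval T)"
    and "\<And>x t. t \<in> time_interval T \<Longrightarrow> 0 < F x t"
  shows "(convex_on \<Gamma> f \<longrightarrow>
            mono_on (time_interval T) (\<lambda>t. INF x. exterior_sphere_curvature X \<nu> x t / F x t)) \<and>
         (concave_on \<Gamma> f \<longrightarrow>
            antimono_on (time_interval T) (\<lambda>t. SUP x. interior_sphere_curvature X \<nu> x t / F x t))"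
proof -
  interpret curvature_flow \<Gamma> f A X \<nu> \<Omega> \<kappa> F T
    by (intro curvature_flow.intro speed.intro curvature_flow_axioms.intro assms)
  show ?thesis using exterior_ratio_mono interior_ratio_antimono by blast
qed

end
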